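(* Let $n\ge1$ and let $P\subseteq[0,1]^n$ be a one-dimensional polyhedron. Then $P$ is a $\mathbb{Z}$-retract of $[0,1]^n$ if and only if $P$ satisfies the following three conditions: (i) $P$ is contractible; (ii) $P$ contains a vertex of $[0,1]^n$; (iii) $P$ has a strongly regular triangulation. Moreover, for such one-dimensional $P$, condition (i) is equivalent to saying that $P$ is connected and simply connected, i.e., that $P$ is a tree.
   Context: A polyhedron in $[0,1]^n$ is a finite union of (closed) simplexes contained in $[0,1]^n$; it is rational if the simplexes can be chosen with rational vertices. A triangulation of a polyhedron $P$ is a finite simplicial complex $\Delta$ (of closed simplexes) whose point-set union $|\Delta|$ is $P$. $\mathbb{Z}$-maps and $\mathbb{Z}$-retracts: for rational polyhedra $P\subseteq[0,1]^n$, $Q\subseteq[0,1]^m$, a map $\eta\colon P\to Q$ is a $\mathbb{Z}$-map if there is a triangulation $\mathcal K$ of $P$ such that on every simplex $T\in\mathcal K$, $\eta$ coincides with an (affine) linear map with integer coefficients, i.e. $x\mapsto Mx+b$ with $M\in\mathbb{Z}^{m\times n}$, $b\in\mathbb{Z}^m$. A $\mathbb{Z}$-retraction of $P$ is a $\mathbb{Z}$-map $\sigma\colon P\to P$ with $\sigma\circ\sigma=\sigma$; the set $\sigma(P)$ is then called a $\mathbb{Z}$-retract of $P$. Regularity: for a rational point $v\in\mathbb{R}^n$, $\operatorname{den}(v)$ is the least common denominator of the coordinates of $v$, and $\widetilde v=\operatorname{den}(v)(v,1)\in\mathbb{Z}^{n+1}$. A simplex $\operatorname{conv}(w_0,\dots,w_m)\subseteq[0,1]^n$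 is regular if its vertices are rational and $\{\widetilde{w_0},\dots,\widetilde{w_m}\}$ can be extended to a basis of the free abelian group $\mathbb{Z}^{n+1}$. A triangulation is regular if all its simplexes are regular. It is strongly regular if it is regular and, for each of its maximal simplexes, the greatest common divisor of the denominators of the vertices of that simplex is $1$. *)

theory Defs
  imports "HOL-Analysis.Analysis"
begin

definition is_simplex :: "'a::euclidean_space set \<Rightarrow> bool" where
  "is_simplex S \<longleftrightarrow> (\<exists>d. d simplex S)"

(* For a simplex conv {w0, ..., wm} this is {w0, ..., wm}. *)
definition vertices :: "'a::real_vector set \<Rightarrow> 'a set" where
  "vertices S = {v. v extreme_point_of S}"

abbreviation unit_cube :: "(real ^ 'n) set" where
  "unit_cube \<equiv> cbox 0 1"

(* Not the library's polyhedron, which is an intersection of half-spaces. The library's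
   simplexes, and hence its simplicial complexes, include the empty simplex of dimension -1;
   this is harmless throughout. *)
definition cube_polyhedron :: "(real ^ 'n) set \<Rightarrow> bool" where
  "cube_polyhedron P \<longleftrightarrow>
     (\<exists>\<C>. finite \<C> \<and> (\<forall>S\<in>\<C>. is_simplex S \<and> S \<subseteq> unit_cube) \<and> \<Union>\<C> = P)"

definition rational_point :: "real ^ 'n \<Rightarrow> bool" where
  "rational_point v \<longleftrightarrow> (\<forall>i. v $ i \<in> \<rat>)"

definition rational_polyhedron :: "(real ^ 'n) set \<Rightarrow> bool" where
  "rational_polyhedron P \<longleftrightarrow>
     (\<exists>\<C>. finite \<C> \<and>
        (\<forall>S\<in>\<C>. is_simplex S \<and> S \<subseteq> unit_cube \<and> (\<forall>v\<in>vertices S. rational_point v)) \<and>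
        \<Union>\<C> = P)"

(* The dimension of a finite union of simplexes is the largest dimension of these simplexes
   (which does not depend on how the union is written); lower-dimensional parts are allowed. *)
definition polyhedron_has_dim :: "(real ^ 'n) set \<Rightarrow> int \<Rightarrow> bool" where
  "polyhedron_has_dim P d \<longleftrightarrow>
     (\<exists>\<C>. finite \<C> \<and> (\<forall>S\<in>\<C>. is_simplex S) \<and> \<Union>\<C> = P \<and>
        (\<forall>S\<in>\<C>. aff_dim S \<le> d) \<and> (\<exists>S\<in>\<C>. aff_dim S = d))"

(* The library's predicate triangulation does not require closure under faces. *)
definition triangulates :: "'a::euclidean_space set set \<Rightarrow> 'a set \<Rightarrow> bool" where
  "triangulates \<K> P \<longleftrightarrow> simplicial_complex \<K> \<and> \<Union>\<K> = P"

definition z_map :: "(real ^ 'n) set \<Rightarrow> (real ^ 'm) set \<Rightarrow> (real ^ 'n \<Rightarrow> real ^ 'm) \<Rightarrow> bool" where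
  "z_map P Q \<eta> \<longleftrightarrow>
     rational_polyhedron P \<and> rational_polyhedron Q \<and> \<eta> ` P \<subseteq> Q \<and>
     (\<exists>\<K>. triangulates \<K> P \<and>
        (\<forall>T\<in>\<K>. \<exists>(M :: real ^ 'n ^ 'm) b.
           (\<forall>i j. M $ i $ j \<in> \<int>) \<and> (\<forall>i. b $ i \<in> \<int>) \<and> (\<forall>x\<in>T. \<eta> x = M *v x + b)))"

definition z_retraction :: "(real ^ 'n) set \<Rightarrow> (real ^ 'n \<Rightarrow> real ^ 'n) \<Rightarrow> bool" where
  "z_retraction P \<sigma> \<longleftrightarrow> z_map P P \<sigma> \<and> (\<forall>x\<in>P. \<sigma> (\<sigma> x) = \<sigma> x)"

definition z_retract :: "(real ^ 'n) set \<Rightarrow> (real ^ 'n) set \<Rightarrow> bool" where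
  "z_retract R P \<longleftrightarrow> (\<exists>\<sigma>. z_retraction P \<sigma> \<and> \<sigma> ` P = R)"

definition den :: "real ^ 'n \<Rightarrow> nat" where
  "den v = (LEAST d. d > 0 \<and> (\<forall>i. real d * v $ i \<in> \<int>))"

definition homog :: "real ^ 'n \<Rightarrow> (real ^ 'n) \<times> real" where
  "homog v = real (den v) *\<^sub>R (v, 1)"

(* The free abelian group of rank n + 1, as the integer points of R^n x R. *)
definition int_lattice :: "((real ^ 'n) \<times> real) set" where
  "int_lattice = {(x, t). (\<forall>i. x $ i \<in> \<int>) \<and> t \<in> \<int>}"

definition zscale :: "int \<Rightarrow> 'a::real_vector \<Rightarrow> 'a" where
  "zscale k v = of_int k *\<^sub>R v"

lemma module_zscale: "module zscale"
  by unfold_locales (simp_all add: zscale_def algebra_simps)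

(* Independence and span are taken over the integers. *)
definition lattice_basis :: "((real ^ 'n) \<times> real) set \<Rightarrow> bool" where
  "lattice_basis B \<longleftrightarrow> \<not> module.dependent zscale B \<and> module.span zscale B = int_lattice"

definition regular_simplex :: "(real ^ 'n) set \<Rightarrow> bool" where
  "regular_simplex S \<longleftrightarrow>
     is_simplex S \<and> S \<subseteq> unit_cube \<and> (\<forall>v\<in>vertices S. rational_point v) \<and>
     (\<exists>B. homog ` vertices S \<subseteq> B \<and> lattice_basis B)"

definition regular_complex :: "(real ^ 'n) set set \<Rightarrow> bool" where
  "regular_complex \<K> \<longleftrightarrow> (\<forall>S\<in>\<K>. regular_simplex S)"

definition strongly_regular_complex :: "(real ^ 'n) set set \<Rightarrow> bool" where
  "strongly_regular_complex \<K> \<longleftrightarrow>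
     regular_complex \<K> \<and>
     (\<forall>S\<in>\<K>. (\<forall>T\<in>\<K>. S \<subseteq> T \<longrightarrow> T = S) \<longrightarrow> Gcd (den ` vertices S) = 1)"

definition complex_vertices :: "'a::euclidean_space set set \<Rightarrow> 'a set" where
  "complex_vertices \<K> = {v. {v} \<in> \<K>}"

definition complex_adj :: "'a::euclidean_space set set \<Rightarrow> 'a \<Rightarrow> 'a \<Rightarrow> bool" where
  "complex_adj \<K> u v \<longleftrightarrow> u \<noteq> v \<and> closed_segment u v \<in> \<K>"

(* The underlying space of a finite simplicial complex of dimension at most 1 which is, as a
   graph, nonempty, connected and without cycles. *)
definition tree :: "'a::euclidean_space set \<Rightarrow> bool" where
  "tree P \<longleftrightarrow>
     (\<exists>\<K>. triangulates \<K> P \<and> (\<forall>S\<in>\<K>. aff_dim S \<le> 1) \<and>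
        complex_vertices \<K> \<noteq> {} \<and>
        (\<forall>u\<in>complex_vertices \<K>. \<forall>v\<in>complex_vertices \<K>. (complex_adj \<K>)\<^sup>*\<^sup>* u v) \<and>
        \<not> (\<exists>vs. length vs \<ge> 3 \<and> distinct vs \<and>
             (\<forall>i<length vs. complex_adj \<K> (vs ! i) (vs ! (Suc i mod length vs)))))"

end

theory Submission
  imports Defs
begin

text \<open>
  If \<open>\<sigma>\<close> is a retraction of the cube onto P, then P is contractible and contains the vertex \<open>\<sigma> 0\<close>. Each
  full-dimensional simplex is mapped into the range of an integral affine map, which is a rational
  line through an integer point, because P is one-dimensional. So P is a union of segments on
  finitely many such lines. Their end points are rational: at an irrational point all affine pieces
  agree with the identity of the line. Cutting P at all its rational points of denominator at most N
  gives Farey neighbours on each line, that is, regular edges with coprime denominators.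

  Conversely, let P be a tree with such a triangulation, rooted at a vertex of the cube. By regularity
  the hat functions of the vertices extend to integral piecewise linear functions on the cube, and these
  can be normalized to weights in the simplex spanned by all vertices, since the root has
  denominator 1. Going from the leaves to the root, each vertex is decoupled from all its
  predecessors except its parent by trading weights; coprimality of the denominators along an edge
  is what makes this trade integral. The remaining weights are coordinates of a point of P.

  Contractibility is related to trees as graphs by wrapping an edge around the circle: if P is
  simply connected, that map has a logarithm, hence the edge is a bridge.
\<close>

section \<open>Segments and affine hulls\<close>

text \<open>What an integral map retains of a point on an edge is its pair of coefficients with
  respect to the two homogenized vertices. Weights \<open>c i\<close> with
  \<open>den i * c i\<close> summing to 1 are therefore the right coordinates for the converse, and
  the denominators enter every balance of weights. Working in the simplex of weights reduces the
  construction to steps that concern one vertex each; what has to be watched is that a step neither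
  moves weights coming from P nor spoils decouplings obtained before. The first holds because
  vertices weighted at a point of P lie on one edge, the second because a vertex has only one
  neighbour among its predecessors. In the other direction the triangulation that witnesses the
  Z-map is of little use in P: its vertices may be irrational and the images of its simplexes may
  overlap. Only the lines spanned by these images are kept, and P is cut anew along them. Dimension
  1 is given for one cover of P only. It passes to every simplex in P because a convex set inside a
  finite union lies in the affine hull of a single member.\<close>

lemma affine_Int_segment_unique:
  fixes L :: "'a::real_vector set"
  assumes "affine L" "y \<notin> L" "u \<in> L \<inter> closed_segment x y" "v \<in> L \<inter> closed_segment x y"
  shows "u = v"
proof (rule ccontr)
  assume "u \<noteq> v"
  obtain s where s: "u = (1 - s) *\<^sub>R x + s *\<^sub>R y" using assms(3) by (auto simp: in_segment)
  obtain t where t: "v = (1 - t) *\<^sub>R x + t *\<^sub>R y" using assms(4) by (auto simp: in_segment)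
  have "s \<noteq> t" using s t \<open>u \<noteq> v\<close> by auto
  \<comment> \<open>Solves \<open>(1 - r) * s + r * t = 1\<close>: on the line through
    \<open>u\<close> and \<open>v\<close> this is the parameter of \<open>y\<close>.\<close>
  define r where "r = (1 - s) / (t - s)"
  have r: "(1 - r) * s + r * t = 1"
  proof -
    have "r * (t - s) = 1 - s" using \<open>s \<noteq> t\<close> by (simp add: r_def)
    then show ?thesis by (simp add: algebra_simps)
  qed
  have "(1 - r) *\<^sub>R u + r *\<^sub>R v = (1 - ((1 - r) * s + r * t)) *\<^sub>R x + ((1 - r) * s + r * t) *\<^sub>R y"
    by (simp add: s t algebra_simps)
  then have "(1 - r) *\<^sub>R u + r *\<^sub>R v = y" using r by simp
  moreover have "(1 - r) *\<^sub>R u + r *\<^sub>R v \<in> L"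
    using assms by (intro mem_affine) auto
  ultimately show False using assms(2) by simp
qed

lemma finite_affine_Int_segment:
  assumes "affine L" "y \<notin> L"
  shows "finite (L \<inter> closed_segment x y)"
proof (cases "L \<inter> closed_segment x y = {}")
  case False
  then obtain u where "u \<in> L \<inter> closed_segment x y" by blast
  then have "L \<inter> closed_segment x y \<subseteq> {u}"
    using affine_Int_segment_unique[OF assms] by blast
  then show ?thesis using finite_subset by blast
qed auto

text \<open>Otherwise S contains a point x outside L and a point y outside all remaining subspaces.
  Each subspace misses an end of the segment from x to y and so meets it at most once, which leaves
  only finitely many points for the whole segment.\<close>

lemma convex_subset_Union_affine:
  fixes S :: "'a::euclidean_space set"
  assumes "finite \<F>" "\<And>L. L \<in> \<F> \<Longrightarrow> affine L" "convex S" "S \<noteq> {}" "S \<subseteq> \<Union>\<F>"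
  obtains L where "L \<in> \<F>" "S \<subseteq> L"
proof -
  have "\<exists>L\<in>\<F>. S \<subseteq> L"
    using assms(1,2,5)
  proof (induction \<F>)
    case empty
    then show ?case using assms(4) by auto
  next
    case (insert L \<F>)
    show ?case
    proof (rule ccontr)
      assume "\<not> ?thesis"
      then have "\<not> S \<subseteq> L" "\<not> S \<subseteq> \<Union>\<F>" using insert by auto
      then obtain x y where x: "x \<in> S" "x \<notin> L" and y: "y \<in> S" "y \<notin> \<Union>\<F>" by blast
      then have "x \<noteq> y" using insert.prems by blast
      have seg: "closed_segment x y \<subseteq> S" using assms(3) x y by (simp add: closed_segment_subset)
      have "z \<in> (L \<inter> closed_segment y x) \<union> (\<Union>M\<in>\<F>. M \<inter> closed_segment x y)"
        if "z \<in> closed_segment x y" for z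
      proof -
        have "z \<in> L \<or> (\<exists>M\<in>\<F>. z \<in> M)" using that seg insert.prems(2) by auto
        moreover have "z \<in> closed_segment y x" using that by (subst closed_segment_commute)
        ultimately show ?thesis using that by auto
      qed
      then have "closed_segment x y \<subseteq> (L \<inter> closed_segment y x) \<union> (\<Union>M\<in>\<F>. M \<inter> closed_segment x y)"
        by (rule subsetI)
      moreover have "finite (L \<inter> closed_segment y x)"
        using insert.prems x by (intro finite_affine_Int_segment) auto
      moreover have "finite (\<Union>M\<in>\<F>. M \<inter> closed_segment x y)"
        using insert y by (intro finite_UN_I finite_affine_Int_segment) auto
      ultimately have "finite (closed_segment x y)"
        by (rule finite_subset[OF _ finite_UnI])
      then show False using \<open>x \<noteq> y\<close> by (simp add: finite_closed_segment)
    qed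
  qed
  then show ?thesis using that by blast
qed

text \<open>This transfers the dimension from one known cover to every convex subset, in particular
  to the simplexes of an arbitrary triangulation and to images of simplexes under the
  retraction.\<close>

lemma aff_dim_convex_subset_Union:
  fixes S :: "'a::euclidean_space set"
  assumes "finite \<C>" "\<And>C. C \<in> \<C> \<Longrightarrow> aff_dim C \<le> d" "convex S" "S \<subseteq> \<Union>\<C>" "-1 \<le> d"
  shows "aff_dim S \<le> d"
proof (cases "S = {}")
  case False
  define \<L> where "\<L> = (\<lambda>C. affine hull C) ` \<C>"
  have sub: "S \<subseteq> \<Union>\<L>"
  proof
    fix x assume "x \<in> S"
    then obtain C where "C \<in> \<C>" "x \<in> C" using assms(4) by auto
    then show "x \<in> \<Union>\<L>" unfolding \<L>_def using hull_inc[of x C affine] by blast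
  qed
  have fin: "finite \<L>" unfolding \<L>_def using assms(1) by (rule finite_imageI)
  have aff: "affine L" if "L \<in> \<L>" for L
    using that unfolding \<L>_def by (elim imageE) (simp add: affine_affine_hull)
  obtain L where "L \<in> \<L>" "S \<subseteq> L"
    using convex_subset_Union_affine[OF fin aff assms(3) False sub] .
  then obtain C where "C \<in> \<C>" "S \<subseteq> affine hull C" unfolding \<L>_def by blast
  then show ?thesis using assms(2)[of C] aff_dim_subset[of S "affine hull C"] by simp
qed (use assms in simp)

text \<open>The affine hulls of the smaller pieces do not exhaust C. From a point y outside them,
  the segment to any x meets these hulls finitely often, so x is a limit of points in pieces of full
  dimension, whose union is closed.\<close>

lemma convex_eq_Union_full_dim:
  fixes C :: "'a::euclidean_space set"
  assumes "finite \<K>" "\<And>T. T \<in> \<K> \<Longrightarrow> closed T" "\<Union>\<K> = C" "convex C" "aff_dim C = d"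
  shows "\<Union>{T \<in> \<K>. aff_dim T = d} = C"
proof
  show "\<Union>{T \<in> \<K>. aff_dim T = d} \<subseteq> C" using assms(3) by auto
  define \<L> where "\<L> = (hull) affine ` {T \<in> \<K>. aff_dim T \<noteq> d}"
  have fL: "finite \<L>" "\<And>L. L \<in> \<L> \<Longrightarrow> affine L" using assms by (auto simp: \<L>_def)
  show "C \<subseteq> \<Union>{T \<in> \<K>. aff_dim T = d}"
  proof
    fix x assume x: "x \<in> C"
    have "\<not> C \<subseteq> \<Union>\<L>"
    proof
      assume "C \<subseteq> \<Union>\<L>"
      then obtain L where L: "L \<in> \<L>" "C \<subseteq> L"
        using convex_subset_Union_affine[of \<L> C] fL assms(4) x by auto
      then obtain T where T: "T \<in> \<K>" "aff_dim T \<noteq> d" "C \<subseteq> affine hull T" by (auto simp: \<L>_def)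
      have "aff_dim C \<le> aff_dim T" using T(3) aff_dim_subset aff_dim_affine_hull by metis
      moreover have "aff_dim T \<le> aff_dim C" using T(1) assms(3) by (intro aff_dim_subset) auto
      ultimately show False using T(2) assms(5) by simp
    qed
    then obtain y where y: "y \<in> C" "y \<notin> \<Union>\<L>" by auto
    define U where "U = \<Union>{T \<in> \<K>. aff_dim T = d}"
    have clU: "closed U" unfolding U_def using assms by (intro closed_Union) auto
    show "x \<in> \<Union>{T \<in> \<K>. aff_dim T = d}"
    proof (cases "x = y")
      case True
      obtain T where T: "T \<in> \<K>" "x \<in> T" using x assms(3) by auto
      then have "T \<subseteq> affine hull T" by (simp add: hull_subset)
      then show ?thesis using T y True unfolding \<L>_def by blast
    next
      case False
      have fin: "finite (\<Union>L\<in>\<L>. L \<inter> closed_segment x y)"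
        using y fL by (intro finite_UN_I finite_affine_Int_segment) auto
      have sub: "closed_segment x y - (\<Union>L\<in>\<L>. L \<inter> closed_segment x y) \<subseteq> U"
      proof
        fix z assume z: "z \<in> closed_segment x y - (\<Union>L\<in>\<L>. L \<inter> closed_segment x y)"
        have "closed_segment x y \<subseteq> C" using x y assms(4) by (simp add: closed_segment_subset)
        then obtain T where T: "T \<in> \<K>" "z \<in> T" using z assms(3) by blast
        have "T \<subseteq> affine hull T" by (simp add: hull_subset)
        then show "z \<in> U" using T z unfolding U_def \<L>_def by blast
      qed
      have ne: "closed_segment x y \<noteq> {z}" for z
        using False ends_in_segment(1)[of x y] ends_in_segment(2)[of y x] by (metis singletonD)
      have "x islimpt closed_segment x y"
        by (rule connected_imp_perfect[OF connected_segment(1) ends_in_segment(1) ne])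
      then have "x islimpt ((\<Union>L\<in>\<L>. L \<inter> closed_segment x y) \<union> U)"
        by (rule islimpt_subset) (use sub in \<open>simp only: Diff_subset_conv\<close>)
      then have "x islimpt U" using islimpt_Un_finite[OF fin, of x U] by (rule iffD1[rotated])
      then have "x \<in> U" using clU by (simp add: closed_limpt)
      then show ?thesis unfolding U_def .
    qed
  qed
qed

lemma convex_aff_dim_le_1_cases:
  fixes S :: "'a::euclidean_space set"
  assumes "compact S" "convex S" "aff_dim S \<le> 1"
  obtains "S = {}" | v where "S = {v}" | a b where "a \<noteq> b" "S = closed_segment a b"
proof (cases "S = {}")
  case False
  have "collinear S" using assms(3) by (simp add: collinear_aff_dim)
  then obtain a b where ab: "S = closed_segment a b"
    using compact_convex_collinear_segment[OF False assms(1,2)] by blast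
  show ?thesis using ab that by (cases "a = b") auto
qed (use that in blast)

lemma face_of_closed_segment:
  fixes a b :: "'a::euclidean_space"
  shows "F face_of closed_segment a b \<longleftrightarrow> F = {} \<or> F = {a} \<or> F = {b} \<or> F = closed_segment a b"
proof -
  have "\<not> affine_dependent {a, b}" by (cases "a = b") (auto simp: affine_independent_2)
  then have "F face_of closed_segment a b \<longleftrightarrow> (\<exists>c\<subseteq>{a,b}. F = convex hull c)"
    unfolding segment_convex_hull by (rule face_of_convex_hull_affine_independent)
  moreover have c: "c \<subseteq> {a,b} \<longleftrightarrow> c = {} \<or> c = {a} \<or> c = {b} \<or> c = {a,b}" for c by blast
  have "(\<exists>c\<subseteq>{a,b}. F = convex hull c) \<longleftrightarrow> F = {} \<or> F = {a} \<or> F = {b} \<or> F = closed_segment a b"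
    unfolding c segment_convex_hull by (metis convex_hull_empty convex_hull_singleton)
  ultimately show ?thesis by simp
qed

lemma extreme_point_of_closed_segment:
  fixes a b :: "'a::euclidean_space"
  shows "v extreme_point_of closed_segment a b \<longleftrightarrow> v = a \<or> v = b"
proof -
  have "{v} = closed_segment a b \<Longrightarrow> v = a" using ends_in_segment(1)[of a b] by (metis singletonD)
  then show ?thesis
    unfolding face_of_singleton[symmetric] face_of_closed_segment
    by (metis insert_not_empty singleton_insert_inj_eq')
qed

lemma simplex_closed_segment:
  fixes a b :: "'a::euclidean_space"
  assumes "a \<noteq> b"
  shows "1 simplex closed_segment a b"
proof -
  have "\<not> affine_dependent {a,b}" by (rule affine_independent_2)
  moreover have "int (card {a,b}) = 1 + 1" using assms by simp
  ultimately show ?thesis unfolding simplex_def segment_convex_hull by blast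
qed

lemma simplex_singleton:
  fixes a :: "'a::euclidean_space"
  shows "0 simplex {a}"
  unfolding simplex_def by (intro exI[of _ "{a}"]) auto

text \<open>A parametrization of the common line reduces this to intervals of reals: an interval
  that reaches the interior of another without ending there must cover it.\<close>

lemma closed_segment_subset_of_cross:
  fixes S :: "'a::euclidean_space set"
  assumes col: "collinear S" and S: "{a, b, p, q} \<subseteq> S"
    and x: "x \<in> open_segment a b" "x \<in> closed_segment p q"
    and out: "p \<notin> open_segment a b" "q \<notin> open_segment a b"
  shows "closed_segment a b \<subseteq> closed_segment p q"
proof -
  obtain z u where zu: "\<forall>s\<in>S. \<exists>c. s = z + c *\<^sub>R u" using col collinear_alt[of S] by metis
  have "u \<noteq> 0"
  proof
    assume "u = 0" then have "a = b" using bspec[OF zu, of a] bspec[OF zu, of b] S by simp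
    then show False using x(1) by simp
  qed
  define f where "f = (\<lambda>c. z + c *\<^sub>R u)"
  have inj: "inj f" using \<open>u \<noteq> 0\<close> by (simp add: f_def inj_def)
  obtain \<alpha> \<beta> \<pi> \<kappa> where ab: "a = f \<alpha>" "b = f \<beta>" and pq: "p = f \<pi>" "q = f \<kappa>"
    using bspec[OF zu, of a] bspec[OF zu, of b] bspec[OF zu, of p] bspec[OF zu, of q] S
    unfolding f_def by auto
  have seg: "closed_segment (f s) (f t) = f ` closed_segment s t" for s t
  proof -
    have "f ` closed_segment s t = (+) z ` ((\<lambda>c. c *\<^sub>R u) ` closed_segment s t)"
      by (simp add: f_def image_image)
    also have "\<dots> = (+) z ` closed_segment (s *\<^sub>R u) (t *\<^sub>R u)"
      by (subst closed_segment_linear_image) (auto intro!: linearI simp: algebra_simps)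
    also have "\<dots> = closed_segment (f s) (f t)" by (simp add: f_def closed_segment_translation)
    finally show ?thesis by simp
  qed
  have oseg: "open_segment (f s) (f t) = f ` open_segment s t" for s t
    unfolding open_segment_def seg image_set_diff[OF inj] by simp
  obtain \<xi> where xi: "x = f \<xi>" "\<xi> \<in> open_segment \<alpha> \<beta>" using x(1) unfolding ab oseg by auto
  have 1: "\<xi> \<in> closed_segment \<pi> \<kappa>" using x(2) unfolding pq seg xi(1) by (simp add: inj_image_mem_iff[OF inj])
  have 2: "\<pi> \<notin> open_segment \<alpha> \<beta>" "\<kappa> \<notin> open_segment \<alpha> \<beta>" using out unfolding ab pq oseg by (simp_all add: inj_image_mem_iff[OF inj])
  have "closed_segment \<alpha> \<beta> \<subseteq> closed_segment \<pi> \<kappa>"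
    using xi(2) 1 2 by (simp add: open_segment_eq_real_ivl closed_segment_eq_real_ivl split: if_splits)
  then show ?thesis unfolding ab pq seg by (rule image_mono)
qed

section \<open>Triangulating finite unions of segments\<close>

text \<open>The members of \<open>\<C>\<close> cut at the points of \<open>V\<close>, so that edges
  join consecutive points. The empty set is a face of every simplex, hence closure under faces
  forces it in.\<close>

definition segment_complex :: "'a::euclidean_space set set \<Rightarrow> 'a set \<Rightarrow> 'a set set" where
  "segment_complex \<C> V = insert {} ((\<lambda>v. {v}) ` V \<union>
     {closed_segment a b |a b. a \<in> V \<and> b \<in> V \<and> a \<noteq> b \<and>
        (\<exists>S\<in>\<C>. closed_segment a b \<subseteq> S) \<and> open_segment a b \<inter> V = {}})"

text \<open>The last assumption with \<open>S = S'\<close> makes the end points of the members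
  vertices; for different members it adds the crossing points and the ends of overlaps, so that the
  pieces meet in common faces.\<close>

locale segment_cover =
  fixes \<C> :: "'a::euclidean_space set set" and V :: "'a set"
  assumes finite_cover: "finite \<C>"
    and compact_cover: "S \<in> \<C> \<Longrightarrow> compact S"
    and convex_cover: "S \<in> \<C> \<Longrightarrow> convex S"
    and dim_cover: "S \<in> \<C> \<Longrightarrow> aff_dim S \<le> 1"
    and finite_V: "finite V"
    and V_subset: "V \<subseteq> \<Union>\<C>"
    and extreme_in_V: "S \<in> \<C> \<Longrightarrow> S' \<in> \<C> \<Longrightarrow> v extreme_point_of (S \<inter> S') \<Longrightarrow> v \<in> V"
begin

lemma collinear_cover: "S \<in> \<C> \<Longrightarrow> collinear S"
  using dim_cover by (simp add: collinear_aff_dim)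

lemma Int_cover_segment:
  assumes "S \<in> \<C>" "S' \<in> \<C>" "x \<in> S \<inter> S'" "x \<notin> V"
  obtains p q where "p \<in> V" "q \<in> V" "S \<inter> S' = closed_segment p q"
proof -
  have "compact (S \<inter> S')" "convex (S \<inter> S')"
    using assms compact_cover convex_cover by (auto simp: compact_Int convex_Int)
  moreover have "aff_dim (S \<inter> S') \<le> 1"
    using aff_dim_subset[of "S \<inter> S'" S] dim_cover[OF assms(1)] by simp
  ultimately show ?thesis
  proof (cases rule: convex_aff_dim_le_1_cases)
    case 1
    then show ?thesis using assms by auto
  next
    case (2 v)
    then have "v extreme_point_of (S \<inter> S')" by (simp add: face_of_singleton[symmetric] face_of_refl)
    then have "v \<in> V" using extreme_in_V assms by blast
    then show ?thesis using 2 assms by auto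
  next
    case (3 a b)
    then have "a extreme_point_of (S \<inter> S')" "b extreme_point_of (S \<inter> S')"
      by (simp_all add: extreme_point_of_closed_segment)
    then show ?thesis using that[of a b] 3 extreme_in_V[OF assms(1,2)] by simp
  qed
qed

lemma nearest_vertex:
  assumes "p \<in> V" 
  obtains a where "a \<in> V" "a \<in> closed_segment p x" "closed_segment a x \<inter> V \<subseteq> {a}"
proof -
  have "finite (V \<inter> closed_segment p x)" "V \<inter> closed_segment p x \<noteq> {}" using finite_V assms by auto
  then obtain a where a: "a \<in> V \<inter> closed_segment p x"
    "\<And>v. v \<in> V \<inter> closed_segment p x \<Longrightarrow> dist a x \<le> dist v x"
    using ex_is_arg_min_if_finite[of _ "\<lambda>v. dist v x"] unfolding is_arg_min_linorder by blast
  have "v = a" if "v \<in> closed_segment a x \<inter> V" for v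
  proof (rule ccontr)
    assume "v \<noteq> a"
    have "closed_segment a x \<subseteq> closed_segment p x" using a by (simp add: subset_closed_segment)
    then have "dist a x \<le> dist v x" using a(2) that by auto
    moreover have "dist a x = dist a v + dist v x"
      using that by (auto simp: between_mem_segment[symmetric] between)
    ultimately show False using \<open>v \<noteq> a\<close> by simp
  qed
  then show ?thesis using that a by blast
qed

lemma cover_edge:
  assumes "S \<in> \<C>" "x \<in> S" "x \<notin> V"
  obtains a b where "a \<in> V" "b \<in> V" "a \<noteq> b" "closed_segment a b \<subseteq> S"
    "open_segment a b \<inter> V = {}" "x \<in> closed_segment a b"
proof -
  obtain p q where pq: "p \<in> V" "q \<in> V" "S = closed_segment p q"
    using Int_cover_segment[of S S x] assms by auto
  obtain a where a: "a \<in> V" "a \<in> closed_segment p x" "closed_segment a x \<inter> V \<subseteq> {a}"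
    using nearest_vertex pq by metis
  obtain b where b: "b \<in> V" "b \<in> closed_segment q x" "closed_segment b x \<inter> V \<subseteq> {b}"
    using nearest_vertex pq by metis
  have x: "x \<in> closed_segment p q" using pq assms by simp
  have bx: "between (p,q) x" "between (p,x) a" "between (q,x) b"
    using x a b by (auto simp: between_mem_segment)
  \<comment> \<open>The triangle inequality along \<open>p\<close>, \<open>a\<close>,
    \<open>b\<close>, \<open>q\<close> leaves no slack, so \<open>x\<close> lies between the nearest
    vertices on its two sides.\<close>
  have "dist p q = dist p x + dist x q" "dist p x = dist p a + dist a x" "dist q x = dist q b + dist b x"
    using bx by (simp_all add: between)
  moreover have "dist p q \<le> dist p a + dist a b + dist b q"
    using dist_triangle[of p q a] dist_triangle[of a q b] by simp
  moreover have "dist a b \<le> dist a x + dist x b" by (rule dist_triangle)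
  ultimately have "dist a b = dist a x + dist x b" by (simp add: dist_commute)
  then have xab: "x \<in> closed_segment a b" by (simp add: between between_mem_segment[symmetric])
  have un: "closed_segment a x \<union> closed_segment x b = closed_segment a b"
    using xab by (rule Un_closed_segment)
  have "open_segment a b \<inter> V = {}"
    using un a(3) b(3) closed_segment_commute[of b x] unfolding open_segment_def by blast
  moreover have "closed_segment a b \<subseteq> S"
  proof -
    have "closed_segment a x \<subseteq> closed_segment p q" "closed_segment b x \<subseteq> closed_segment p q"
      using a b x pq by (simp_all add: subset_closed_segment, meson closed_segment_subset convex_closed_segment ends_in_segment subset_iff)+
    then show ?thesis using un pq closed_segment_commute[of b x] by blast
  qed
  moreover have "a \<noteq> b" using xab a(1) assms(3) by auto
  ultimately show ?thesis using that a b xab by blast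
qed

lemma Union_segment_complex: "\<Union>(segment_complex \<C> V) = \<Union>\<C>"
proof
  show "\<Union>(segment_complex \<C> V) \<subseteq> \<Union>\<C>" using V_subset by (auto simp: segment_complex_def)
  show "\<Union>\<C> \<subseteq> \<Union>(segment_complex \<C> V)"
  proof
    fix x assume "x \<in> \<Union>\<C>"
    then obtain S where S: "S \<in> \<C>" "x \<in> S" by blast
    show "x \<in> \<Union>(segment_complex \<C> V)"
    proof (cases "x \<in> V")
      case False
      obtain a b where "a \<in> V" "b \<in> V" "a \<noteq> b" "closed_segment a b \<subseteq> S"
        "open_segment a b \<inter> V = {}" "x \<in> closed_segment a b" using cover_edge[OF S False] .
      then show ?thesis using S unfolding segment_complex_def by blast
    qed (auto simp: segment_complex_def)
  qed
qed

text \<open>The ends of \<open>S \<inter> S'\<close> belong to \<open>V\<close> and hence lie in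
  neither open edge. So both edges are contained in this intersection; being collinear and crossing,
  they then contain each other.\<close>

lemma edges_eq_if_cross:
  assumes ab: "a \<in> V" "b \<in> V" "closed_segment a b \<subseteq> S" "S \<in> \<C>" "open_segment a b \<inter> V = {}"
    and cd: "c \<in> V" "d \<in> V" "closed_segment c d \<subseteq> S'" "S' \<in> \<C>" "open_segment c d \<inter> V = {}"
    and x: "x \<in> open_segment a b" "x \<in> closed_segment c d"
  shows "closed_segment a b = closed_segment c d"
proof -
  have xV: "x \<notin> V" using x ab by blast
  have xcd: "x \<in> open_segment c d" using x xV cd by (auto simp: open_segment_def)
  have xab: "x \<in> closed_segment a b" using x by (auto simp: open_segment_def)
  have xSS: "x \<in> S \<inter> S'" using x xab ab cd by blast
  then obtain p q where pq: "p \<in> V" "q \<in> V" "S \<inter> S' = closed_segment p q"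
    using Int_cover_segment[of S S' x] ab cd xV by blast
  have col: "collinear S" "collinear S'" using ab cd collinear_cover by auto
  have pS: "p \<in> S" "q \<in> S" "p \<in> S'" "q \<in> S'" using pq(3) ends_in_segment by blast+
  have aS: "a \<in> S" "b \<in> S" "c \<in> S'" "d \<in> S'" using ab cd ends_in_segment by blast+
  have 1: "closed_segment a b \<subseteq> S \<inter> S'" unfolding pq(3)
    using pS aS x(1) xSS pq ab
    by (intro closed_segment_subset_of_cross[OF col(1)]) auto
  have 2: "closed_segment c d \<subseteq> S \<inter> S'" unfolding pq(3)
    using pS aS xcd xSS pq cd
    by (intro closed_segment_subset_of_cross[OF col(2)]) auto
  have abcd: "{a,b,c,d} \<subseteq> S" using aS 2 by auto
  show ?thesis
  proof
    show "closed_segment a b \<subseteq> closed_segment c d"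
      using abcd x cd ab by (intro closed_segment_subset_of_cross[OF col(1)]) auto
    show "closed_segment c d \<subseteq> closed_segment a b"
      using abcd xcd xab cd ab by (intro closed_segment_subset_of_cross[OF col(1)]) auto
  qed
qed

lemma Int_edges:
  assumes ab: "a \<in> V" "b \<in> V" "closed_segment a b \<subseteq> S" "S \<in> \<C>" "open_segment a b \<inter> V = {}"
    and cd: "c \<in> V" "d \<in> V" "closed_segment c d \<subseteq> S'" "S' \<in> \<C>" "open_segment c d \<inter> V = {}"
  shows "(closed_segment a b \<inter> closed_segment c d) face_of closed_segment a b"
proof (cases "closed_segment a b = closed_segment c d")
  case False
  let ?I = "closed_segment a b \<inter> closed_segment c d"
  have "open_segment a b \<inter> closed_segment c d = {}" using edges_eq_if_cross[OF ab cd] False by blast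
  then have "?I \<subseteq> {a, b}" by (auto simp: open_segment_def)
  moreover have "?I \<noteq> {a, b}" if "a \<noteq> b"
  proof
    assume "?I = {a,b}"
    moreover have "connected ?I" by (intro convex_connected convex_Int convex_closed_segment)
    ultimately have "connected {a,b}" by simp
    then obtain c where "{a,b} = {c}"
      using connected_finite_iff_sing[of "{a,b}"] by auto
    then show False using that by (metis insertI1 insert_commute singletonD)
  qed
  ultimately have "?I = {} \<or> ?I = {a} \<or> ?I = {b}" by (cases "a = b") auto
  then show ?thesis unfolding face_of_closed_segment by blast
next
  case True
  then show ?thesis by (metis Int_absorb convex_closed_segment face_of_refl)
qed

lemma segment_complex_cases:
  assumes "X \<in> segment_complex \<C> V"
  obtains "X = {}" | v where "v \<in> V" "X = {v}"
  | a b S where "X = closed_segment a b" "a \<in> V" "b \<in> V" "a \<noteq> b" "closed_segment a b \<subseteq> S" "S \<in> \<C>" "open_segment a b \<inter> V = {}"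
  using assms unfolding segment_complex_def by blast

lemma empty_in_segment_complex: "{} \<in> segment_complex \<C> V"
  and singleton_in_segment_complex: "v \<in> V \<Longrightarrow> {v} \<in> segment_complex \<C> V"
  by (simp_all add: segment_complex_def)

lemma simplicial_complex_segment_complex: "simplicial_complex (segment_complex \<C> V)"
  unfolding simplicial_complex_def
proof (intro conjI ballI allI impI)
  have "{closed_segment a b |a b. a \<in> V \<and> b \<in> V \<and> a \<noteq> b \<and>
        (\<exists>S\<in>\<C>. closed_segment a b \<subseteq> S) \<and> open_segment a b \<inter> V = {}} \<subseteq>
        (\<lambda>(a,b). closed_segment a b) ` (V \<times> V)" by auto
  then have "finite {closed_segment a b |a b. a \<in> V \<and> b \<in> V \<and> a \<noteq> b \<and>
        (\<exists>S\<in>\<C>. closed_segment a b \<subseteq> S) \<and> open_segment a b \<inter> V = {}}"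
    by (rule finite_subset) (use finite_V in simp)
  then show "finite (segment_complex \<C> V)"
    unfolding segment_complex_def using finite_V by simp
next
  fix X assume "X \<in> segment_complex \<C> V"
  then show "\<exists>n. n simplex X"
  proof (cases rule: segment_complex_cases)
    case 1
    then show ?thesis using simplex_empty by auto
  next
    case (2 v)
    then show ?thesis using simplex_singleton by auto
  next
    case (3 a b S)
    then show ?thesis using simplex_closed_segment[of a b] by blast
  qed
next
  fix F X assume "X \<in> segment_complex \<C> V \<and> F face_of X"
  then have X: "X \<in> segment_complex \<C> V" and F: "F face_of X" by auto
  show "F \<in> segment_complex \<C> V" using X
  proof (cases rule: segment_complex_cases)
    case 1
    then have "F = {}" using F by simp
    then show ?thesis by (simp add: empty_in_segment_complex)
  next
    case (2 v)
    then have "F = {} \<or> F = {v}" using F face_of_imp_subset[OF F] by auto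
    then show ?thesis using 2(1) by (auto simp only: empty_in_segment_complex singleton_in_segment_complex)
  next
    case (3 a b S)
    have "F = {} \<or> F = {a} \<or> F = {b} \<or> F = X" using F unfolding 3(1) face_of_closed_segment .
    then show ?thesis using 3(2,3) X by (auto simp only: empty_in_segment_complex singleton_in_segment_complex)
  qed
next
  fix X Y assume "X \<in> segment_complex \<C> V \<and> Y \<in> segment_complex \<C> V"
  then have X: "X \<in> segment_complex \<C> V" and Y: "Y \<in> segment_complex \<C> V" by auto
  show "X \<inter> Y face_of X" using X
  proof (cases rule: segment_complex_cases)
    case 1
    then show ?thesis by simp
  next
    case (2 v)
    then show ?thesis by (cases "v \<in> Y") (simp_all add: face_of_refl)
  next
    case (3 a b S)
    note ab = this
    show ?thesis using Y
    proof (cases rule: segment_complex_cases)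
      case (2 v)
      have v: "v = a \<or> v = b" if "v \<in> closed_segment a b"
        using that ab(7) \<open>v \<in> V\<close> by (auto simp: open_segment_def)
      show ?thesis
      proof (cases "v \<in> closed_segment a b")
        case True
        then have "X \<inter> Y = {v}" unfolding ab(1) \<open>Y = {v}\<close> by (simp add: Int_absorb2)
        then show ?thesis unfolding ab(1) using v[OF True] by (auto simp only: face_of_closed_segment)
      next
        case False
        then have "X \<inter> Y = {}" unfolding ab(1) \<open>Y = {v}\<close> by simp
        then show ?thesis by simp
      qed
    next
      case (3 c d S')
      show ?thesis unfolding ab(1) 3(1)
        by (rule Int_edges[OF ab(2,3,5,6,7) 3(2,3,5,6,7)])
    qed simp
  qed
qed

lemma segment_complex_dim: "X \<in> segment_complex \<C> V \<Longrightarrow> aff_dim X \<le> 1"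
  by (elim segment_complex_cases) (auto simp: segment_convex_hull aff_dim_convex_hull aff_dim_2)

lemma triangulates_segment_complex: "triangulates (segment_complex \<C> V) (\<Union>\<C>)"
  by (simp add: triangulates_def simplicial_complex_segment_complex Union_segment_complex)

end

lemma finite_extreme_points_dim_1:
  fixes S :: "'a::euclidean_space set"
  assumes "compact S" "convex S" "aff_dim S \<le> 1"
  shows "finite {v. v extreme_point_of S}"
  by (rule convex_aff_dim_le_1_cases[OF assms]) (auto simp: extreme_point_of_closed_segment)

section \<open>Trees as graphs\<close>

text \<open>Acyclicity phrased through reachability instead of lists of vertices. For symmetric
  irreflexive relations it agrees with the absence of cycles; it is the form that a logarithm yields
  and that growing a tree consumes.\<close>

definition bridges :: "('a \<Rightarrow> 'a \<Rightarrow> bool) \<Rightarrow> bool" where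
  "bridges E \<longleftrightarrow> (\<forall>a b. E a b \<longrightarrow> \<not> (\<lambda>u v. E u v \<and> {u, v} \<noteq> {a, b})\<^sup>*\<^sup>* a b)"

lemma rtranclp_nth_chain:
  assumes "\<And>i. Suc i < length xs \<Longrightarrow> R (xs ! i) (xs ! Suc i)" "j < length xs"
  shows "R\<^sup>*\<^sup>* (xs ! 0) (xs ! j)"
  using assms(2)
proof (induction j)
  case (Suc j)
  then show ?case using assms(1)[of j] by (simp add: rtranclp.rtrancl_into_rtrancl)
qed simp

lemma rtranclp_distinct_chain:
  assumes "R\<^sup>*\<^sup>* a b"
  obtains xs where "xs \<noteq> []" "hd xs = a" "last xs = b" "distinct xs" "successively R xs"
proof -
  have "\<exists>xs. xs \<noteq> [] \<and> hd xs = a \<and> last xs = b \<and> distinct xs \<and> successively R xs"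
    using assms
  proof (induction rule: converse_rtranclp_induct)
    case base
    then show ?case by (intro exI[of _ "[b]"]) simp
  next
    case (step y z)
    then obtain xs where xs: "xs \<noteq> []" "hd xs = z" "last xs = b" "distinct xs" "successively R xs" by auto
    show ?case
    proof (cases "y \<in> set xs")
      case True
      then obtain us vs where uv: "xs = us @ y # vs" using split_list by metis
      show ?thesis using xs by (intro exI[of _ "y # vs"]) (auto simp: uv successively_append_iff)
    next
      case False
      then show ?thesis using xs step(1) by (intro exI[of _ "y # xs"]) (cases xs; auto)
    qed
  qed
  then show ?thesis using that by auto
qed

text \<open>The long way round a cycle joins the ends of its closing edge. Length at least 3 ensures
  that none of the other edges is the closing edge traversed backwards.\<close>

lemma bridges_imp_no_cycle:
  assumes "bridges E" and sym: "\<And>u v. E u v \<Longrightarrow> E v u"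
  shows "\<not> (\<exists>vs. length vs \<ge> 3 \<and> distinct vs \<and>
             (\<forall>i<length vs. E (vs ! i) (vs ! (Suc i mod length vs))))"
proof
  assume "\<exists>vs. length vs \<ge> 3 \<and> distinct vs \<and> (\<forall>i<length vs. E (vs ! i) (vs ! (Suc i mod length vs)))"
  then obtain vs where vs: "length vs \<ge> 3" "distinct vs"
    "\<And>i. i < length vs \<Longrightarrow> E (vs ! i) (vs ! (Suc i mod length vs))" by auto
  define n where "n = length vs - 1"
  have n: "length vs = Suc n" "n \<ge> 2" using vs(1) by (auto simp: n_def)
  define R where "R = (\<lambda>u v. E u v \<and> {u, v} \<noteq> {vs ! 0, vs ! n})"
  have ends: "E (vs ! 0) (vs ! n)" using vs(3)[of n] n sym by simp
  have step: "R (vs ! Suc i) (vs ! Suc (Suc i)) \<and> R (vs ! 0) (vs ! 1)" if "Suc (Suc i) < length vs" for i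
  proof -
    have "E (vs ! Suc i) (vs ! Suc (Suc i))" "E (vs ! 0) (vs ! 1)"
      using vs(3)[of "Suc i"] vs(3)[of 0] that n by simp_all
    moreover have "vs ! Suc i \<noteq> vs ! 0" "vs ! Suc (Suc i) \<noteq> vs ! 0" "vs ! 0 \<noteq> vs ! n" "vs ! 1 \<noteq> vs ! n"
      using vs(2) that n by (simp_all add: nth_eq_iff_index_eq)
    ultimately show ?thesis unfolding R_def by (auto simp: doubleton_eq_iff)
  qed
  have "R (vs ! i) (vs ! Suc i)" if "Suc i < length vs" for i
    using step[of "i - 1"] step[of 0] that n by (cases i) auto
  then have "R\<^sup>*\<^sup>* (vs ! 0) (vs ! n)" using rtranclp_nth_chain[of vs R n] n by simp
  then show False using assms(1) ends unfolding bridges_def R_def by blast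
qed

lemma no_cycle_imp_bridges:
  assumes nc: "\<not> (\<exists>vs. length vs \<ge> 3 \<and> distinct vs \<and>
             (\<forall>i<length vs. E (vs ! i) (vs ! (Suc i mod length vs))))"
    and sym: "\<And>u v. E u v \<Longrightarrow> E v u" and irr: "\<And>u. \<not> E u u"
  shows "bridges E"
  unfolding bridges_def
proof (intro allI impI notI)
  fix a b assume E: "E a b"
  define R where "R = (\<lambda>u v. E u v \<and> {u, v} \<noteq> {a, b})"
  assume "(\<lambda>u v. E u v \<and> {u, v} \<noteq> {a, b})\<^sup>*\<^sup>* a b"
  then have "R\<^sup>*\<^sup>* a b" by (simp add: R_def)
  then obtain xs where xs: "xs \<noteq> []" "hd xs = a" "last xs = b" "distinct xs" "successively R xs"
    by (rule rtranclp_distinct_chain)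
  have "a \<noteq> b" using E irr by auto
  have step: "R (xs ! i) (xs ! Suc i)" if "Suc i < length xs" for i
    using xs(5) that by (simp add: successively_conv_nth)
  have h: "xs ! 0 = a" "xs ! (length xs - 1) = b"
    using xs by (simp_all add: hd_conv_nth last_conv_nth)
  have "length xs \<noteq> 0" using xs(1) by simp
  moreover have "length xs \<noteq> 1" using h \<open>a \<noteq> b\<close> by auto
  \<comment> \<open>A chain of length 2 would be the removed edge itself.\<close>
  moreover have "length xs \<noteq> 2" using step[of 0] h by (auto simp: R_def numeral_2_eq_2)
  ultimately have len: "length xs \<ge> 3" by linarith
  have "E (xs ! i) (xs ! (Suc i mod length xs))" if "i < length xs" for i
  proof (cases "Suc i < length xs")
    case True
    then show ?thesis using step[of i] by (simp add: R_def)
  next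
    case False
    then have "Suc i = length xs" "i = length xs - 1" using that by auto
    then show ?thesis using h E sym by simp
  qed
  then show False using nc len xs(4) by blast
qed

text \<open>Read backwards, such a list strips the tree of one leaf at a time. The uniqueness of the
  parent is used twice: for gluing edges at single points and for decoupling weights.\<close>

definition tree_order :: "('a \<Rightarrow> 'a \<Rightarrow> bool) \<Rightarrow> 'a list \<Rightarrow> bool" where
  "tree_order E ws \<longleftrightarrow> ws \<noteq> [] \<and> distinct ws \<and>
     (\<forall>k. 0 < k \<and> k < length ws \<longrightarrow>
        (\<exists>p<k. E (ws ! k) (ws ! p) \<and> (\<forall>j<k. E (ws ! k) (ws ! j) \<longrightarrow> j = p)))"

lemma tree_order_connected:
  assumes "tree_order E ws" and sym: "\<And>u v. E u v \<Longrightarrow> E v u" and "k < length ws"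
  shows "(\<lambda>u v. E u v \<and> u \<in> set ws \<and> v \<in> set ws)\<^sup>*\<^sup>* (ws ! 0) (ws ! k)"
  using assms(3)
proof (induction k rule: less_induct)
  case (less k)
  show ?case
  proof (cases "k = 0")
    case False
    then obtain p where p: "p < k" "E (ws ! k) (ws ! p)"
      using assms(1) less.prems unfolding tree_order_def by blast
    then have "E (ws ! p) (ws ! k)" "ws ! p \<in> set ws" "ws ! k \<in> set ws" using sym less.prems by auto
    moreover have "(\<lambda>u v. E u v \<and> u \<in> set ws \<and> v \<in> set ws)\<^sup>*\<^sup>* (ws ! 0) (ws ! p)"
      using less p by simp
    ultimately show ?thesis by (simp add: rtranclp.rtrancl_into_rtrancl)
  qed simp
qed

text \<open>A second neighbour \<open>u'\<close> of \<open>v\<close> in the list is linked to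
  \<open>u\<close> inside the list. Together with the edge from \<open>v\<close> to \<open>u\<close>
  this bypasses the edge from \<open>v\<close> to \<open>u'\<close>, which is a bridge.\<close>

lemma tree_order_extend:
  assumes br: "bridges E" and sym: "\<And>u v. E u v \<Longrightarrow> E v u" and irr: "\<And>u. \<not> E u u"
    and T: "tree_order E ws" and v: "v \<notin> set ws" "u \<in> set ws" "E v u"
  shows "tree_order E (ws @ [v])"
proof -
  have uniq: "u' = u" if "u' \<in> set ws" "E v u'" for u'
  proof (rule ccontr)
    assume ne: "u' \<noteq> u"
    define R where "R = (\<lambda>x y. E x y \<and> {x, y} \<noteq> {v, u'})"
    define W where "W = (\<lambda>x y. E x y \<and> x \<in> set ws \<and> y \<in> set ws)"
    have WR: "W x y \<Longrightarrow> R x y" for x y unfolding W_def R_def doubleton_eq_iff using v(1) by metis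
    have symW: "W\<^sup>*\<^sup>* y x" if "W\<^sup>*\<^sup>* x y" for x y
      using that
    proof (induction rule: rtranclp_induct)
      case (step y z)
      have "W z y" using step(2) sym unfolding W_def by blast
      then show ?case using step(3) by (rule converse_rtranclp_into_rtranclp)
    qed simp
    have con: "W\<^sup>*\<^sup>* (ws ! 0) x" if x: "x \<in> set ws" for x
    proof -
      obtain k where "k < length ws" "x = ws ! k" using x by (metis in_set_conv_nth)
      then show ?thesis using tree_order_connected[OF T sym] unfolding W_def by simp
    qed
    have Wu: "W\<^sup>*\<^sup>* u u'" by (rule rtranclp_trans[OF symW[OF con[OF v(2)]] con[OF that(1)]])
    have mono: "W\<^sup>*\<^sup>* \<le> R\<^sup>*\<^sup>*" by (rule rtranclp_mono) (simp add: le_fun_def WR)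
    have "R v u" unfolding R_def doubleton_eq_iff using v ne that(1) by blast
    then have "R\<^sup>*\<^sup>* v u'" using predicate2D[OF mono Wu] by (rule converse_rtranclp_into_rtranclp)
    then show False using br that(2) unfolding bridges_def R_def by blast
  qed
  have dist: "distinct ws" using T unfolding tree_order_def by blast
  obtain q where q: "q < length ws" "u = ws ! q" using v(2) by (metis in_set_conv_nth)
  show ?thesis unfolding tree_order_def
  proof (intro conjI allI impI)
    show "distinct (ws @ [v])" using dist v(1) by simp
    fix k assume k: "0 < k \<and> k < length (ws @ [v])"
    show "\<exists>p<k. E ((ws @ [v]) ! k) ((ws @ [v]) ! p) \<and>
        (\<forall>j<k. E ((ws @ [v]) ! k) ((ws @ [v]) ! j) \<longrightarrow> j = p)"
    proof (cases "k < length ws")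
      case True
      then obtain p where p: "p < k" "E (ws ! k) (ws ! p)" "\<And>j. j < k \<Longrightarrow> E (ws ! k) (ws ! j) \<Longrightarrow> j = p"
        using T k unfolding tree_order_def by blast
      have nth: "(ws @ [v]) ! j = ws ! j" if "j \<le> k" for j using that True by (simp add: nth_append)
      show ?thesis
      proof (intro exI[of _ p] conjI allI impI)
        show "E ((ws @ [v]) ! k) ((ws @ [v]) ! p)" using nth[of k] nth[of p] p(1,2) by simp
        fix j assume j: "j < k" "E ((ws @ [v]) ! k) ((ws @ [v]) ! j)"
        then show "j = p" using nth[of k] nth[of j] p(3)[of j] by (metis less_imp_le order_refl)
      qed (rule p(1))
    next
      case False
      then have kl: "k = length ws" using k by simp
      have jq: "j = q" if "j < k" "E v (ws ! j)" for j
      proof -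
        have "ws ! j = ws ! q" using uniq[of "ws ! j"] that q kl by simp
        then show ?thesis using that kl q(1) dist by (simp add: nth_eq_iff_index_eq)
      qed
      have nth: "(ws @ [v]) ! k = v" "(ws @ [v]) ! j = ws ! j" if "j < k" for j
        using that kl by (simp_all add: nth_append)
      show ?thesis
      proof (intro exI[of _ q] conjI allI impI)
        show "q < k" using q kl by simp
        then show "E ((ws @ [v]) ! k) ((ws @ [v]) ! q)" using nth q v(3) by simp
        fix j assume j: "j < k" "E ((ws @ [v]) ! k) ((ws @ [v]) ! j)"
        then show "j = q" using nth[OF j(1)] jq[of j] by metis
      qed
    qed
  qed simp
qed

lemma ex_tree_order:
  assumes br: "bridges E" and sym: "\<And>u v. E u v \<Longrightarrow> E v u" and irr: "\<And>u. \<not> E u u"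
    and V: "finite V" "r \<in> V" "\<And>u v. E u v \<Longrightarrow> u \<in> V"
    and con: "\<And>v. v \<in> V \<Longrightarrow> E\<^sup>*\<^sup>* r v"
  obtains ws where "tree_order E ws" "set ws = V" "ws ! 0 = r"
proof -
  have "\<exists>ws. tree_order E ws \<and> set ws \<subseteq> V \<and> ws ! 0 = r \<and> length ws = Suc m" if "Suc m \<le> card V" for m
    using that
  proof (induction m)
    case 0
    then show ?case using V by (intro exI[of _ "[r]"]) (auto simp: tree_order_def)
  next
    case (Suc m)
    then obtain ws where ws: "tree_order E ws" "set ws \<subseteq> V" "ws ! 0 = r" "length ws = Suc m" by auto
    have "card (set ws) \<le> Suc m" using ws(4) card_length by metis
    then have "set ws \<noteq> V" using Suc.prems by auto
    then obtain x where x: "x \<in> V" "x \<notin> set ws" using ws by auto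
    have r: "r \<in> set ws" using ws(3,4) nth_mem[of 0 ws] by simp
    \<comment> \<open>A path from the root to the missing vertex has to leave the list along some
      edge.\<close>
    have "\<exists>u v. u \<in> set ws \<and> v \<notin> set ws \<and> E u v"
      using con[OF x(1)] x(2)
    proof (induction rule: rtranclp_induct)
      case base
      then show ?case using r by simp
    next
      case (step y z)
      then show ?case by blast
    qed
    then obtain u v where uv: "u \<in> set ws" "v \<notin> set ws" "E u v" by blast
    have "tree_order E (ws @ [v])" using tree_order_extend[OF br sym irr ws(1) uv(2,1)] sym uv(3) by blast
    moreover have "v \<in> V" using V(3) sym uv(3) by blast
    ultimately show ?case using ws by (intro exI[of _ "ws @ [v]"]) (simp add: nth_append)
  qed
  moreover have "card V \<noteq> 0" using V by auto
  ultimately obtain ws where ws: "tree_order E ws" "set ws \<subseteq> V" "ws ! 0 = r" "length ws = card V"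
    by (metis Suc_pred' le_refl neq0_conv)
  have "card (set ws) = card V" using ws(1,4) by (simp add: tree_order_def distinct_card)
  then have "set ws = V" using ws(2) V(1) by (simp add: card_subset_eq)
  then show ?thesis using that ws by blast
qed

section \<open>One-dimensional simplicial complexes\<close>

locale graph_complex =
  fixes \<K> :: "'a::euclidean_space set set"
  assumes simplicial: "simplicial_complex \<K>"
    and dim_le_1: "X \<in> \<K> \<Longrightarrow> aff_dim X \<le> 1"
begin

abbreviation "V \<equiv> complex_vertices \<K>"
abbreviation "E \<equiv> complex_adj \<K>"

lemma finite_complex: "finite \<K>"
  and face_in_complex: "X \<in> \<K> \<Longrightarrow> F face_of X \<Longrightarrow> F \<in> \<K>"
  and Int_face: "X \<in> \<K> \<Longrightarrow> Y \<in> \<K> \<Longrightarrow> X \<inter> Y face_of X"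
  and simplex_in_complex: "X \<in> \<K> \<Longrightarrow> \<exists>n. n simplex X"
  using simplicial unfolding simplicial_complex_def by blast+

lemma compact_in_complex: "X \<in> \<K> \<Longrightarrow> compact X"
  and convex_in_complex: "X \<in> \<K> \<Longrightarrow> convex X"
  using simplex_in_complex compact_simplex convex_simplex by blast+

lemma finite_vertices: "finite V"
proof -
  have "(\<lambda>v. {v}) ` V \<subseteq> \<K>" unfolding complex_vertices_def by blast
  then have "finite ((\<lambda>v. {v}) ` V)" using finite_complex finite_subset by blast
  then show ?thesis by (rule finite_imageD) (simp add: inj_on_def)
qed

lemma complex_cases:
  assumes "X \<in> \<K>"
  obtains "X = {}" | v where "v \<in> V" "X = {v}"
    | a b where "E a b" "X = closed_segment a b"
proof (rule convex_aff_dim_le_1_cases[OF compact_in_complex convex_in_complex dim_le_1, OF assms assms assms])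
  fix v assume "X = {v}"
  then show thesis using that(2)[of v] assms unfolding complex_vertices_def by blast
next
  fix a b assume "a \<noteq> b" "X = closed_segment a b"
  then show thesis using that(3)[of a b] assms unfolding complex_adj_def by blast
qed (rule that(1))

lemma adj_sym: "E a b \<Longrightarrow> E b a"
  unfolding complex_adj_def by (metis closed_segment_commute)

lemma adj_irrefl: "\<not> E a a"
  unfolding complex_adj_def by blast

lemma adj_vertex: "E a b \<Longrightarrow> a \<in> V"
  unfolding complex_adj_def complex_vertices_def
  using face_in_complex[of "closed_segment a b" "{a}"] by (simp add: face_of_closed_segment)

lemma adj_in_complex: "E a b \<Longrightarrow> closed_segment a b \<in> \<K>"
  unfolding complex_adj_def by blast

lemma closed_segment_adj_eq:
  assumes "E a b" "E c d" "closed_segment a b \<subseteq> closed_segment c d"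
  shows "closed_segment a b = closed_segment c d"
proof -
  have "closed_segment c d \<inter> closed_segment a b face_of closed_segment c d"
    using Int_face adj_in_complex assms by blast
  then have "closed_segment a b face_of closed_segment c d" using assms(3) by (simp add: Int_absorb1)
  moreover have "closed_segment a b \<noteq> {v}" for v
    using assms(1) ends_in_segment(1)[of a b] ends_in_segment(2)[of b a] unfolding complex_adj_def
    by (metis singletonD)
  ultimately show ?thesis unfolding face_of_closed_segment by simp
qed

lemma edge_Int:
  assumes "E a b" "X \<in> \<K>" "X \<noteq> closed_segment a b"
  shows "closed_segment a b \<inter> X = {} \<or> closed_segment a b \<inter> X = {a} \<or> closed_segment a b \<inter> X = {b}"
proof -
  have "closed_segment a b \<inter> X face_of closed_segment a b"
    using Int_face adj_in_complex assms by blast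
  moreover have "closed_segment a b \<inter> X \<noteq> closed_segment a b"
  proof
    assume "closed_segment a b \<inter> X = closed_segment a b"
    then have sub: "closed_segment a b \<subseteq> X" by blast
    have ab: "a \<noteq> b" "a \<in> X" "b \<in> X" using assms(1) sub unfolding complex_adj_def by auto
    show False using assms(2)
    proof (cases rule: complex_cases)
      case (2 v)
      then show ?thesis using ab by simp
    next
      case (3 c d)
      then show ?thesis using closed_segment_adj_eq[OF assms(1) 3(1)] sub assms(3) by blast
    qed (use ab in simp)
  qed
  ultimately show ?thesis unfolding face_of_closed_segment by blast
qed

lemma vertex_in_edge:
  assumes "E a b" "v \<in> V" "v \<in> closed_segment a b"
  shows "v = a \<or> v = b"
proof -
  have "{v} \<in> \<K>" using assms(2) unfolding complex_vertices_def by blast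
  moreover have "{v} \<noteq> closed_segment a b"
    using assms(1) ends_in_segment(1)[of a b] ends_in_segment(2)[of b a] unfolding complex_adj_def
    by (metis singletonD)
  moreover have "closed_segment a b \<inter> {v} = {v}" using assms(3) by blast
  ultimately show ?thesis using edge_Int[OF assms(1), of "{v}"] by (metis insert_not_empty singleton_inject)
qed

lemma Union_complex:
  assumes "\<And>v. v \<in> V \<Longrightarrow> \<exists>u. E v u"
  shows "\<Union>\<K> = (\<Union>(a,b)\<in>{(a,b). E a b}. closed_segment a b)"
proof
  show "(\<Union>(a,b)\<in>{(a,b). E a b}. closed_segment a b) \<subseteq> \<Union>\<K>" using adj_in_complex by blast
  show "\<Union>\<K> \<subseteq> (\<Union>(a,b)\<in>{(a,b). E a b}. closed_segment a b)"
  proof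
    fix x assume "x \<in> \<Union>\<K>"
    then obtain X where X: "X \<in> \<K>" "x \<in> X" by blast
    from X(1) have "\<exists>a b. E a b \<and> x \<in> closed_segment a b"
    proof (cases rule: complex_cases)
      case (2 v)
      then show ?thesis using assms[of v] X(2) by auto
    next
      case (3 a b)
      then show ?thesis using X(2) by blast
    qed (use X in simp)
    then show "x \<in> (\<Union>(a,b)\<in>{(a,b). E a b}. closed_segment a b)" by blast
  qed
qed

text \<open>The simplexes with only reachable vertices and those without any cover the complex. Two
  intersecting simplexes share a face and hence a vertex, so the two unions are disjoint closed
  sets, both nonempty.\<close>

lemma vertex_connected:
  assumes con: "connected (\<Union>\<K>)" and r: "r \<in> V" "v \<in> V"
  shows "E\<^sup>*\<^sup>* r v"
proof (rule ccontr)
  assume nv: "\<not> E\<^sup>*\<^sup>* r v"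
  define R where "R = {u. E\<^sup>*\<^sup>* r u}"
  define A where "A = {X \<in> \<K>. X \<inter> V \<subseteq> R}"
  define B where "B = {X \<in> \<K>. X \<inter> V \<inter> R = {}}"
  have fin: "finite A" "finite B" using finite_complex by (simp_all add: A_def B_def)
  have cl: "closed (\<Union>A)" "closed (\<Union>B)"
    using fin compact_in_complex compact_imp_closed unfolding A_def B_def by (auto intro!: closed_Union)
  have cov: "X \<in> A \<or> X \<in> B" if X: "X \<in> \<K>" for X
    using X
  proof (cases rule: complex_cases)
    case 1
    then show ?thesis using X by (simp add: A_def)
  next
    case (2 w)
    then show ?thesis using X by (simp add: A_def B_def)
  next
    case (3 a b)
    have "X \<inter> V \<subseteq> {a, b}" using vertex_in_edge[OF 3(1)] 3(2) by blast
    moreover have "a \<in> R \<longleftrightarrow> b \<in> R" unfolding R_def using 3(1) adj_sym[OF 3(1)]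
      by (auto intro: rtranclp.rtrancl_into_rtrancl)
    ultimately show ?thesis unfolding A_def B_def using X by blast
  qed
  have disj: "X \<inter> Y = {}" if X: "X \<in> A" and Y: "Y \<in> B" for X Y
  proof (rule ccontr)
    assume ne: "X \<inter> Y \<noteq> {}"
    have K: "X \<in> \<K>" "Y \<in> \<K>" using X Y by (simp_all add: A_def B_def)
    have "X \<inter> Y \<in> \<K>" using face_in_complex Int_face K by blast
    then have "\<exists>w\<in>V. w \<in> X \<inter> Y"
    proof (cases rule: complex_cases)
      case (3 a b)
      then show ?thesis using adj_vertex[OF 3(1)] by auto
    qed (use ne in auto)
    then show False using X Y unfolding A_def B_def by blast
  qed
  have "\<Union>\<K> \<subseteq> \<Union>A \<union> \<Union>B" using cov by blast
  moreover have "\<Union>A \<inter> \<Union>B \<inter> \<Union>\<K> = {}" using disj by blast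
  moreover have "\<Union>A \<inter> \<Union>\<K> \<noteq> {}"
  proof -
    have "{r} \<in> A" using r unfolding A_def R_def complex_vertices_def by simp
    then show ?thesis unfolding A_def by blast
  qed
  moreover have "\<Union>B \<inter> \<Union>\<K> \<noteq> {}"
  proof -
    have "{v} \<in> B" using r nv unfolding B_def R_def complex_vertices_def by simp
    then show ?thesis unfolding B_def by blast
  qed
  ultimately show False using con cl unfolding connected_closed by blast
qed

lemma edge_neq_avoid:
  assumes "E a b" "E u v" "{u, v} \<noteq> {a, b}"
  shows "closed_segment u v \<noteq> closed_segment a b"
proof
  assume eq: "closed_segment u v = closed_segment a b"
  have "u = a \<or> u = b" "v = a \<or> v = b"
    using vertex_in_edge[OF assms(1)] adj_vertex[OF assms(2)] adj_vertex[OF adj_sym[OF assms(2)]] eq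
    by (metis ends_in_segment(1), metis ends_in_segment(2))
  then show False using assms(2,3) adj_irrefl by (metis insert_commute)
qed

end

section \<open>Simple connectivity, bridges and contractibility\<close>

lemma exp_eq_1_imp_constant:
  assumes "connected S" "continuous_on S (h :: 'a::euclidean_space \<Rightarrow> complex)"
    and "\<And>x. x \<in> S \<Longrightarrow> exp (h x) = 1" and xy: "x \<in> S" "y \<in> S"
  shows "h x = h y"
proof -
  have gap: "2 * pi \<le> norm (h v - h u)" if uv: "u \<in> S" "v \<in> S" "h v \<noteq> h u" for u v
  proof -
    obtain n m :: int where n: "Im (h u) = of_int (2 * n) * pi" "Re (h u) = 0" and m: "Im (h v) = of_int (2 * m) * pi" "Re (h v) = 0"
      using assms(3)[OF uv(1)] assms(3)[OF uv(2)] unfolding exp_eq_1 by blast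
    have "n \<noteq> m" using n m uv(3) by (metis complex_eqI)
    then have "1 \<le> \<bar>of_int (m - n) :: real\<bar>" by linarith
    then have "2 * pi * 1 \<le> 2 * pi * \<bar>of_int (m - n)\<bar>" by (intro mult_left_mono) auto
    also have "\<dots> = \<bar>2 * pi * of_int (m - n)\<bar>" by (simp add: abs_mult)
    also have "2 * pi * of_int (m - n) = Im (h v) - Im (h u)" using n m by (simp add: algebra_simps)
    also have "\<bar>Im (h v) - Im (h u)\<bar> = \<bar>Im (h v - h u)\<bar>" by simp
    also have "\<dots> \<le> norm (h v - h u)" by (rule abs_Im_le_cmod)
    finally show ?thesis by simp
  qed
  have "h constant_on S"
    by (rule continuous_discrete_range_constant[OF assms(1,2)]) (use gap in \<open>intro exI[of _ "2 * pi"], simp\<close>)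
  then show ?thesis using xy unfolding constant_on_def by metis
qed

context graph_complex
begin

text \<open>A path from \<open>a\<close> to \<open>b\<close> avoiding the edge runs where
  \<open>f = 1\<close>, so a logarithm of \<open>f\<close> is constant along it. Along the edge
  itself the same logarithm grows by \<open>2 * pi * \<i>\<close>.\<close>

lemma bridges_if_simply_connected:
  assumes sc: "simply_connected (\<Union>\<K>)"
  shows "bridges E"
  unfolding bridges_def
proof (intro allI impI notI)
  fix a b assume ab: "E a b" and path: "(\<lambda>u v. E u v \<and> {u, v} \<noteq> {a, b})\<^sup>*\<^sup>* a b"
  define e where "e = closed_segment a b"
  define Q where "Q = \<Union>(\<K> - {e})"
  define \<phi> where "\<phi> x = ((x - a) \<bullet> (b - a)) / ((b - a) \<bullet> (b - a))" for x
  define f where "f x = (if x \<in> e then exp (2 * pi * \<i> * \<phi> x) else 1)" for x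
  have "a \<noteq> b" using ab adj_irrefl by auto
  have eK: "e \<in> \<K>" using adj_in_complex[OF ab] by (simp add: e_def)
  have U: "\<Union>\<K> = e \<union> Q" using eK by (auto simp: Q_def)
  have cl: "closed e" by (simp add: e_def)
  have clQ: "closed Q" unfolding Q_def using finite_complex compact_in_complex compact_imp_closed
    by (intro closed_Union) auto
  have \<phi>: "\<phi> a = 0" "\<phi> b = 1" using \<open>a \<noteq> b\<close> by (simp_all add: \<phi>_def)
  have eQ: "x = a \<or> x = b" if x: "x \<in> e" "x \<in> Q" for x
  proof -
    obtain X where "X \<in> \<K>" "X \<noteq> e" "x \<in> X" using x(2) unfolding Q_def by blast
    then show ?thesis using edge_Int[OF ab, of X] x(1) unfolding e_def by blast
  qed
  have fQ: "f x = 1" if x: "x \<in> Q" for x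
  proof (cases "x \<in> e")
    case True
    then have "x = a \<or> x = b" using eQ x by blast
    then have "exp (2 * pi * \<i> * \<phi> x) = 1" using \<phi> by (auto simp: exp_eq_1)
    then show ?thesis by (simp add: f_def)
  qed (simp add: f_def)
  have fe: "f x = exp (2 * pi * \<i> * \<phi> x)" if "x \<in> e" for x using that by (simp add: f_def)
  have "continuous_on e f"
    by (subst continuous_on_cong[OF refl fe]) (use \<open>a \<noteq> b\<close> in \<open>auto simp: \<phi>_def intro!: continuous_intros\<close>)
  moreover have "continuous_on Q f"
    by (subst continuous_on_cong[OF refl fQ]) auto
  ultimately have "continuous_on (\<Union>\<K>) f" unfolding U using cl clQ by (intro continuous_on_closed_Un)
  \<comment> \<open>Needed for lifting through the exponential; finite unions of closed convex sets
    are ANRs.\<close>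
  moreover have "locally path_connected (\<Union>\<K>)"
    using finite_complex compact_in_complex convex_in_complex
    by (intro ANR_imp_locally_path_connected ANR_finite_Union_convex_closed) (auto intro: compact_imp_closed)
  moreover have "f x \<noteq> 0" for x by (simp add: f_def)
  ultimately obtain g where g: "continuous_on (\<Union>\<K>) g" "\<And>x. x \<in> \<Union>\<K> \<Longrightarrow> f x = exp (g x)"
    using continuous_logarithm_on_simply_connected[OF _ sc] by metis
  have gQ: "g a = g v" if "(\<lambda>u v. E u v \<and> {u, v} \<noteq> {a, b})\<^sup>*\<^sup>* a v" for v
    using that
  proof (induction rule: rtranclp_induct)
    case (step u v)
    define d where "d = closed_segment u v"
    have "d \<in> \<K>" "d \<noteq> e"
      using edge_neq_avoid[OF ab, of u v] adj_in_complex[of u v] step(2) unfolding d_def e_def by blast+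
    then have dQ: "d \<subseteq> Q" "d \<subseteq> \<Union>\<K>" unfolding Q_def by blast+
    have "g u = g v"
    proof (rule exp_eq_1_imp_constant[of d g u v])
      show "connected d" by (simp add: d_def)
      show "continuous_on d g" using g(1) dQ(2) by (rule continuous_on_subset)
      show "exp (g x) = 1" if "x \<in> d" for x
      proof -
        have "x \<in> Q" "x \<in> \<Union>\<K>" using dQ that by blast+
        then show ?thesis using g(2)[of x] fQ[of x] by simp
      qed
    qed (auto simp: d_def)
    then show ?case using step(3) by simp
  qed simp
  have "g a - 2 * pi * \<i> * \<phi> a = g b - 2 * pi * \<i> * \<phi> b"
  proof (rule exp_eq_1_imp_constant[of e "\<lambda>x. g x - 2 * pi * \<i> * \<phi> x" a b])
    show "connected e" by (simp add: e_def)
    show "continuous_on e (\<lambda>x. g x - 2 * pi * \<i> * \<phi> x)"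
      using continuous_on_subset[OF g(1)] U \<open>a \<noteq> b\<close> unfolding \<phi>_def by (intro continuous_intros) auto
    show "exp (g x - 2 * pi * \<i> * \<phi> x) = 1" if "x \<in> e" for x
      using g(2)[of x] fe[OF that] that U by (simp add: exp_diff)
  qed (auto simp: e_def)
  then show False using gQ[OF path] \<phi> by simp
qed

text \<open>Each new vertex brings exactly one edge, glued to the earlier part at the parent alone,
  and absolute retracts glue along absolute retracts. The singleton takes care of the stage without
  edges.\<close>

lemma AR_tree_order:
  assumes ord: "tree_order E ws" and "set ws \<subseteq> V"
  shows "AR ({ws ! 0} \<union> \<Union>{closed_segment (ws ! i) (ws ! j) |i j. i < length ws \<and> j < length ws \<and> E (ws ! i) (ws ! j)})"
proof -
  define P where "P m = {ws ! 0} \<union> \<Union>{closed_segment (ws ! i) (ws ! j) |i j. i < m \<and> j < m \<and> E (ws ! i) (ws ! j)}" for m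
  have P_iff: "x \<in> P m \<longleftrightarrow> x = ws ! 0 \<or>
      (\<exists>i j. i < m \<and> j < m \<and> E (ws ! i) (ws ! j) \<and> x \<in> closed_segment (ws ! i) (ws ! j))" for x m
    unfolding P_def by blast
  have fin: "finite {closed_segment (ws ! i) (ws ! j) |i j. i < m \<and> j < m \<and> E (ws ! i) (ws ! j)}" for m
  proof (rule finite_subset)
    show "{closed_segment (ws ! i) (ws ! j) |i j. i < m \<and> j < m \<and> E (ws ! i) (ws ! j)} \<subseteq> \<K>"
      using adj_in_complex by blast
  qed (rule finite_complex)
  have cl: "closed (P m)" for m
    unfolding P_def by (intro closed_Un closed_singleton closed_Union fin) auto
  have dist: "distinct ws" using ord unfolding tree_order_def by blast
  have "AR (P (Suc m))" if "Suc m \<le> length ws" for m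
    using that
  proof (induction m)
    case 0
    have "P (Suc 0) = {ws ! 0}" unfolding P_def using adj_irrefl by auto
    then show ?case by (simp add: convex_imp_AR)
  next
    case (Suc m)
    define k where "k = Suc m"
    have k: "0 < k" "k < length ws" using Suc.prems by (simp_all add: k_def)
    obtain p where p: "p < k" "E (ws ! k) (ws ! p)" "\<And>j. j < k \<Longrightarrow> E (ws ! k) (ws ! j) \<Longrightarrow> j = p"
      using ord k unfolding tree_order_def by blast
    define e where "e = closed_segment (ws ! k) (ws ! p)"
    have "x \<in> P k \<union> e" if x: "x \<in> P (Suc k)" for x
    proof (cases "x = ws ! 0")
      case False
      then obtain i j where ij: "i < Suc k" "j < Suc k" "E (ws ! i) (ws ! j)" "x \<in> closed_segment (ws ! i) (ws ! j)"
        using x unfolding P_iff by blast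
      consider "i < k" "j < k" | "i = k" "j < k" | "i < k" "j = k" | "i = k" "j = k" using ij by linarith
      then show ?thesis
      proof cases
        case 1
        then show ?thesis using ij unfolding P_def by blast
      next
        case 2
        then show ?thesis using ij p(3)[of j] unfolding e_def by auto
      next
        case 3
        then have "i = p" using ij p(3)[of i] adj_sym by auto
        then show ?thesis using ij 3 unfolding e_def by (simp add: closed_segment_commute)
      next
        case 4
        then show ?thesis using ij adj_irrefl by auto
      qed
    qed (simp add: P_def)
    moreover have "x \<in> P (Suc k)" if x: "x \<in> P k" for x
      using x less_SucI unfolding P_iff by meson
    moreover have "x \<in> P (Suc k)" if x: "x \<in> e" for x
      using x p(2) less_SucI[OF p(1)] lessI[of k] unfolding P_iff e_def by blast
    ultimately have step: "P (Suc k) = P k \<union> e" by blast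
    have vk: "ws ! k \<in> V" "ws ! 0 \<in> V" by (rule subsetD[OF assms(2) nth_mem], use k in linarith)+
    have nin: "ws ! k \<notin> P k"
    proof
      assume "ws ! k \<in> P k"
      moreover have ne: "ws ! k \<noteq> ws ! i" if "i < k" for i
        using that k(2) dist by (simp add: nth_eq_iff_index_eq)
      ultimately obtain i j where ij: "i < k" "j < k" "E (ws ! i) (ws ! j)" "ws ! k \<in> closed_segment (ws ! i) (ws ! j)"
        unfolding P_iff using k(1) by blast
      then show False using vertex_in_edge[OF ij(3) vk(1) ij(4)] ne by blast
    qed
    have pin: "ws ! p \<in> P k"
    proof (cases "p = 0")
      case False
      moreover have "p < length ws" using p(1) k(2) by simp
      ultimately obtain q where q: "q < p" "E (ws ! p) (ws ! q)" using ord unfolding tree_order_def by blast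
      then have "q < k" using p(1) by simp
      then show ?thesis unfolding P_iff using p(1) q ends_in_segment(1) by blast
    qed (simp add: P_def)
    have "P k \<inter> e = {ws ! p}"
    proof
      show "{ws ! p} \<subseteq> P k \<inter> e" using pin by (simp add: e_def)
      show "P k \<inter> e \<subseteq> {ws ! p}"
      proof
        fix x assume x: "x \<in> P k \<inter> e"
        \<comment> \<open>Intersections are controlled only between simplexes of the complex, so the
          point is first placed in one inside \<open>P k\<close>.\<close>
        obtain X where X: "X \<in> \<K>" "x \<in> X" "X \<subseteq> P k"
        proof (cases "x = ws ! 0")
          case True
          have "{ws ! 0} \<in> \<K>" using vk(2) unfolding complex_vertices_def by blast
          moreover have "{ws ! 0} \<subseteq> P k" by (simp add: P_def)
          ultimately show thesis using that[of "{ws ! 0}"] True by blast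
        next
          case False
          then obtain i j where ij: "i < k" "j < k" "E (ws ! i) (ws ! j)" "x \<in> closed_segment (ws ! i) (ws ! j)"
            using IntD1[OF x] unfolding P_iff by blast
          then have "closed_segment (ws ! i) (ws ! j) \<subseteq> P k" unfolding P_def by blast
          then show thesis using that adj_in_complex[OF ij(3)] ij(4) by blast
        qed
        have "X \<noteq> e" using X nin unfolding e_def by auto
        then have "x = ws ! k \<or> x = ws ! p" using edge_Int[OF p(2), of X] X x unfolding e_def by blast
        then show "x \<in> {ws ! p}" using nin x by auto
      qed
    qed
    then have "AR (P k \<inter> e)" by (simp add: convex_imp_AR)
    moreover have "AR e" unfolding e_def by (simp add: convex_imp_AR)
    moreover have "AR (P k)" using Suc unfolding k_def by simp
    moreover have "closed e" by (simp add: e_def)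
    ultimately have "AR (P (Suc k))" unfolding step using cl by (intro AR_closed_Un)
    then show ?case by (simp add: k_def)
  qed
  moreover have "length ws \<noteq> 0" using ord unfolding tree_order_def by simp
  ultimately have "AR (P (length ws))" by (metis not0_implies_Suc order_refl)
  then show ?thesis unfolding P_def .
qed

lemma contractible_if_bridges:
  assumes br: "bridges E" and ne: "V \<noteq> {}" and con: "\<And>u v. u \<in> V \<Longrightarrow> v \<in> V \<Longrightarrow> E\<^sup>*\<^sup>* u v"
  shows "contractible (\<Union>\<K>)"
proof -
  obtain r where r: "r \<in> V" using ne by blast
  obtain ws where ws: "tree_order E ws" "set ws = V" "ws ! 0 = r"
  proof (rule ex_tree_order[of E V r])
    show "\<And>u v. E u v \<Longrightarrow> E v u" by (rule adj_sym)
    show "\<And>u v. E u v \<Longrightarrow> u \<in> V" by (rule adj_vertex)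
    show "\<And>v. v \<in> V \<Longrightarrow> E\<^sup>*\<^sup>* r v" by (rule con[OF r])
  qed (use br adj_irrefl finite_vertices r in auto)
  define P where "P = {ws ! 0} \<union> \<Union>{closed_segment (ws ! i) (ws ! j) |i j. i < length ws \<and> j < length ws \<and> E (ws ! i) (ws ! j)}"
  have "\<Union>\<K> = P"
  proof
    show "P \<subseteq> \<Union>\<K>" unfolding P_def using adj_in_complex r ws(3) unfolding complex_vertices_def by blast
    have edge: "closed_segment a b \<subseteq> P" if ab: "E a b" for a b
    proof -
      have "a \<in> set ws" "b \<in> set ws" using adj_vertex[OF ab] adj_vertex[OF adj_sym[OF ab]] ws(2) by auto
      then obtain i j where "i < length ws" "j < length ws" "a = ws ! i" "b = ws ! j" by (metis in_set_conv_nth)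
      then show ?thesis unfolding P_def using ab by blast
    qed
    show "\<Union>\<K> \<subseteq> P"
    proof
      fix x assume "x \<in> \<Union>\<K>"
      then obtain X where X: "X \<in> \<K>" "x \<in> X" by blast
      from X(1) show "x \<in> P"
      proof (cases rule: complex_cases)
        case (2 v)
        show ?thesis
        proof (cases "v = r")
          case False
          then obtain u where "E u v" using con[OF r 2(1)] by (metis rtranclp.cases)
          then show ?thesis using edge[of u v] 2 X(2) by auto
        qed (use 2 X ws in \<open>simp add: P_def\<close>)
      next
        case (3 a b)
        then show ?thesis using edge X by blast
      qed (use X in simp)
    qed
  qed
  then show ?thesis using AR_imp_contractible[OF AR_tree_order[OF ws(1)]] ws(2) unfolding P_def by simp
qed

end

section \<open>Integer vectors, denominators and primitive vectors\<close>

definition int_vec :: "real ^ 'n \<Rightarrow> bool" where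
  "int_vec v \<longleftrightarrow> (\<forall>i. v $ i \<in> \<int>)"

lemma int_vec_add: "int_vec u \<Longrightarrow> int_vec v \<Longrightarrow> int_vec (u + v)"
  and int_vec_diff: "int_vec u \<Longrightarrow> int_vec v \<Longrightarrow> int_vec (u - v)"
  and int_vec_scale: "k \<in> \<int> \<Longrightarrow> int_vec v \<Longrightarrow> int_vec (k *\<^sub>R v)"
  and int_vec_0: "int_vec 0"
  by (simp_all add: int_vec_def)

lemma int_vec_axis: "k \<in> \<int> \<Longrightarrow> int_vec (axis i k)"
  by (simp add: int_vec_def axis_def)

lemma int_vec_inner: "int_vec u \<Longrightarrow> int_vec v \<Longrightarrow> u \<bullet> v \<in> \<int>"
  unfolding int_vec_def inner_vec_def by (intro Ints_sum) simp

lemma rational_point_if_int_vec: "int_vec v \<Longrightarrow> rational_point v"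
  unfolding int_vec_def rational_point_def using Ints_subset_Rats by blast

lemma rational_point_inner: "rational_point u \<Longrightarrow> rational_point v \<Longrightarrow> u \<bullet> v \<in> \<rat>"
  unfolding rational_point_def inner_vec_def by (intro Rats_sum) simp

lemma rational_point_add: "rational_point u \<Longrightarrow> rational_point v \<Longrightarrow> rational_point (u + v)"
  and rational_point_diff: "rational_point u \<Longrightarrow> rational_point v \<Longrightarrow> rational_point (u - v)"
  and rational_point_scale: "k \<in> \<rat> \<Longrightarrow> rational_point v \<Longrightarrow> rational_point (k *\<^sub>R v)"
  by (simp_all add: rational_point_def)

lemma int_vec_sum_basis:
  fixes z :: "real ^ 'n::finite"
  assumes "int_vec z"
  obtains k :: "'n \<Rightarrow> int" where "z = (\<Sum>i\<in>UNIV. of_int (k i) *\<^sub>R axis i 1)"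
proof -
  have "\<forall>i. \<exists>k. z $ i = of_int k" using assms unfolding int_vec_def by (auto elim: Ints_cases)
  then obtain k where k: "\<And>i. z $ i = of_int (k i)" by metis
  have "z = (\<Sum>i\<in>UNIV. of_int (k i) *\<^sub>R axis i 1)"
    using basis_expansion[of z] by (simp add: k scalar_mult_eq_scaleR)
  then show ?thesis using that by blast
qed

lemma den_properties:
  assumes "rational_point (v :: real ^ 'n)"
  shows "den v > 0" "int_vec (real (den v) *\<^sub>R v)"
proof -
  have "\<forall>i. \<exists>d::nat. d > 0 \<and> real d * v $ i \<in> \<int>"
  proof
    fix i
    obtain a b :: int where "b > 0" "v $ i = of_int a / of_int b"
      using assms unfolding rational_point_def by (metis Rats_cases')
    then show "\<exists>d::nat. d > 0 \<and> real d * v $ i \<in> \<int>"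
      by (intro exI[of _ "nat b"]) auto
  qed
  then obtain f where f: "\<And>i. f i > (0::nat)" "\<And>i. real (f i) * v $ i \<in> \<int>" by metis
  have "real (\<Prod>i\<in>UNIV. f i) * v $ i \<in> \<int>" for i
  proof -
    have "real (\<Prod>i\<in>UNIV. f i) * v $ i = real (\<Prod>j\<in>UNIV - {i}. f j) * (real (f i) * v $ i)"
      by (subst prod.remove[of UNIV i]) auto
    also have "\<dots> \<in> \<int>" by (rule Ints_mult[OF Ints_of_nat f(2)])
    finally show ?thesis .
  qed
  moreover have "(\<Prod>i\<in>UNIV. f i) > 0" using f(1) by (simp add: prod_pos)
  ultimately have "\<exists>d. d > 0 \<and> (\<forall>i. real d * v $ i \<in> \<int>)" by blast
  from LeastI_ex[OF this] show "den v > 0" "int_vec (real (den v) *\<^sub>R v)"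
    unfolding den_def int_vec_def by auto
qed

lemma den_int_vec:
  assumes "int_vec v" shows "den v = 1"
  unfolding den_def using assms by (intro Least_equality) (auto simp: int_vec_def)

text \<open>The least positive value at \<open>m\<close> of an integral functional is the gcd of the
  coordinates of \<open>m\<close>; the functional attaining it becomes the witness \<open>c\<close>
  of primitivity.\<close>

lemma primitive_direction:
  assumes m: "int_vec (m :: real ^ 'n)" "m \<noteq> 0"
  obtains u c and g :: int where "int_vec u" "int_vec c" "c \<bullet> u = 1" "g > 0" "m = of_int g *\<^sub>R u"
proof -
  obtain i where i: "m $ i \<noteq> 0" using m(2) by (metis vec_eq_iff zero_index)
  define Q where "Q = (\<lambda>d::nat. d > 0 \<and> (\<exists>c. int_vec c \<and> c \<bullet> m = real d))"
  have "Q (nat \<bar>\<lfloor>m $ i\<rfloor>\<bar>)"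
  proof -
    have e: "m $ i = of_int \<lfloor>m $ i\<rfloor>" using m(1) unfolding int_vec_def by (metis floor_of_int Ints_cases)
    then have "\<lfloor>m $ i\<rfloor> \<noteq> 0" using i by linarith
    moreover have "axis i (sgn (m $ i)) \<bullet> m = \<bar>m $ i\<bar>" by (simp add: inner_axis' sgn_mult_abs abs_mult_sgn sgn_if)
    moreover have "int_vec (axis i (sgn (m $ i)))" by (intro int_vec_axis) (simp add: sgn_if)
    moreover have "\<bar>m $ i\<bar> = real (nat \<bar>\<lfloor>m $ i\<rfloor>\<bar>)" using e by simp
    ultimately show ?thesis unfolding Q_def by force
  qed
  define g where "g = (LEAST d. Q d)"
  have "Q g" unfolding g_def using LeastI[of Q] \<open>Q (nat _)\<close> by blast
  then obtain c where c: "g > 0" "int_vec c" "c \<bullet> m = real g" unfolding Q_def by blast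
  have min: "\<not> Q d" if "d < g" for d using that not_less_Least unfolding g_def by blast
  have dv: "m $ j / real g \<in> \<int>" for j
  proof -
    obtain k :: int where k: "m $ j = of_int k" using m(1) unfolding int_vec_def by (metis Ints_cases)
    \<comment> \<open>Division with remainder: \<open>r\<close> is again the value of an integral
      functional at \<open>m\<close>, hence 0 by minimality of \<open>g\<close>.\<close>
    define q r where "q = k div int g" and "r = k mod int g"
    have r: "0 \<le> r" "r < int g" using c(1) by (simp_all add: r_def)
    have "k = q * int g + r" by (simp add: q_def r_def)
    then have kr: "of_int k = of_int q * real g + of_int r" by (metis of_int_add of_int_mult of_int_of_nat_eq)
    have "(axis j 1 - of_int q *\<^sub>R c) \<bullet> m = of_int r"
      using kr by (simp add: inner_diff_left inner_axis' c(3) k)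
    moreover have "int_vec (axis j 1 - of_int q *\<^sub>R c)"
      by (intro int_vec_diff int_vec_axis int_vec_scale c) auto
    moreover have "of_int r = real (nat r)" using r by simp
    ultimately have "nat r > 0 \<Longrightarrow> Q (nat r)" unfolding Q_def by metis
    then have "r = 0" using min[of "nat r"] r by (cases "r = 0") auto
    then show ?thesis using kr k c(1) by simp
  qed
  define u where "u = (1 / real g) *\<^sub>R m"
  have "int_vec u" using dv unfolding int_vec_def u_def by simp
  moreover have "c \<bullet> u = 1" using c by (simp add: u_def)
  moreover have "m = of_int (int g) *\<^sub>R u" using c(1) by (simp add: u_def)
  ultimately show ?thesis using that[of u c "int g"] c by simp
qed

text \<open>Being indexed by the coordinates, such spanning families are bases of the integer lattice.\<close>
definition spans_int :: "('n::finite \<Rightarrow> real ^ 'n) \<Rightarrow> bool" where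
  "spans_int b \<longleftrightarrow> (\<forall>i. int_vec (b i)) \<and>
     (\<forall>z. int_vec z \<longrightarrow> (\<exists>k :: 'n \<Rightarrow> int. z = (\<Sum>i\<in>UNIV. of_int (k i) *\<^sub>R b i)))"

text \<open>An elementary change of basis and the matching change of coordinates; the opposite signs
  of \<open>e\<close> make the two changes cancel.\<close>

lemma sum_exchange:
  fixes b :: "'n::finite \<Rightarrow> 'a::real_vector" and k :: "'n \<Rightarrow> int"
  assumes "i \<noteq> j"
  shows "(\<Sum>l\<in>UNIV. of_int ((k(i := k i - e * k j)) l) *\<^sub>R (b(j := b j + of_int e *\<^sub>R b i)) l)
       = (\<Sum>l\<in>UNIV. of_int (k l) *\<^sub>R b l)"
proof -
  define A where "A = UNIV - {i} - {j}"
  have "(\<Sum>l\<in>UNIV. f l) = f i + (f j + sum f A)" for f :: "'n \<Rightarrow> 'a"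
    unfolding A_def using assms by (subst sum.remove[of _ i]; simp; subst sum.remove[of _ j]; simp)
  moreover have "(\<Sum>l\<in>A. of_int ((k(i := k i - e * k j)) l) *\<^sub>R (b(j := b j + of_int e *\<^sub>R b i)) l)
      = (\<Sum>l\<in>A. of_int (k l) *\<^sub>R b l)"
    by (intro sum.cong) (auto simp: A_def)
  ultimately show ?thesis using assms by (simp add: algebra_simps)
qed

lemma spans_int_exchange:
  assumes "spans_int b" "i \<noteq> j"
  shows "spans_int (b(j := b j + of_int e *\<^sub>R b i))"
  unfolding spans_int_def
proof (intro conjI allI impI)
  show "int_vec ((b(j := b j + of_int e *\<^sub>R b i)) l)" for l
    using assms(1) unfolding spans_int_def by (simp add: int_vec_add int_vec_scale)
  fix z :: "real ^ 'a" assume "int_vec z"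
  then obtain k :: "'a \<Rightarrow> int" where "z = (\<Sum>i\<in>UNIV. of_int (k i) *\<^sub>R b i)"
    using assms(1) unfolding spans_int_def by blast
  then show "\<exists>k :: 'a \<Rightarrow> int. z = (\<Sum>l\<in>UNIV. of_int (k l) *\<^sub>R (b(j := b j + of_int e *\<^sub>R b i)) l)"
    using sum_exchange[OF assms(2), of k e b] by metis
qed

text \<open>The Euclidean algorithm as a minimality argument: among all pairs of an integral basis
  and coordinates of \<open>u\<close> in it, one with the least sum of absolute values has a single
  nonzero coordinate. Since \<open>c\<close> takes the value 1 at \<open>u\<close>, that coordinate
  is a unit.\<close>

lemma primitive_extends:
  assumes u: "int_vec (u :: real ^ 'n)" and c: "int_vec c" "c \<bullet> u = 1"
  obtains b i where "spans_int b" "b i = u"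
proof -
  define Q where "Q = (\<lambda>(b, k::'n \<Rightarrow> int). spans_int b \<and> u = (\<Sum>i\<in>UNIV. of_int (k i) *\<^sub>R b i))"
  define \<mu> where "\<mu> = (\<lambda>(b :: 'n \<Rightarrow> real ^ 'n, k::'n \<Rightarrow> int). nat (\<Sum>i\<in>UNIV. \<bar>k i\<bar>))"
  have "spans_int (\<lambda>i. axis i (1::real) :: real ^ 'n)"
    unfolding spans_int_def using int_vec_sum_basis int_vec_axis by (metis Ints_1)
  moreover obtain k where "u = (\<Sum>i\<in>UNIV. of_int (k i) *\<^sub>R axis i 1)" using int_vec_sum_basis[OF u] .
  ultimately have "Q (\<lambda>i. axis i 1, k)" unfolding Q_def by simp
  then obtain x where x: "Q x" "\<And>y. Q y \<Longrightarrow> \<mu> x \<le> \<mu> y"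
    using ex_has_least_nat[of Q _ \<mu>] by blast
  obtain b k where bk: "x = (b, k)" by (cases x)
  have b: "spans_int b" "u = (\<Sum>i\<in>UNIV. of_int (k i) *\<^sub>R b i)" using x(1) unfolding bk Q_def by auto
  have contr: False if ij: "i \<noteq> j" "k j \<noteq> 0" "\<bar>k j\<bar> \<le> \<bar>k i\<bar>" for i j
  proof -
    \<comment> \<open>With this sign, subtracting \<open>e * k j\<close> from \<open>k i\<close>
      lowers its absolute value by that of \<open>k j\<close>.\<close>
    define e where "e = sgn (k i) * sgn (k j)"
    define k' where "k' = k(i := k i - e * k j)"
    define b' where "b' = b(j := b j + of_int e *\<^sub>R b i)"
    have "Q (b', k')" unfolding Q_def k'_def b'_def
      using spans_int_exchange[OF b(1) ij(1)] sum_exchange[OF ij(1), of k e b] b(2) by simp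
    then have "\<mu> (b, k) \<le> \<mu> (b', k')" using x(2) bk by blast
    moreover have "\<bar>k' i\<bar> < \<bar>k i\<bar>"
      using ij unfolding k'_def e_def by (auto simp: sgn_if abs_if split: if_splits)
    moreover have "(\<Sum>l\<in>UNIV. \<bar>k' l\<bar>) < (\<Sum>l\<in>UNIV. \<bar>k l\<bar>)"
      using calculation(2) by (intro sum_strict_mono_ex1) (auto simp: k'_def intro!: exI[of _ i])
    moreover have "0 \<le> (\<Sum>l\<in>UNIV. \<bar>k' l\<bar>)" by (simp add: sum_nonneg)
    ultimately show False unfolding \<mu>_def prod.case by linarith
  qed
  have "\<exists>i. k i \<noteq> 0"
  proof (rule ccontr)
    assume "\<nexists>i. k i \<noteq> 0"
    then have "u = 0" using b(2) by simp
    then show False using c(2) by simp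
  qed
  then obtain i where i: "k i \<noteq> 0" by blast
  have "k j = 0" if "j \<noteq> i" for j
  proof (rule ccontr)
    assume "k j \<noteq> 0"
    then show False using contr[of i j] contr[of j i] that i by (metis linear)
  qed
  then have "(\<Sum>j\<in>UNIV. of_int (k j) *\<^sub>R b j) = of_int (k i) *\<^sub>R b i"
    by (subst sum.remove[of UNIV i]) (auto intro!: sum.neutral)
  then have ui: "u = of_int (k i) *\<^sub>R b i" using b(2) by simp
  have "c \<bullet> b i \<in> \<int>" using c(1) b(1) unfolding spans_int_def by (blast intro: int_vec_inner)
  then obtain q where "c \<bullet> b i = of_int q" by (elim Ints_cases)
  then have "of_int (k i) * of_int q = (1::real)" using c(2) ui by simp
  then have "k i * q = 1" by (metis of_int_1 of_int_eq_iff of_int_mult)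
  \<comment> \<open>A unit of the integers is its own inverse, so \<open>b i\<close> is also
    \<open>k i\<close> times \<open>u\<close>.\<close>
  then have kk: "k i * k i = 1" by (metis zmult_eq_1_iff minus_mult_minus)
  have bi: "b i = of_int (k i) *\<^sub>R u" unfolding ui using kk
    by (metis of_int_1 of_int_mult scaleR_one scaleR_scaleR)
  have "spans_int (b(i := u))" unfolding spans_int_def
  proof (intro conjI allI impI)
    show "int_vec ((b(i := u)) l)" for l using b(1) u unfolding spans_int_def by simp
    fix z :: "real ^ 'n" assume "int_vec z"
    then obtain l :: "'n \<Rightarrow> int" where l: "z = (\<Sum>j\<in>UNIV. of_int (l j) *\<^sub>R b j)"
      using b(1) unfolding spans_int_def by blast
    have "z = (\<Sum>j\<in>UNIV. of_int ((l(i := l i * k i)) j) *\<^sub>R (b(i := u)) j)"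
      unfolding l by (intro sum.cong refl) (auto simp: bi)
    then show "\<exists>l :: 'n \<Rightarrow> int. z = (\<Sum>j\<in>UNIV. of_int (l j) *\<^sub>R (b(i := u)) j)" by blast
  qed
  then show ?thesis using that[of "b(i := u)" i] by simp
qed

section \<open>Lattice bases and Farey neighbours\<close>

interpretation Z: module "zscale :: int \<Rightarrow> 'a::real_vector \<Rightarrow> 'a"
  by (rule module_zscale)

text \<open>The standard basis lies in the integer span, so \<open>B\<close> spans the real space of
  dimension n + 1. With at most n + 1 elements it is independent over the reals, a fortiori over the
  integers.\<close>

lemma lattice_basis_if_spanning:
  fixes B :: "((real ^ 'n) \<times> real) set"
  assumes fin: "finite B" and card: "card B \<le> CARD('n) + 1" and sub: "B \<subseteq> int_lattice"
    and sp: "int_lattice \<subseteq> Z.span B"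
  shows "lattice_basis B"
proof -
  have "Z.span B \<subseteq> int_lattice"
  proof
    fix z assume "z \<in> Z.span B"
    then show "z \<in> int_lattice"
    proof (induction rule: Z.span_induct_alt)
      case base
      then show ?case by (simp add: int_lattice_def zero_prod_def)
    next
      case (step c x y)
      then show ?case using sub by (auto simp: int_lattice_def zscale_def)
    qed
  qed
  moreover have "independent B"
  proof -
    have zs: "Z.span B \<subseteq> span B"
    proof
      fix z assume "z \<in> Z.span B"
      then show "z \<in> span B"
        by (induction rule: Z.span_induct_alt) (auto simp: zscale_def span_zero intro: span_add span_scale span_base)
    qed
    have "Basis \<subseteq> (int_lattice :: ((real ^ 'n) \<times> real) set)"
      by (auto simp: int_lattice_def Basis_prod_def Basis_vec_def axis_def)
    then have "Basis \<subseteq> span B" using zs sp by blast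
    then have "UNIV \<subseteq> span B" using span_minimal[of Basis "span B"] span_Basis by (metis subspace_span)
    then show ?thesis using card fin by (intro card_le_dim_spanning[of B UNIV]) (simp_all add: dim_UNIV)
  qed
  moreover have "independent B \<Longrightarrow> \<not> Z.dependent B"
  proof -
    assume ind: "independent B"
    show "\<not> Z.dependent B"
    proof
      assume "Z.dependent B"
      then obtain t u where t: "finite t" "t \<subseteq> B" "(\<Sum>v\<in>t. zscale (u v) v) = 0" "\<exists>v\<in>t. u v \<noteq> 0"
        unfolding Z.dependent_explicit by blast
      then have "(\<Sum>v\<in>t. of_int (u v) *\<^sub>R v) = 0" "\<exists>v\<in>t. of_int (u v) \<noteq> (0::real)"
        unfolding zscale_def by simp_all
      then have "dependent B" unfolding dependent_explicit using t(1,2) by (intro exI[of _ t] exI[of _ "\<lambda>v. of_int (u v)"]) simp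
      then show False using ind by blast
    qed
  qed
  ultimately show ?thesis using sp unfolding lattice_basis_def by blast
qed

text \<open>The two vectors are the homogenized points at parameters \<open>r / s\<close> and
  \<open>r' / s'\<close>. By Cramer's rule determinant 1 recovers \<open>(p, 1)\<close> and
  \<open>(u, 0)\<close> from them; the other members of an integral basis through the primitive
  \<open>u\<close> generate the rest.\<close>

lemma unimodular_pair_extends:
  fixes p u c :: "real ^ 'n" and r s r' s' :: int
  assumes p: "int_vec p" and u: "int_vec u" and c: "int_vec c" "c \<bullet> u = 1"
    and det: "r' * s - r * s' = 1"
  obtains B where "lattice_basis B"
    "(of_int s *\<^sub>R p + of_int r *\<^sub>R u, of_int s) \<in> B"
    "(of_int s' *\<^sub>R p + of_int r' *\<^sub>R u, of_int s') \<in> B"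
proof -
  obtain b i0 where b: "spans_int b" "b i0 = u" using primitive_extends[OF u c] .
  define A where "A = (of_int s *\<^sub>R p + of_int r *\<^sub>R u, of_int s :: real)"
  define A' where "A' = (of_int s' *\<^sub>R p + of_int r' *\<^sub>R u, of_int s' :: real)"
  define D where "D = (\<lambda>i. (b i, 0::real)) ` (UNIV - {i0})"
  define B where "B = insert A (insert A' D)"
  have ib: "int_vec (b i)" for i using b(1) unfolding spans_int_def by blast
  have detr: "of_int r' * of_int s - of_int r * of_int s' = (1::real)"
    using arg_cong[OF det, of real_of_int] by simp
  have P: "(p, 1) = zscale r' A + zscale (- r) A'"
  proof -
    have "of_int r' *\<^sub>R (of_int s *\<^sub>R p + of_int r *\<^sub>R u) + of_int (- r) *\<^sub>R (of_int s' *\<^sub>R p + of_int r' *\<^sub>R u)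
        = (of_int r' * of_int s - of_int r * of_int s') *\<^sub>R p"
      by (simp add: algebra_simps)
    then show ?thesis using detr by (simp add: A_def A'_def zscale_def)
  qed
  have U: "(u, 0) = zscale (- s') A + zscale s A'"
  proof -
    have "of_int (- s') *\<^sub>R (of_int s *\<^sub>R p + of_int r *\<^sub>R u) + of_int s *\<^sub>R (of_int s' *\<^sub>R p + of_int r' *\<^sub>R u)
        = (of_int r' * of_int s - of_int r * of_int s') *\<^sub>R u"
      by (simp add: algebra_simps)
    then show ?thesis using detr by (simp add: A_def A'_def zscale_def)
  qed
  have AB: "A \<in> Z.span B" "A' \<in> Z.span B" unfolding B_def by (auto intro: Z.span_base)
  have Ps: "(p, 1) \<in> Z.span B" unfolding P by (intro Z.span_add Z.span_scale AB)
  have Us: "(u, 0) \<in> Z.span B" unfolding U by (intro Z.span_add Z.span_scale AB)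
  have bs: "(b i, 0) \<in> Z.span B" for i
  proof (cases "i = i0")
    case False
    then have "(b i, 0) \<in> D" unfolding D_def by blast
    then show ?thesis unfolding B_def by (intro Z.span_base) simp
  qed (use Us b in simp)
  have "int_lattice \<subseteq> Z.span B"
  proof
    fix z :: "(real ^ 'n) \<times> real" assume "z \<in> int_lattice"
    then obtain x t where z: "z = (x, of_int t)" "int_vec x"
      unfolding int_lattice_def int_vec_def by (auto elim!: Ints_cases)
    have "int_vec (x - of_int t *\<^sub>R p)" using z(2) p by (intro int_vec_diff int_vec_scale) auto
    then obtain k :: "'n \<Rightarrow> int" where k: "x - of_int t *\<^sub>R p = (\<Sum>i\<in>UNIV. of_int (k i) *\<^sub>R b i)"
      using b(1) unfolding spans_int_def by blast
    have "z = zscale t (p, 1) + (\<Sum>i\<in>UNIV. zscale (k i) (b i, 0))"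
    proof (rule prod_eqI)
      show "fst z = fst (zscale t (p, 1) + (\<Sum>i\<in>UNIV. zscale (k i) (b i, 0)))"
        using k by (simp add: z zscale_def fst_sum algebra_simps)
      show "snd z = snd (zscale t (p, 1) + (\<Sum>i\<in>UNIV. zscale (k i) (b i, 0)))"
        by (simp add: z zscale_def snd_sum)
    qed
    then show "z \<in> Z.span B" using Ps bs by (simp add: Z.span_add Z.span_scale Z.span_sum)
  qed
  moreover have "B \<subseteq> int_lattice"
  proof -
    have "int_vec (of_int s *\<^sub>R p + of_int r *\<^sub>R u)" "int_vec (of_int s' *\<^sub>R p + of_int r' *\<^sub>R u)"
      using p u by (auto intro!: int_vec_add int_vec_scale)
    then show ?thesis using ib unfolding B_def A_def A'_def D_def int_lattice_def int_vec_def by auto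
  qed
  moreover have "finite B" unfolding B_def D_def by simp
  moreover have "card B \<le> CARD('n) + 1"
  proof -
    have "card D \<le> CARD('n) - 1" unfolding D_def
      using card_image_le[of "UNIV - {i0}" "\<lambda>i. (b i, 0::real)"] by simp
    moreover have "card B \<le> card D + 2" unfolding B_def D_def by (simp add: card_insert_if)
    moreover have "CARD('n) \<ge> 1" by (simp add: Suc_leI)
    ultimately show ?thesis by linarith
  qed
  ultimately have "lattice_basis B" by (intro lattice_basis_if_spanning)
  then show ?thesis using that unfolding B_def A_def A'_def by blast
qed

text \<open>The functional \<open>c\<close> recovers the parameter from the point, so every
  denominator of the point is one of \<open>r / s\<close>.\<close>

lemma den_on_line:
  fixes p u c :: "real ^ 'n" and r s :: int
  assumes p: "int_vec p" and u: "int_vec u" and c: "int_vec c" "c \<bullet> u = 1"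
    and s: "s > 0" "coprime r s"
  shows "den (p + (of_int r / of_int s) *\<^sub>R u) = nat s"
  unfolding den_def
proof (rule Least_equality)
  define x where "x = p + (of_int r / of_int s) *\<^sub>R u"
  have sx: "of_int s *\<^sub>R x = of_int s *\<^sub>R p + of_int r *\<^sub>R u"
    using s(1) by (simp add: x_def scaleR_right_distrib)
  have "int_vec (of_int s *\<^sub>R x)" unfolding sx using p u by (auto intro!: int_vec_add int_vec_scale)
  then show "0 < nat s \<and> (\<forall>i. real (nat s) * (p + (of_int r / of_int s) *\<^sub>R u) $ i \<in> \<int>)"
    unfolding x_def[symmetric] using s(1) by (simp add: int_vec_def)
  fix d assume d: "0 < d \<and> (\<forall>i. real d * (p + (of_int r / of_int s) *\<^sub>R u) $ i \<in> \<int>)"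
  then have "int_vec (real d *\<^sub>R x)" unfolding x_def int_vec_def by simp
  then have "c \<bullet> (real d *\<^sub>R x - real d *\<^sub>R p) \<in> \<int>"
    using c(1) p int_vec_scale[of "real d" p] by (intro int_vec_inner int_vec_diff) simp_all
  also have "real d *\<^sub>R x - real d *\<^sub>R p = (real d * (of_int r / of_int s)) *\<^sub>R u"
    by (simp add: x_def scaleR_right_distrib)
  finally obtain k :: int where "real d * (of_int r / of_int s) = of_int k" using c(2) by (auto elim: Ints_cases)
  then have "real d * of_int r = of_int k * of_int s" using s(1) by (simp add: field_simps)
  then have "int d * r = k * s" by (metis of_int_eq_iff of_int_mult of_int_of_nat_eq)
  then have "s dvd int d" using s(2) by (metis coprime_commute coprime_dvd_mult_left_iff dvd_triv_right)
  then show "nat s \<le> d" using d by (simp add: zdvd_imp_le nat_le_iff)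
qed

lemma rational_on_line:
  fixes p u c :: "real ^ 'n"
  assumes "int_vec p" "int_vec u" "int_vec c" "c \<bullet> u = 1"
  shows "rational_point (p + t *\<^sub>R u) \<longleftrightarrow> t \<in> \<rat>"
proof
  assume "t \<in> \<rat>"
  then show "rational_point (p + t *\<^sub>R u)"
    using assms by (intro rational_point_add rational_point_scale rational_point_if_int_vec)
next
  assume "rational_point (p + t *\<^sub>R u)"
  then have "c \<bullet> ((p + t *\<^sub>R u) - p) \<in> \<rat>"
    using assms(1,3) by (blast intro: rational_point_inner rational_point_diff rational_point_if_int_vec)
  then show "t \<in> \<rat>" using assms(4) by simp
qed

text \<open>Consecutive points of bounded denominator on a line through an integer point behave like
  Farey neighbours: otherwise the unimodular partner of the first one, reduced modulo that one,
  would be a point of small denominator strictly in between.\<close>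
lemma farey_neighbours:
  fixes r s r' s' :: int
  assumes s: "0 < s" "s \<le> N" "0 < s'" "s' \<le> N" and cop: "coprime r s" "coprime r' s'" and lt: "r * s' < r' * s"
    and gap: "\<And>r'' s''. 0 < s'' \<Longrightarrow> s'' \<le> N \<Longrightarrow> coprime r'' s'' \<Longrightarrow>
       \<not> (r * s'' < r'' * s \<and> r'' * s' < r' * s'')"
  shows "r' * s - r * s' = 1"
proof (rule ccontr)
  assume ne: "r' * s - r * s' \<noteq> 1"
  define D where "D = r' * s - r * s'"
  have D: "D > 1" using ne lt unfolding D_def by linarith
  obtain x y where "x * r + y * s = 1" using cop(1) bezout_int[of r s] by (metis coprime_imp_gcd_eq_1)
  then have xy: "y * s - r * (- x) = 1" by (simp add: algebra_simps)
  \<comment> \<open>Subtracting multiples of \<open>(r, s)\<close> from the partner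
    \<open>(y, - x)\<close> keeps its determinant with \<open>(r, s)\<close> and changes the one
    with \<open>(r', s')\<close> by multiples of \<open>D\<close>; \<open>q\<close> makes the latter
    a remainder.\<close>
  define q where "q = (r' * (- x) - y * s') div D"
  define s2 where "s2 = - x - q * s"
  define r2 where "r2 = y - q * r"
  have d1: "r2 * s - r * s2 = 1" using xy unfolding r2_def s2_def by (simp add: algebra_simps)
  have "r' * s2 - r2 * s' = (r' * (- x) - y * s') - q * D"
    unfolding r2_def s2_def D_def by (simp add: algebra_simps)
  also have "\<dots> = (r' * (- x) - y * s') mod D" unfolding q_def by (simp add: minus_div_mult_eq_mod)
  finally have d2: "0 \<le> r' * s2 - r2 * s'" "r' * s2 - r2 * s' < D" using D by simp_all
  define F where "F = r' * s2 - r2 * s'"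
  \<comment> \<open>Cramer's rule: \<open>D\<close> times \<open>(r2, s2)\<close> is
    \<open>F\<close> times \<open>(r, s)\<close> plus \<open>(r', s')\<close>. As \<open>F\<close>
    is at most \<open>D - 1\<close>, the bound \<open>N\<close> passes to \<open>s2\<close>.\<close>
  have eq_s: "D * s2 = F * s + s'"
  proof -
    have "D * s2 - (F * s + s') = s' * (r2 * s - r * s2 - 1)"
      unfolding D_def F_def by (simp add: algebra_simps)
    then show ?thesis using d1 by simp
  qed
  have eq_r: "D * r2 = F * r + r'"
  proof -
    have "D * r2 - (F * r + r') = r' * (r2 * s - r * s2 - 1)"
      unfolding D_def F_def by (simp add: algebra_simps)
    then show ?thesis using d1 by simp
  qed
  have "0 < D * s2" unfolding eq_s using d2 s unfolding F_def by (simp add: add_nonneg_pos)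
  then have s2: "0 < s2" using D by (simp add: zero_less_mult_iff)
  have "D * s2 \<le> (D - 1) * N + N" unfolding eq_s
    using d2 s unfolding F_def by (intro add_mono mult_mono) auto
  then have "D * s2 \<le> D * N" by (simp add: algebra_simps)
  then have s2N: "s2 \<le> N" using D by simp
  have "coprime r2 s2"
  proof (rule coprimeI)
    fix e assume "e dvd r2" "e dvd s2"
    then have "e dvd r2 * s - r * s2" by simp
    then show "is_unit e" using d1 by simp
  qed
  then have "\<not> (r * s2 < r2 * s \<and> r2 * s' < r' * s2)" using gap s2 s2N by blast
  \<comment> \<open>By \<open>d1\<close> the new fraction exceeds \<open>r / s\<close>, so it cannot
    lie below \<open>r' / s'\<close>. Equality makes \<open>D\<close> a common divisor of
    \<open>r'\<close> and \<open>s'\<close>.\<close>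
  then have "F = 0" using d1 d2 unfolding F_def by linarith
  then have "D dvd s'" "D dvd r'" using eq_s eq_r by (metis add_0 dvd_triv_left mult_zero_left)+
  then have "is_unit D" using cop(2) by (metis coprime_common_divisor)
  then show False using D by simp
qed

lemma regular_simplex_closed_segment:
  assumes "a \<noteq> b" "closed_segment a b \<subseteq> unit_cube" "rational_point a" "rational_point b"
    and "lattice_basis B" "homog a \<in> B" "homog b \<in> B"
  shows "regular_simplex (closed_segment a b)"
proof -
  have v: "vertices (closed_segment a b) = {a, b}"
    unfolding vertices_def by (auto simp: extreme_point_of_closed_segment)
  have "is_simplex (closed_segment a b)" unfolding is_simplex_def using simplex_closed_segment[OF assms(1)] by blast
  then show ?thesis unfolding regular_simplex_def v using assms by auto
qed

text \<open>Determinant 1 serves twice: the homogenized ends extend to a lattice basis, and a common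
  divisor of the two denominators would divide the determinant.\<close>

lemma farey_segment:
  fixes p u c :: "real ^ 'n"
  assumes p: "int_vec p" and u: "int_vec u" and c: "int_vec c" "c \<bullet> u = 1"
    and a: "a = p + t *\<^sub>R u" "rational_point a" "den a \<le> N"
    and b: "b = p + t' *\<^sub>R u" "rational_point b" "den b \<le> N"
    and "t < t'" and cube: "closed_segment a b \<subseteq> unit_cube"
    and gap: "\<And>x. x \<in> open_segment a b \<Longrightarrow> rational_point x \<Longrightarrow> den x > N"
  shows "regular_simplex (closed_segment a b) \<and> Gcd (den ` vertices (closed_segment a b)) = 1"
proof -
  have tq: "t \<in> \<rat>" "t' \<in> \<rat>" using a b rational_on_line[OF p u c] by simp_all
  obtain r s where rs: "s > 0" "coprime r s" "t = of_int r / of_int s" using tq(1) by (elim Rats_cases')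
  obtain r' s' where rs': "s' > 0" "coprime r' s'" "t' = of_int r' / of_int s'" using tq(2) by (elim Rats_cases')
  have da: "den a = nat s" and db: "den b = nat s'"
    using den_on_line[OF p u c] rs rs' a(1) b(1) by simp_all
  have u0: "u \<noteq> 0" using c by auto
  have det: "r' * s - r * s' = 1"
  proof (rule farey_neighbours[OF rs(1) _ rs'(1) _ rs(2) rs'(2), of "int N"])
    show "s \<le> int N" "s' \<le> int N" using a(3) b(3) da db by simp_all
    have "of_int r * of_int s' < (of_int r' * of_int s :: real)"
      using \<open>t < t'\<close> rs rs' by (simp add: field_simps)
    then show "r * s' < r' * s" by (metis of_int_less_iff of_int_mult)
    fix r'' s'' :: int assume s'': "0 < s''" "s'' \<le> int N" "coprime r'' s''"
    define x where "x = p + (of_int r'' / of_int s'') *\<^sub>R u"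
    have "den x = nat s''" unfolding x_def using den_on_line[OF p u c] s'' by simp
    then have "den x \<le> N" using s'' by simp
    moreover have "rational_point x" unfolding x_def using rational_on_line[OF p u c] by simp
    ultimately have nx: "x \<notin> open_segment a b" using gap by force
    show "\<not> (r * s'' < r'' * s \<and> r'' * s' < r' * s'')"
    proof
      assume "r * s'' < r'' * s \<and> r'' * s' < r' * s''"
      then have "of_int r * of_int s'' < (of_int r'' * of_int s :: real)" "of_int r'' * of_int s' < (of_int r' * of_int s'' :: real)"
        by (metis of_int_less_iff of_int_mult)+
      then have lt: "t < of_int r'' / of_int s''" "of_int r'' / of_int s'' < t'"
        unfolding rs(3) rs'(3) using rs(1) rs'(1) s''(1) by (simp_all add: field_simps)
      define y where "y = (of_int r'' / of_int s'' :: real)"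
      define \<theta> where "\<theta> = (y - t) / (t' - t)"
      have th: "0 < \<theta>" "\<theta> < 1" "t + \<theta> * (t' - t) = y"
        using lt[folded y_def] unfolding \<theta>_def by (simp_all add: divide_less_eq_1)
      have "x = (1 - \<theta>) *\<^sub>R a + \<theta> *\<^sub>R b"
        unfolding x_def y_def[symmetric] a(1) b(1) th(3)[symmetric] by (simp add: algebra_simps)
      moreover have "a \<noteq> b" using a(1) b(1) u0 \<open>t < t'\<close> by simp
      ultimately have "x \<in> open_segment a b" using th by (auto simp: in_segment)
      then show False using nx by blast
    qed
  qed
  have ha: "homog a = (of_int s *\<^sub>R p + of_int r *\<^sub>R u, of_int s)"
  proof -
    have "homog a = real (nat s) *\<^sub>R (p + (of_int r / of_int s) *\<^sub>R u, 1)"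
      unfolding homog_def da unfolding a(1) rs(3) ..
    then show ?thesis using rs(1) by (simp add: scaleR_right_distrib)
  qed
  have hb: "homog b = (of_int s' *\<^sub>R p + of_int r' *\<^sub>R u, of_int s')"
  proof -
    have "homog b = real (nat s') *\<^sub>R (p + (of_int r' / of_int s') *\<^sub>R u, 1)"
      unfolding homog_def db unfolding b(1) rs'(3) ..
    then show ?thesis using rs'(1) by (simp add: scaleR_right_distrib)
  qed
  obtain B where B: "lattice_basis B" "homog a \<in> B" "homog b \<in> B"
    using unimodular_pair_extends[OF p u c det] unfolding ha hb .
  have ab: "a \<noteq> b" using a(1) b(1) u0 \<open>t < t'\<close> by simp
  have "regular_simplex (closed_segment a b)"
    using regular_simplex_closed_segment[OF ab cube a(2) b(2) B] .
  moreover have "Gcd (den ` vertices (closed_segment a b)) = 1"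
  proof -
    have v: "vertices (closed_segment a b) = {a, b}"
      unfolding vertices_def by (auto simp: extreme_point_of_closed_segment)
    have "gcd s s' dvd r' * s - r * s'" by (intro dvd_diff dvd_mult) simp_all
    then have "gcd s s' = 1" using det by simp
    moreover have "int (gcd (nat s) (nat s')) = gcd s s'"
      using rs(1) rs'(1) by (simp flip: gcd_int_int_eq)
    ultimately have "gcd (nat s) (nat s') = 1" by simp
    then show ?thesis unfolding v by (simp add: da db)
  qed
  ultimately show ?thesis ..
qed

text \<open>The coordinate at \<open>b\<close> is an integral linear functional on the lattice; its
  values at the standard basis are the coefficients \<open>m\<close> and
  \<open>\<beta>\<close>.\<close>

lemma dual_functional:
  fixes B :: "((real ^ 'n) \<times> real) set"
  assumes B: "lattice_basis B" and b: "b \<in> B"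
  obtains m \<beta> where "int_vec m" "\<beta> \<in> \<int>" "m \<bullet> fst b + \<beta> * snd b = 1"
    "\<And>b'. b' \<in> B \<Longrightarrow> b' \<noteq> b \<Longrightarrow> m \<bullet> fst b' + \<beta> * snd b' = 0"
proof -
  have ind: "\<not> Z.dependent B" and sp: "Z.span B = int_lattice" using B unfolding lattice_basis_def by auto
  define f where "f z = Z.representation B z b" for z
  have add: "f (x + y) = f x + f y" if "x \<in> int_lattice" "y \<in> int_lattice" for x y
    unfolding f_def using that Z.representation_add[OF ind] sp by simp
  have scale: "f (zscale k x) = k * f x" if "x \<in> int_lattice" for x k
    unfolding f_def using that Z.representation_scale[OF ind] sp by simp
  have basis: "f b' = (if b' = b then 1 else 0)" if "b' \<in> B" for b'
    unfolding f_def using Z.representation_basis[OF ind that] by simp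
  define m where "m = (\<chi> i. real_of_int (f (axis i 1, 0)))"
  define \<beta> where "\<beta> = (of_int (f (0, 1)) :: real)"
  have lat: "(axis i 1, 0) \<in> (int_lattice :: ((real ^ 'n) \<times> real) set)" "(0, 1) \<in> (int_lattice :: ((real ^ 'n) \<times> real) set)" for i
    by (simp_all add: int_lattice_def axis_def)
  \<comment> \<open>The coordinate is additive only on the lattice, so membership has to be carried
    through the induction.\<close>
  have latsum: "(\<Sum>i\<in>A. zscale (k i) (axis i 1, 0)) \<in> (int_lattice :: ((real ^ 'n) \<times> real) set)
      \<and> f (\<Sum>i\<in>A. zscale (k i) (axis i 1, 0)) = (\<Sum>i\<in>A. k i * f (axis i 1, 0))" if "finite A" for A :: "'n set" and k
    using that
  proof (induction A)
    case empty
    have 0: "(0 :: (real ^ 'n) \<times> real) \<in> int_lattice" by (simp add: int_lattice_def zero_prod_def)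
    then show ?case using add[OF 0 0] by simp
  next
    case (insert i A)
    have "zscale (k i) (axis i 1, 0) \<in> (int_lattice :: ((real ^ 'n) \<times> real) set)"
      unfolding sp[symmetric] by (intro Z.span_scale) (simp add: sp lat)
    moreover from this have "zscale (k i) (axis i 1, 0) + (\<Sum>i\<in>A. zscale (k i) (axis i 1, 0)) \<in> (int_lattice :: ((real ^ 'n) \<times> real) set)"
      using insert unfolding sp[symmetric] by (intro Z.span_add) auto
    ultimately show ?case using insert scale[OF lat(1)] add by simp
  qed
  have val: "m \<bullet> fst z + \<beta> * snd z = of_int (f z)" if z: "z \<in> int_lattice" for z
  proof -
    obtain x t where xt: "z = (x, of_int t)" "int_vec x"
      using z unfolding int_lattice_def int_vec_def by (auto elim!: Ints_cases)
    obtain k :: "'n \<Rightarrow> int" where k: "x = (\<Sum>i\<in>UNIV. of_int (k i) *\<^sub>R axis i 1)" using int_vec_sum_basis[OF xt(2)] .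
    have zk: "z = (\<Sum>i\<in>UNIV. zscale (k i) (axis i 1, 0)) + zscale t (0, 1)"
      by (rule prod_eqI) (simp_all add: xt(1) zscale_def k fst_sum snd_sum)
    have "zscale t (0, 1) \<in> (int_lattice :: ((real ^ 'n) \<times> real) set)"
      unfolding sp[symmetric] by (intro Z.span_scale) (simp add: sp lat)
    then have "f z = (\<Sum>i\<in>UNIV. k i * f (axis i 1, 0)) + t * f (0, 1)"
      unfolding zk using add latsum[of UNIV k] scale[OF lat(2)] by simp
    moreover have "x $ i = of_int (k i)" for i
      unfolding k by (simp add: axis_def if_distrib cong: if_cong)
    ultimately show ?thesis by (simp add: xt(1) m_def \<beta>_def inner_vec_def mult.commute)
  qed
  have "b' \<in> int_lattice" if "b' \<in> B" for b' using that Z.span_base unfolding sp[symmetric] by blast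
  then have "m \<bullet> fst b' + \<beta> * snd b' = (if b' = b then 1 else 0)" if "b' \<in> B" for b'
    using val[of b'] basis[OF that] that by simp
  moreover have "int_vec m" "\<beta> \<in> \<int>" by (simp_all add: m_def \<beta>_def int_vec_def)
  ultimately show ?thesis using that[of m \<beta>] b by simp
qed

section \<open>The image of a retraction\<close>

lemma rational_relation_zero:
  fixes t :: real
  assumes "t \<notin> \<rat>" "a \<in> \<rat>" "b \<in> \<rat>" "a + t * b = 0"
  shows "a = 0 \<and> b = 0"
proof -
  have "b = 0"
  proof (rule ccontr)
    assume "b \<noteq> 0"
    then have "t = - a / b" using assms(4) by (simp add: field_simps)
    then show False using assms by simp
  qed
  then show ?thesis using assms(4) by simp
qed

text \<open>Rational affine subspaces of dimension at most 1 that contain an integer point; \<open>u\<close> is a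
  primitive direction, as witnessed by \<open>c\<close>.\<close>
definition int_line :: "(real ^ 'n) set \<Rightarrow> bool" where
  "int_line L \<longleftrightarrow> (\<exists>p. int_vec p \<and> L = {p}) \<or>
     (\<exists>p u c. int_vec p \<and> int_vec u \<and> int_vec c \<and> c \<bullet> u = 1 \<and> L = range (\<lambda>t. p + t *\<^sub>R u))"

text \<open>An irrational point determines its line. By \<open>c'\<close> its parameter on the
  second line is an integral affine expression in the irrational parameter \<open>t\<close> on the
  first; comparing the coefficients of 1 and of \<open>t\<close> in each coordinate identifies the
  lines.\<close>

lemma int_line_Int_rational:
  assumes "int_line L" "int_line L'" "L \<noteq> L'" "x \<in> L" "x \<in> L'"
  shows "rational_point x"
proof (rule ccontr)
  assume irr: "\<not> rational_point x"
  then have ni: "\<not> int_vec x" using rational_point_if_int_vec by blast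
  obtain p u c where L: "int_vec p" "int_vec u" "int_vec c" "c \<bullet> u = 1" "L = range (\<lambda>t. p + t *\<^sub>R u)"
    using assms(1,4) ni unfolding int_line_def by blast
  obtain p' u' c' where L': "int_vec p'" "int_vec u'" "int_vec c'" "c' \<bullet> u' = 1" "L' = range (\<lambda>t. p' + t *\<^sub>R u')"
    using assms(2,5) ni unfolding int_line_def by blast
  obtain t where t: "x = p + t *\<^sub>R u" using assms(4) L(5) by blast
  obtain t' where t': "x = p' + t' *\<^sub>R u'" using assms(5) L'(5) by blast
  have tirr: "t \<notin> \<rat>" using irr rational_on_line[OF L(1-4)] t by blast
  define \<alpha> \<beta> where "\<alpha> = c' \<bullet> (p - p')" and "\<beta> = c' \<bullet> u"
  have ab: "\<alpha> \<in> \<int>" "\<beta> \<in> \<int>" unfolding \<alpha>_def \<beta>_def using L L' by (auto intro!: int_vec_inner int_vec_diff)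
  have "c' \<bullet> (x - p') = \<alpha> + t * \<beta>" unfolding t \<alpha>_def \<beta>_def by (simp add: inner_diff_right inner_add_right)
  moreover have "c' \<bullet> (x - p') = t'" unfolding t' using L'(4) by simp
  ultimately have t'eq: "t' = \<alpha> + t * \<beta>" by simp
  have comp: "(p - p' - \<alpha> *\<^sub>R u') $ i = 0 \<and> (u - \<beta> *\<^sub>R u') $ i = 0" for i
  proof (rule rational_relation_zero[OF tirr])
    have "rational_point (p - p' - \<alpha> *\<^sub>R u')" "rational_point (u - \<beta> *\<^sub>R u')"
      using L L' ab by (auto intro!: rational_point_if_int_vec int_vec_diff int_vec_scale)
    then show "(p - p' - \<alpha> *\<^sub>R u') $ i \<in> \<rat>" "(u - \<beta> *\<^sub>R u') $ i \<in> \<rat>" unfolding rational_point_def by blast+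
    have "p + t *\<^sub>R u = p' + (\<alpha> + t * \<beta>) *\<^sub>R u'" using t t' t'eq by simp
    then have "(p + t *\<^sub>R u) $ i = (p' + (\<alpha> + t * \<beta>) *\<^sub>R u') $ i" by simp
    then show "(p - p' - \<alpha> *\<^sub>R u') $ i + t * (u - \<beta> *\<^sub>R u') $ i = 0"
      by (simp add: algebra_simps)
  qed
  have "p - p' - \<alpha> *\<^sub>R u' = 0" "u - \<beta> *\<^sub>R u' = 0"
    unfolding vec_eq_iff using comp by (simp_all only: zero_index simp_thms)
  then have pe: "p = p' + \<alpha> *\<^sub>R u'" and ue: "u = \<beta> *\<^sub>R u'" by (simp_all add: algebra_simps)
  have "\<beta> \<noteq> 0" using L(4) ue by auto
  have eq: "p + s *\<^sub>R u = p' + (\<alpha> + s * \<beta>) *\<^sub>R u'" for s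
    unfolding pe ue by (simp add: algebra_simps)
  have "L = L'"
  proof
    show "L \<subseteq> L'" unfolding L(5) L'(5) eq by blast
    show "L' \<subseteq> L"
    proof
      fix y assume "y \<in> L'"
      then obtain s where "y = p' + s *\<^sub>R u'" using L'(5) by blast
      then have "y = p + ((s - \<alpha>) / \<beta>) *\<^sub>R u" unfolding eq using \<open>\<beta> \<noteq> 0\<close> by simp
      then show "y \<in> L" unfolding L(5) by blast
    qed
  qed
  then show False using assms(3) by blast
qed

lemma affine_range_affine_map: "affine (range (\<lambda>x. M *v x + (b :: real ^ 'm)))"
proof -
  have "range (\<lambda>x. M *v x + b) = (+) b ` range ((*v) M)" by (auto simp: image_image add.commute)
  moreover have "affine (range ((*v) M))"
    by (intro subspace_imp_affine linear_subspace_image matrix_vector_mul_linear subspace_UNIV)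
  ultimately show ?thesis using affine_translation[of "range ((*v) M)" b] by simp
qed

text \<open>The value \<open>b\<close> at 0 is an integer point, and a nonzero column of
  \<open>M\<close> gives the direction, which becomes primitive after division by the gcd of its
  entries.\<close>

lemma int_line_range:
  fixes M :: "real ^ 'n ^ 'm" and b :: "real ^ 'm"
  assumes M: "\<And>i j. M $ i $ j \<in> \<int>" and b: "int_vec b"
    and dim: "aff_dim (range (\<lambda>x. M *v x + b)) \<le> 1"
  shows "int_line (range (\<lambda>x. M *v x + b))"
proof (cases "M = 0")
  case True
  then have "range (\<lambda>x. M *v x + b) = {b}" by auto
  then show ?thesis using b unfolding int_line_def by blast
next
  case False
  then obtain i j where "M $ i $ j \<noteq> 0" by (metis vec_eq_iff zero_index)
  define m where "m = M *v axis j 1"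
  have mj: "m $ k = M $ k $ j" for k unfolding m_def by (simp add: matrix_vector_mul_component inner_axis)
  have "int_vec m" "m \<noteq> 0" using M mj \<open>M $ i $ j \<noteq> 0\<close> unfolding int_vec_def by auto
  then obtain u c and g :: int where u: "int_vec u" "int_vec c" "c \<bullet> u = 1" "g > 0" "m = of_int g *\<^sub>R u"
    by (rule primitive_direction)
  define L where "L = range (\<lambda>x. M *v x + b)"
  have "b \<in> L" unfolding L_def by (rule range_eqI[of _ _ 0]) simp
  moreover have "b + m \<in> L" unfolding L_def m_def by (rule range_eqI[of _ _ "axis j 1"]) (simp add: add.commute)
  moreover have aL: "affine L" unfolding L_def by (rule affine_range_affine_map)
  ultimately have sub: "affine hull {b, b + m} \<subseteq> L" by (simp add: hull_minimal)
  have d: "aff_dim (affine hull {b, b + m}) = 1" using \<open>m \<noteq> 0\<close> by (simp add: aff_dim_2)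
  have "aff_dim (affine hull {b, b + m}) \<le> aff_dim L" using sub by (rule aff_dim_subset)
  then have "aff_dim L = aff_dim (affine hull {b, b + m})" using d dim unfolding L_def by simp
  then have "affine hull {b, b + m} = L"
    using affine_dim_equal[OF affine_affine_hull aL _ sub] by simp
  then have "L = range (\<lambda>t. b + t *\<^sub>R m)" by (simp add: affine_hull_2_alt)
  also have "\<dots> = range (\<lambda>t. b + t *\<^sub>R u)"
  proof
    show "range (\<lambda>t. b + t *\<^sub>R m) \<subseteq> range (\<lambda>t. b + t *\<^sub>R u)" unfolding u(5) by auto
    show "range (\<lambda>t. b + t *\<^sub>R u) \<subseteq> range (\<lambda>t. b + t *\<^sub>R m)"
    proof
      fix y assume "y \<in> range (\<lambda>t. b + t *\<^sub>R u)"
      then obtain t where "y = b + t *\<^sub>R u" by blast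
      then have "y = b + (t / of_int g) *\<^sub>R m" unfolding u(5) using u(4) by simp
      then show "y \<in> range (\<lambda>t. b + t *\<^sub>R m)" by blast
    qed
  qed
  finally show ?thesis using b u unfolding int_line_def L_def by blast
qed

lemma aff_dim_unit_cube: "aff_dim (unit_cube :: (real ^ 'n) set) = int (CARD('n))"
proof -
  have "(\<chi> i. 1 / 2) \<in> box 0 (1 :: real ^ 'n)" by (simp add: mem_box_cart)
  then have "interior (unit_cube :: (real ^ 'n) set) \<noteq> {}" unfolding interior_cbox by blast
  then show ?thesis using aff_dim_nonempty_interior by fastforce
qed

lemma finite_components_finite_Union:
  fixes \<F> :: "'a::topological_space set set"
  assumes "finite \<F>" "\<And>F. F \<in> \<F> \<Longrightarrow> connected F"
  shows "finite (components (\<Union>\<F>))"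
proof (rule finite_subset)
  show "components (\<Union>\<F>) \<subseteq> (\<lambda>F. connected_component_set (\<Union>\<F>) (SOME y. y \<in> F)) ` \<F>"
  proof
    fix c assume "c \<in> components (\<Union>\<F>)"
    then obtain x where x: "x \<in> \<Union>\<F>" "c = connected_component_set (\<Union>\<F>) x" by (elim componentsE)
    then obtain F where F: "F \<in> \<F>" "x \<in> F" by blast
    have "(SOME y. y \<in> F) \<in> F" using F(2) by (rule someI)
    then have "connected_component (\<Union>\<F>) x (SOME y. y \<in> F)"
      using F assms(2) unfolding connected_component_def by blast
    then have "c = connected_component_set (\<Union>\<F>) (SOME y. y \<in> F)"
      unfolding x(2) using connected_component_eq by fastforce
    then show "c \<in> (\<lambda>F. connected_component_set (\<Union>\<F>) (SOME y. y \<in> F)) ` \<F>" using F(1) by blast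
  qed
qed (use assms(1) in simp)

lemma finite_bounded_den: "finite {x :: real ^ 'n. x \<in> unit_cube \<and> rational_point x \<and> den x \<le> N}"
proof -
  define A where "A = (\<lambda>k::nat. real k) ` {..N}"
  define G where "G = vec_lambda ` (PiE UNIV (\<lambda>_::'n. A))"
  have finG: "finite G" unfolding G_def A_def by (intro finite_imageI finite_PiE) auto
  have "{x :: real ^ 'n. x \<in> unit_cube \<and> rational_point x \<and> den x \<le> N} \<subseteq> (\<Union>d\<in>{..N}. (\<lambda>z. (1 / real d) *\<^sub>R z) ` G)"
  proof
    fix x :: "real ^ 'n" assume "x \<in> {x. x \<in> unit_cube \<and> rational_point x \<and> den x \<le> N}"
    then have x: "x \<in> unit_cube" "rational_point x" "den x \<le> N" by auto
    define d where "d = den x"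
    have d: "d > 0" "int_vec (real d *\<^sub>R x)" using den_properties[OF x(2)] unfolding d_def by auto
    have "real d * x $ i \<in> A" for i
    proof -
      have xi: "0 \<le> x $ i" "x $ i \<le> 1" using x(1) by (simp_all add: mem_box_cart)
      obtain k where k: "real d * x $ i = of_int k" using d(2) unfolding int_vec_def by (auto elim: Ints_cases)
      have "real d * x $ i \<le> real d * 1" using xi by (intro mult_left_mono) auto
      then have "of_int k \<le> real N" using k x(3) unfolding d_def by simp
      moreover have "0 \<le> real d * x $ i" using xi by simp
      then have "0 \<le> k" unfolding k by simp
      ultimately have "nat k \<le> N" "real (nat k) = of_int k" by (simp_all add: nat_le_iff)
      then show ?thesis unfolding A_def k by (intro image_eqI[of _ _ "nat k"]) simp_all
    qed
    then have "real d *\<^sub>R x \<in> G" unfolding G_def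
      by (intro image_eqI[of _ _ "\<lambda>i. real d * x $ i"]) (auto simp: vec_eq_iff)
    moreover have "x = (1 / real d) *\<^sub>R (real d *\<^sub>R x)" using d(1) by simp
    ultimately show "x \<in> (\<Union>d\<in>{..N}. (\<lambda>z. (1 / real d) *\<^sub>R z) ` G)" using x(3) unfolding d_def by blast
  qed
  then show ?thesis by (rule finite_subset) (use finG in simp)
qed

lemma vertices_closed_segment: "vertices (closed_segment a b) = {a, b :: 'a::euclidean_space}"
  unfolding vertices_def by (auto simp: extreme_point_of_closed_segment)

lemma vertices_singleton: "vertices {a :: 'a::euclidean_space} = {a}"
  using vertices_closed_segment[of a a] by simp

lemma regular_simplex_face:
  assumes "regular_simplex S" "is_simplex F" "F \<subseteq> S" "vertices F \<subseteq> vertices S"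
  shows "regular_simplex F"
  using assms unfolding regular_simplex_def by blast

context graph_complex
begin

lemma no_isolated_vertex:
  assumes con: "connected (\<Union>\<K>)" and v: "v \<in> V" and ne: "\<Union>\<K> \<noteq> {v}"
  obtains u where "E v u"
proof -
  have "v \<in> \<Union>\<K>" using v unfolding complex_vertices_def by blast
  then obtain x X where X: "X \<in> \<K>" "x \<in> X" "x \<noteq> v" using ne by blast
  from X(1) have "\<exists>w\<in>V. w \<noteq> v"
  proof (cases rule: complex_cases)
    case (2 w)
    then show ?thesis using X by blast
  next
    case (3 a b)
    then show ?thesis using adj_vertex[OF 3(1)] adj_vertex[OF adj_sym[OF 3(1)]] adj_irrefl by metis
  qed (use X in simp)
  then obtain w where w: "w \<in> V" "w \<noteq> v" by blast
  have "E\<^sup>*\<^sup>* v w" using vertex_connected[OF con v w(1)] .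
  then show ?thesis using that w(2) by (metis converse_rtranclpE)
qed

end

section \<open>One-dimensional retracts of the cube as unions of chords\<close>

locale z_retraction_dim_1 =
  fixes P :: "(real ^ 'n) set" and \<sigma> \<K> \<C>
  assumes triangulated: "triangulates \<K> unit_cube"
    and affine_on: "T \<in> \<K> \<Longrightarrow> \<exists>(M :: real ^ 'n ^ 'n) b. (\<forall>i j. M $ i $ j \<in> \<int>) \<and> int_vec b \<and> (\<forall>x\<in>T. \<sigma> x = M *v x + b)"
    and fixes_P: "x \<in> P \<Longrightarrow> \<sigma> x = x"
    and image_eq: "\<sigma> ` unit_cube = P"
    and P_cube: "P \<subseteq> unit_cube"
    and cover: "finite \<C>" "\<Union>\<C> = P" "S \<in> \<C> \<Longrightarrow> compact S" "S \<in> \<C> \<Longrightarrow> convex S" "S \<in> \<C> \<Longrightarrow> aff_dim S \<le> 1"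
    and infinite_P: "infinite P"
begin

lemma finite_triangulation: "finite \<K>"
  and Union_triangulation: "\<Union>\<K> = unit_cube"
  and compact_simplices: "T \<in> \<K> \<Longrightarrow> compact T"
  using triangulated compact_simplex unfolding triangulates_def simplicial_complex_def by blast+

lemma closed_simplices: "T \<in> \<K> \<Longrightarrow> closed T"
  using compact_simplices compact_imp_closed by blast

lemma continuous_retraction: "continuous_on unit_cube \<sigma>"
proof -
  have "continuous_on T \<sigma>" if "T \<in> \<K>" for T
  proof -
    obtain M b where "\<forall>x\<in>T. \<sigma> x = M *v x + b" using affine_on[OF \<open>T \<in> \<K>\<close>] by blast
    then show ?thesis
      by (subst continuous_on_cong[OF refl, of T \<sigma> "\<lambda>x. M *v x + b"])
        (auto intro!: continuous_intros matrix_vector_mult_linear_continuous_on)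
  qed
  then have "continuous_on (\<Union>T\<in>\<K>. T) \<sigma>"
    using finite_triangulation closed_simplices by (intro continuous_on_closed_Union) auto
  then show ?thesis using Union_triangulation by simp
qed

lemma compact_P: "compact P"
  using compact_continuous_image[OF continuous_retraction compact_cbox] image_eq by simp

lemma connected_P: "connected P"
  using connected_continuous_image[OF continuous_retraction] image_eq convex_connected convex_box(1) by metis

lemma contractible_P: "contractible P"
proof -
  have "P retract_of unit_cube"
    unfolding retract_of_def retraction_def
    using P_cube continuous_retraction image_eq fixes_P by (intro exI[of _ \<sigma>]) auto
  then show ?thesis using retract_of_contractible convex_imp_contractible convex_box(1) by blast
qed

text \<open>Only for these simplexes is the affine hull of the image the full range of the affine
  map, so that it contains the integer point at which 0 is sent. The image of a smaller simplex may
  span a rational line without integer points.\<close>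

definition full :: "(real ^ 'n) set set" where
  "full = {T \<in> \<K>. aff_dim T = int (CARD('n))}"

lemma Union_full: "\<Union>full = unit_cube"
  unfolding full_def
  by (rule convex_eq_Union_full_dim[OF finite_triangulation closed_simplices Union_triangulation convex_box(1) aff_dim_unit_cube])

lemma full_image:
  assumes "T \<in> full"
  obtains M :: "real ^ 'n ^ 'n" and b where "\<And>i j. M $ i $ j \<in> \<int>" "int_vec b" "\<And>x. x \<in> T \<Longrightarrow> \<sigma> x = M *v x + b"
    "range (\<lambda>x. M *v x + b) = affine hull (\<sigma> ` T)" "int_line (affine hull (\<sigma> ` T))" "aff_dim (\<sigma> ` T) \<le> 1"
proof -
  have T: "T \<in> \<K>" "aff_dim T = int (CARD('n))" using assms unfolding full_def by auto
  obtain M :: "real ^ 'n ^ 'n" and b where Mb: "\<And>i j. M $ i $ j \<in> \<int>" "int_vec b" "\<And>x. x \<in> T \<Longrightarrow> \<sigma> x = M *v x + b"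
    using affine_on[OF T(1)] by blast
  have "affine hull T = UNIV" using T(2) by (simp flip: aff_dim_eq_full)
  have cT: "convex T" using T(1) triangulated convex_simplex unfolding triangulates_def simplicial_complex_def by blast
  have im: "(\<lambda>x. M *v x + b) ` T = (+) b ` ((*v) M ` T)" by (simp add: image_image add.commute)
  have "range (\<lambda>x. M *v x + b) = (+) b ` ((*v) M ` (affine hull T))"
    unfolding \<open>affine hull T = UNIV\<close> by (simp add: image_image add.commute)
  also have "\<dots> = affine hull ((+) b ` ((*v) M ` T))"
    by (simp add: affine_hull_translation affine_hull_linear_image matrix_vector_mul_bounded_linear)
  also have "\<dots> = affine hull (\<sigma> ` T)" using im Mb(3) by (metis (no_types, lifting) image_cong)
  finally have r: "range (\<lambda>x. M *v x + b) = affine hull (\<sigma> ` T)" .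
  have "convex (\<sigma> ` T)"
  proof -
    have "\<sigma> ` T = (+) b ` ((*v) M ` T)" using im Mb(3) by (metis (no_types, lifting) image_cong)
    then show ?thesis using cT by (simp add: convex_translation convex_linear_image matrix_vector_mul_linear)
  qed
  moreover have "\<sigma> ` T \<subseteq> \<Union>\<C>" using image_eq cover(2) T(1) Union_triangulation by blast
  ultimately have dim: "aff_dim (\<sigma> ` T) \<le> 1" using aff_dim_convex_subset_Union[OF cover(1,5)] by simp
  then have "int_line (affine hull (\<sigma> ` T))" using int_line_range[OF Mb(1,2)] r by simp
  then show ?thesis using that[OF Mb r] dim by blast
qed

definition lines :: "(real ^ 'n) set set" where
  "lines = (\<lambda>T. affine hull (\<sigma> ` T)) ` full"

text \<open>The images of the simplexes themselves can end at irrational points, since the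
  triangulation may have irrational vertices. The maximal intervals of P on the lines
  cannot.\<close>

definition chords :: "(real ^ 'n) set set" where
  "chords = (\<Union>L\<in>lines. components (L \<inter> P))"

lemma finite_lines: "finite lines"
  unfolding lines_def full_def using finite_triangulation by simp

lemma linesD:
  assumes "L \<in> lines"
  shows "int_line L" "affine L" "aff_dim L \<le> 1"
proof -
  obtain T where T: "T \<in> full" "L = affine hull (\<sigma> ` T)" using assms unfolding lines_def by blast
  show "int_line L" using full_image[OF T(1)] T(2) by metis
  show "affine L" unfolding T(2) by (rule affine_affine_hull)
  have "aff_dim (\<sigma> ` T) \<le> 1" using full_image[OF T(1)] by metis
  then show "aff_dim L \<le> 1" unfolding T(2) by simp
qed

lemma chordsD:
  assumes "S \<in> chords"
  obtains L where "L \<in> lines" "S \<in> components (L \<inter> P)" "S \<subseteq> L" "S \<subseteq> P"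
    "compact S" "convex S" "aff_dim S \<le> 1"
proof -
  obtain L where L: "L \<in> lines" "S \<in> components (L \<inter> P)" using assms unfolding chords_def by blast
  have sub: "S \<subseteq> L \<inter> P" using in_components_subset[OF L(2)] .
  have "closed L" using linesD(2)[OF L(1)] by (rule affine_closed)
  then have "compact (L \<inter> P)" using compact_P by (simp add: closed_Int_compact)
  then have "compact S" using compact_components L(2) by blast
  moreover have d: "aff_dim S \<le> 1" using aff_dim_subset[of S L] sub linesD(3)[OF L(1)] by simp
  moreover have "convex S" using d in_components_connected[OF L(2)]
    by (simp add: convex_connected_collinear collinear_aff_dim)
  ultimately show ?thesis using that L sub by blast
qed

lemma finite_chords: "finite chords"
proof -
  have "finite (components (L \<inter> P))" if "L \<in> lines" for L
  proof -
    have "L \<inter> P = \<Union>((\<inter>) L ` \<C>)" using cover(2) by blast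
    moreover have "finite (components (\<Union>((\<inter>) L ` \<C>)))"
    proof (rule finite_components_finite_Union)
      show "connected F" if "F \<in> (\<inter>) L ` \<C>" for F
        using that cover(4) affine_imp_convex[OF linesD(2)[OF \<open>L \<in> lines\<close>]]
        by (auto intro!: convex_connected convex_Int)
    qed (use cover(1) in simp)
    ultimately show ?thesis by simp
  qed
  then show ?thesis unfolding chords_def using finite_lines by blast
qed

lemma Union_chords: "\<Union>chords = P"
proof
  show "\<Union>chords \<subseteq> P" using chordsD by blast
  show "P \<subseteq> \<Union>chords"
  proof
    fix x assume "x \<in> P"
    then obtain y where "y \<in> unit_cube" "x = \<sigma> y" using image_eq by blast
    then obtain T where T: "T \<in> full" "y \<in> T" using Union_full by blast
    have "x \<in> affine hull (\<sigma> ` T)" using T(2) \<open>x = \<sigma> y\<close> by (simp add: hull_inc)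
    then have "x \<in> affine hull (\<sigma> ` T) \<inter> P" using \<open>x \<in> P\<close> by blast
    then have "x \<in> \<Union>(components (affine hull (\<sigma> ` T) \<inter> P))" by (simp add: Union_components)
    then show "x \<in> \<Union>chords" unfolding chords_def lines_def using T(1) by blast
  qed
qed

text \<open>At an irrational point, all affine pieces of the retraction map into one and the same line
  and fix it, because an integral affine function of one variable with an irrational fixed
  point is the identity. Hence the line stays in P on both sides of that point.\<close>
lemma extreme_point_of_chord_rational:
  assumes S: "S \<in> chords" and e: "e extreme_point_of S"
  shows "rational_point e"
proof (rule ccontr)
  assume irr: "\<not> rational_point e"
  then have ni: "\<not> int_vec e" using rational_point_if_int_vec by blast
  obtain L where L: "L \<in> lines" "S \<in> components (L \<inter> P)" "S \<subseteq> L" "S \<subseteq> P"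
    using chordsD[OF S] by metis
  have eS: "e \<in> S" using e unfolding extreme_point_of_def by blast
  then have eL: "e \<in> L" "e \<in> P" using L by auto
  obtain p u c where puc: "int_vec p" "int_vec u" "int_vec c" "c \<bullet> u = 1" and Leq: "L = range (\<lambda>t. p + t *\<^sub>R u)"
    using linesD(1)[OF L(1)] eL(1) ni unfolding int_line_def by blast
  obtain \<tau> where \<tau>: "e = p + \<tau> *\<^sub>R u" using eL(1) Leq by blast
  have tirr: "\<tau> \<notin> \<rat>" using irr rational_on_line[OF puc] \<tau> by blast
  have fix_line: "\<sigma> (p + t *\<^sub>R u) = p + t *\<^sub>R u" if T: "T \<in> full" "e \<in> T" "p + t *\<^sub>R u \<in> T" for T t
  proof -
    obtain M :: "real ^ 'n ^ 'n" and b where M: "\<And>i j. M $ i $ j \<in> \<int>" "int_vec b" "\<And>x. x \<in> T \<Longrightarrow> \<sigma> x = M *v x + b"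
      "range (\<lambda>x. M *v x + b) = affine hull (\<sigma> ` T)" "int_line (affine hull (\<sigma> ` T))"
      using full_image[OF T(1)] by metis
    have Me: "M *v e + b = e" using M(3)[OF T(2)] fixes_P[OF eL(2)] by simp
    then have "e \<in> affine hull (\<sigma> ` T)" unfolding M(4)[symmetric] by (metis rangeI)
    then have LT: "affine hull (\<sigma> ` T) = L"
      using int_line_Int_rational[OF M(5) linesD(1)[OF L(1)]] eL(1) irr by blast
    have intM: "int_vec (M *v x)" if "int_vec x" for x
      using that M(1) unfolding int_vec_def matrix_vector_mult_def by (auto intro!: Ints_sum Ints_mult)
    define \<alpha> \<beta> where "\<alpha> = c \<bullet> (M *v p + b - p)" and "\<beta> = c \<bullet> (M *v u)"
    have ab: "\<alpha> \<in> \<int>" "\<beta> \<in> \<int>" unfolding \<alpha>_def \<beta>_def using puc intM M(2)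
      by (auto intro!: int_vec_inner int_vec_diff int_vec_add)
    have on: "M *v (p + s *\<^sub>R u) + b = p + (\<alpha> + s * \<beta>) *\<^sub>R u" for s
    proof -
      have "M *v (p + s *\<^sub>R u) + b \<in> L" unfolding LT[symmetric] M(4)[symmetric] by blast
      then obtain s' where s': "M *v (p + s *\<^sub>R u) + b = p + s' *\<^sub>R u" unfolding Leq by blast
      have "s' = c \<bullet> (M *v (p + s *\<^sub>R u) + b - p)" unfolding s' using puc(4) by simp
      also have "\<dots> = \<alpha> + s * \<beta>" unfolding \<alpha>_def \<beta>_def
        by (simp add: matrix_vector_right_distrib matrix_vector_mult_scaleR inner_add_right inner_diff_right)
      finally show ?thesis using s' by simp
    qed
    have "p + (\<alpha> + \<tau> * \<beta>) *\<^sub>R u = p + \<tau> *\<^sub>R u" using on[of \<tau>] Me \<tau> by simp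
    moreover have "u \<noteq> 0" using puc(4) by auto
    ultimately have "\<alpha> + \<tau> * \<beta> = \<tau>" by (simp only: add_left_cancel scaleR_cancel_right) simp
    then have "\<alpha> + \<tau> * (\<beta> - 1) = 0" by (simp add: algebra_simps)
    then have "\<alpha> = 0 \<and> \<beta> - 1 = 0" using ab Ints_subset_Rats by (intro rational_relation_zero[OF tirr]) auto
    then show ?thesis using on[of t] M(3)[OF T(3)] by simp
  qed
  \<comment> \<open>The full simplexes missing \<open>e\<close> form a closed set, so near
    \<open>e\<close> only affine pieces at \<open>e\<close> matter.\<close>
  define W where "W = \<Union>{T \<in> full. e \<notin> T}"
  have "closed W" unfolding W_def full_def using finite_triangulation closed_simplices by (intro closed_Union) auto
  then have opW: "open (- W)" by (simp add: open_Compl)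
  have eW: "e \<in> - W" unfolding W_def by blast
  have lim: "((\<lambda>t. e + t *\<^sub>R u) \<longlongrightarrow> e) (nhds 0)"
  proof -
    have "((\<lambda>t. e + t *\<^sub>R u) \<longlongrightarrow> e + 0 *\<^sub>R u) (nhds 0)" by (intro tendsto_intros filterlim_ident)
    then show ?thesis by simp
  qed
  \<comment> \<open>The line does not leave the cube at \<open>e\<close>: a coordinate that varies
    along it is irrational at \<open>e\<close>, hence neither 0 nor 1.\<close>
  have "eventually (\<lambda>t. 0 \<le> (e + t *\<^sub>R u) $ i \<and> (e + t *\<^sub>R u) $ i \<le> 1) (nhds 0)" for i
  proof (cases "u $ i = 0")
    case True
    have "e \<in> unit_cube" using eL(2) P_cube by blast
    then show ?thesis using True by (simp add: mem_box_cart)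
  next
    case False
    have eb: "0 \<le> e $ i" "e $ i \<le> 1" using eL(2) P_cube by (auto simp: mem_box_cart)
    have "e $ i \<noteq> k" if "k \<in> \<int>" for k
    proof
      assume "e $ i = k"
      then have "\<tau> * u $ i = k - p $ i" unfolding \<tau> by simp
      then have "\<tau> = (k - p $ i) / u $ i" using False by (simp add: field_simps)
      moreover have "k \<in> \<rat>" "p $ i \<in> \<rat>" "u $ i \<in> \<rat>" using \<open>k \<in> \<int>\<close> puc Ints_subset_Rats unfolding int_vec_def by blast+
      ultimately show False using tirr by simp
    qed
    then have "0 < e $ i" "e $ i < 1" using eb by (metis Ints_0 less_eq_real_def, metis Ints_1 less_eq_real_def)
    moreover have "((\<lambda>t. (e + t *\<^sub>R u) $ i) \<longlongrightarrow> e $ i) (nhds 0)" using lim by (rule tendsto_vec_nth)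
    ultimately have "eventually (\<lambda>t. 0 < (e + t *\<^sub>R u) $ i) (nhds 0)" "eventually (\<lambda>t. (e + t *\<^sub>R u) $ i < 1) (nhds 0)"
      using order_tendstoD by blast+
    then show ?thesis by eventually_elim auto
  qed
  then have "eventually (\<lambda>t. \<forall>i. 0 \<le> (e + t *\<^sub>R u) $ i \<and> (e + t *\<^sub>R u) $ i \<le> 1) (nhds 0)"
    by (rule eventually_all_finite)
  moreover have "eventually (\<lambda>t. e + t *\<^sub>R u \<in> - W) (nhds 0)" using topological_tendstoD[OF lim opW eW] .
  ultimately have "eventually (\<lambda>t. e + t *\<^sub>R u \<in> L \<inter> P) (nhds 0)"
  proof eventually_elim
    case (elim t)
    have cube: "e + t *\<^sub>R u \<in> unit_cube" using elim(1) by (simp add: mem_box_cart)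
    then obtain T where T: "T \<in> full" "e + t *\<^sub>R u \<in> T" using Union_full by blast
    then have "e \<in> T" using elim(2) unfolding W_def by blast
    have et: "e + t *\<^sub>R u = p + (\<tau> + t) *\<^sub>R u" unfolding \<tau> by (simp add: algebra_simps)
    then have "\<sigma> (e + t *\<^sub>R u) = e + t *\<^sub>R u" using fix_line[OF T(1) \<open>e \<in> T\<close>] T(2) by simp
    then have "e + t *\<^sub>R u \<in> P" using cube image_eq by (metis imageI)
    then show ?case unfolding Leq et by blast
  qed
  then obtain d where d: "d > 0" "\<And>t. dist t 0 < d \<Longrightarrow> e + t *\<^sub>R u \<in> L \<inter> P"
    unfolding eventually_nhds_metric by blast
  define a b where "a = e + (- (d / 2)) *\<^sub>R u" and "b = e + (d / 2) *\<^sub>R u"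
  have seg: "closed_segment a b \<subseteq> L \<inter> P"
  proof
    fix x assume "x \<in> closed_segment a b"
    then obtain s where s: "0 \<le> s" "s \<le> 1" "x = (1 - s) *\<^sub>R a + s *\<^sub>R b" by (auto simp: in_segment)
    have "x $ i = (e + ((s - 1 / 2) * d) *\<^sub>R u) $ i" for i
      unfolding s(3) a_def b_def by (simp add: field_simps)
    then have "x = e + ((s - 1 / 2) * d) *\<^sub>R u" by (simp add: vec_eq_iff)
    moreover have "\<bar>(s - 1 / 2) * d\<bar> < d"
    proof -
      have "\<bar>s - 1 / 2\<bar> * d \<le> 1 / 2 * d" using s d(1) by (intro mult_right_mono) (auto simp: abs_if)
      then show ?thesis using d(1) by (simp add: abs_mult)
    qed
    ultimately show "x \<in> L \<inter> P" using d(2)[of "(s - 1 / 2) * d"] by (simp add: dist_real_def)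
  qed
  have mid: "e = (1 - 1/2) *\<^sub>R a + (1/2) *\<^sub>R b" by (simp add: a_def b_def algebra_simps flip: scaleR_add_left)
  have "u \<noteq> 0" using puc(4) by auto
  have "b - a = d *\<^sub>R u" unfolding a_def b_def by (simp flip: scaleR_add_left)
  then have "a \<noteq> b" using d(1) \<open>u \<noteq> 0\<close> by auto
  have eo: "e \<in> open_segment a b"
    unfolding in_segment using \<open>a \<noteq> b\<close> mid by (intro conjI exI[of _ "1/2"]) simp_all
  \<comment> \<open>A component absorbs every connected subset that meets it, which puts
    \<open>e\<close> strictly between two points of \<open>S\<close>.\<close>
  have "closed_segment a b \<subseteq> S"
  proof (rule components_maximal[OF L(2) _ seg])
    have "e \<in> closed_segment a b" using eo by (simp add: open_segment_def)
    then show "S \<inter> closed_segment a b \<noteq> {}" using eS by blast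
  qed simp
  then have "a \<in> S" "b \<in> S" by auto
  then show False using e eo unfolding extreme_point_of_def by blast
qed

text \<open>Different chords on the same line are different components and hence disjoint; chords on
  different lines meet in rational points only.\<close>

lemma extreme_point_of_Int_chords_rational:
  assumes S: "S \<in> chords" "S' \<in> chords" and e: "e extreme_point_of (S \<inter> S')"
  shows "rational_point e"
proof (cases "S = S'")
  case True
  then show ?thesis using extreme_point_of_chord_rational S e by simp
next
  case False
  have eS: "e \<in> S" "e \<in> S'" using e unfolding extreme_point_of_def by auto
  obtain L where L: "L \<in> lines" "S \<in> components (L \<inter> P)" "S \<subseteq> L" using chordsD[OF S(1)] by metis
  obtain L' where L': "L' \<in> lines" "S' \<in> components (L' \<inter> P)" "S' \<subseteq> L'" using chordsD[OF S(2)] by metis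
  have "L \<noteq> L'"
  proof
    assume "L = L'"
    then have "S \<inter> S' = {}" using components_nonoverlap L(2) L'(2) False by blast
    then show False using eS by blast
  qed
  then show ?thesis using int_line_Int_rational linesD(1) L L' eS by blast
qed

lemma strongly_regular_triangulation: "\<exists>\<K>. triangulates \<K> P \<and> strongly_regular_complex \<K>"
proof -
  define X where "X = (\<Union>S\<in>chords. \<Union>S'\<in>chords. {v. v extreme_point_of (S \<inter> S')})"
  have "finite {v. v extreme_point_of (S \<inter> S')}" if S: "S \<in> chords" "S' \<in> chords" for S S'
  proof (rule finite_extreme_points_dim_1)
    have c: "compact S" "convex S" "aff_dim S \<le> 1" "compact S'" "convex S'"
      using chordsD[OF S(1)] chordsD[OF S(2)] by metis+
    then show "compact (S \<inter> S')" "convex (S \<inter> S')" by (simp_all add: compact_Int convex_Int)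
    show "aff_dim (S \<inter> S') \<le> 1" using aff_dim_subset[of "S \<inter> S'" S] c(3) by simp
  qed
  then have finX: "finite X" unfolding X_def using finite_chords by blast
  \<comment> \<open>Large enough for \<open>V\<close> to contain all ends and crossings of chords.
    Admitting every rational point of P up to this bound makes consecutive points Farey
    neighbours.\<close>
  define N where "N = Max (den ` X)"
  define V where "V = {x \<in> P. rational_point x \<and> den x \<le> N}"
  define K where "K = segment_complex chords V"
  interpret C: segment_cover chords V
  proof
    show "finite V" unfolding V_def by (rule finite_subset[OF _ finite_bounded_den[of N]]) (use P_cube in blast)
    show "V \<subseteq> \<Union>chords" unfolding Union_chords V_def by blast
    show "v \<in> V" if S: "S \<in> chords" "S' \<in> chords" "v extreme_point_of (S \<inter> S')" for S S' v
    proof -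
      have "v \<in> X" unfolding X_def using S by blast
      then have "den v \<le> N" unfolding N_def using finX by simp
      moreover have "v \<in> P" using S Union_chords unfolding extreme_point_of_def by blast
      ultimately show ?thesis using extreme_point_of_Int_chords_rational[OF S] unfolding V_def by blast
    qed
    show "compact S" "convex S" "aff_dim S \<le> 1" if "S \<in> chords" for S
      using chordsD[OF that] by metis+
  qed (rule finite_chords)
  have tri: "triangulates K P" using C.triangulates_segment_complex Union_chords by (simp add: K_def)
  interpret G: graph_complex K
    by unfold_locales (use tri C.segment_complex_dim in \<open>auto simp: triangulates_def K_def\<close>)
  have UK: "\<Union>K = P" using tri unfolding triangulates_def by simp
  have edge: "regular_simplex (closed_segment a b) \<and> Gcd (den ` vertices (closed_segment a b)) = 1"
    if E: "complex_adj K a b" for a b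
  proof -
    have ab: "a \<noteq> b" "closed_segment a b \<in> segment_complex chords V" using E unfolding complex_adj_def K_def by auto
    from ab(2) obtain a' b' S where S: "closed_segment a b = closed_segment a' b'" "a' \<in> V" "b' \<in> V" "a' \<noteq> b'"
      "closed_segment a' b' \<subseteq> S" "S \<in> chords" "open_segment a' b' \<inter> V = {}"
    proof (cases rule: C.segment_complex_cases)
      case (2 v)
      then have "a = v" "b = v" by (metis ends_in_segment singletonD)+
      then show ?thesis using ab(1) by simp
    qed auto
    obtain L where L: "L \<in> lines" "S \<subseteq> L" "S \<subseteq> P" using chordsD[OF S(6)] by metis
    have aL: "a' \<in> L" "b' \<in> L" using S(5) L(2) by auto
    obtain p u c where puc: "int_vec p" "int_vec u" "int_vec c" "c \<bullet> u = 1" and Leq: "L = range (\<lambda>t. p + t *\<^sub>R u)"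
      using linesD(1)[OF L(1)] aL S(4) unfolding int_line_def by blast
    obtain t t' where t: "a' = p + t *\<^sub>R u" "b' = p + t' *\<^sub>R u" using aL Leq by blast
    have cube: "closed_segment a' b' \<subseteq> unit_cube" using S(5) L(3) P_cube by blast
    have gap: "den x > N" if "x \<in> open_segment a' b'" "rational_point x" for x
    proof -
      have "x \<in> P" using that(1) S(5) L(3) by (auto simp: open_segment_def)
      moreover have "x \<notin> V" using that(1) S(7) by blast
      ultimately show ?thesis using that(2) unfolding V_def by force
    qed
    have V: "rational_point a'" "den a' \<le> N" "rational_point b'" "den b' \<le> N" using S unfolding V_def by auto
    have "t \<noteq> t'" using t S(4) by auto
    then consider "t < t'" | "t' < t" by linarith
    then show ?thesis
    proof cases
      case 1
      show ?thesis unfolding S(1)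
        by (rule farey_segment[OF puc t(1) V(1,2) t(2) V(3,4) 1 cube gap])
    next
      case 2
      have "closed_segment a b = closed_segment b' a'" using S(1) by (simp add: closed_segment_commute)
      moreover have "closed_segment b' a' \<subseteq> unit_cube" using cube by (simp add: closed_segment_commute)
      moreover have "den x > N" if "x \<in> open_segment b' a'" "rational_point x" for x
        using gap[of x] that by (simp add: open_segment_commute)
      ultimately show ?thesis using farey_segment[OF puc t(2) V(3,4) t(1) V(1,2) 2] by metis
    qed
  qed
  have Pv: "\<Union>K \<noteq> {v}" for v using infinite_P UK by auto
  have nbr: "\<exists>u. complex_adj K v u" if v: "v \<in> complex_vertices K" for v
    using G.no_isolated_vertex[OF _ v Pv] connected_P UK by metis
  have "P \<noteq> {}" using infinite_P by auto
  then obtain X0 where "X0 \<in> K" "X0 \<noteq> {}" using UK by auto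
  then obtain a0 where "a0 \<in> complex_vertices K" using G.complex_cases G.adj_vertex by metis
  then obtain b0 where ab0: "complex_adj K a0 b0" using nbr by blast
  have "regular_simplex X \<and> ((\<forall>T\<in>K. X \<subseteq> T \<longrightarrow> T = X) \<longrightarrow> Gcd (den ` vertices X) = 1)" if X: "X \<in> K" for X
    using X
  proof (cases rule: G.complex_cases)
    case 1
    have "regular_simplex X" unfolding 1
      by (rule regular_simplex_face[OF conjunct1[OF edge[OF ab0]]])
        (auto simp: is_simplex_def vertices_def simplex_empty)
    \<comment> \<open>The empty simplex would violate the gcd condition, as
      \<open>Gcd {} = 0\<close>, but it is not maximal.\<close>
    moreover have "\<not> (\<forall>T\<in>K. X \<subseteq> T \<longrightarrow> T = X)" using 1 \<open>X0 \<in> K\<close> \<open>X0 \<noteq> {}\<close> by blast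
    ultimately show ?thesis by blast
  next
    case (2 v)
    obtain u where u: "complex_adj K v u" using nbr[OF 2(1)] by blast
    have "is_simplex {v}" unfolding is_simplex_def using simplex_singleton by blast
    then have "regular_simplex X" unfolding 2(2)
      by (rule regular_simplex_face[OF conjunct1[OF edge[OF u]]])
        (auto simp: vertices_singleton vertices_closed_segment)
    moreover have "\<not> (\<forall>T\<in>K. X \<subseteq> T \<longrightarrow> T = X)"
    proof
      assume "\<forall>T\<in>K. X \<subseteq> T \<longrightarrow> T = X"
      then have "closed_segment v u = {v}" using G.adj_in_complex[OF u] 2(2) by auto
      then have "u = v" by (metis ends_in_segment(2) singletonD)
      then show False using G.adj_irrefl u by blast
    qed
    ultimately show ?thesis by blast
  next
    case (3 a b)
    then show ?thesis using edge by blast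
  qed
  then show ?thesis using tri unfolding strongly_regular_complex_def regular_complex_def by blast
qed

lemma contains_vertex: "\<exists>v\<in>P. v extreme_point_of (unit_cube :: (real ^ 'n) set)"
proof -
  have 0: "(0 :: real ^ 'n) \<in> unit_cube" by (simp add: mem_box_cart)
  then obtain T where T: "T \<in> \<K>" "0 \<in> T" using Union_triangulation by blast
  obtain M :: "real ^ 'n ^ 'n" and b where Mb: "int_vec b" "\<forall>x\<in>T. \<sigma> x = M *v x + b" using affine_on[OF T(1)] by blast
  then have "\<sigma> 0 = b" using T(2) by simp
  then have bP: "b \<in> P" using image_eq 0 by blast
  have b01: "b $ i = 0 \<or> b $ i = 1" for i
  proof -
    have "0 \<le> b $ i" "b $ i \<le> 1" using bP P_cube by (auto simp: mem_box_cart)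
    moreover obtain k where "b $ i = of_int k" using Mb(1) unfolding int_vec_def by (auto elim: Ints_cases)
    ultimately have "k = 0 \<or> k = 1" by simp linarith
    then show ?thesis using \<open>b $ i = of_int k\<close> by auto
  qed
  have "b extreme_point_of (unit_cube :: (real ^ 'n) set)" unfolding extreme_point_of_def
  proof (intro conjI ballI)
    show "b \<in> unit_cube" using bP P_cube by blast
    fix x y :: "real ^ 'n" assume xy: "x \<in> unit_cube" "y \<in> unit_cube"
    show "b \<notin> open_segment x y"
    proof
      assume "b \<in> open_segment x y"
      then obtain s where s: "x \<noteq> y" "0 < s" "s < 1" "b = (1 - s) *\<^sub>R x + s *\<^sub>R y" by (auto simp: in_segment)
      have "x $ i = y $ i" for i
      proof -
        have r: "0 \<le> x $ i" "x $ i \<le> 1" "0 \<le> y $ i" "y $ i \<le> 1" using xy by (auto simp: mem_box_cart)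
        have be: "b $ i = (1 - s) * x $ i + s * y $ i" using s(4) by simp
        have n: "0 \<le> (1 - s) * x $ i" "0 \<le> s * y $ i" "0 \<le> (1 - s) * (1 - x $ i)" "0 \<le> s * (1 - y $ i)"
          using r s(2,3) by simp_all
        from b01[of i] show ?thesis
        proof
          assume "b $ i = 0"
          then have "(1 - s) * x $ i = 0" "s * y $ i = 0" using be n by linarith+
          then show ?thesis using s(2,3) by simp
        next
          assume "b $ i = 1"
          then have "(1 - s) * (1 - x $ i) + s * (1 - y $ i) = 0" using be by (simp add: algebra_simps)
          then have "(1 - s) * (1 - x $ i) = 0" "s * (1 - y $ i) = 0" using n by linarith+
          then show ?thesis using s(2,3) by simp
        qed
      qed
      then show False using s(1) by (simp add: vec_eq_iff)
    qed
  qed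
  then show ?thesis using bP by blast
qed

end

section \<open>Integral piecewise linear functions on the cube\<close>

text \<open>Integral piecewise linear functions, the McNaughton functions of MV-algebra theory.\<close>
definition ipl :: "(real ^ 'n \<Rightarrow> real) \<Rightarrow> bool" where
  "ipl f \<longleftrightarrow> continuous_on unit_cube f \<and>
     (\<exists>A. finite A \<and> (\<forall>(m, \<beta>)\<in>A. int_vec m \<and> \<beta> \<in> \<int>) \<and> (\<forall>x\<in>unit_cube. \<exists>(m, \<beta>)\<in>A. f x = m \<bullet> x + \<beta>))"

lemma iplE:
  assumes "ipl f"
  obtains A where "finite A" "\<And>m \<beta>. (m, \<beta>) \<in> A \<Longrightarrow> int_vec m \<and> \<beta> \<in> \<int>"
    "\<And>x. x \<in> unit_cube \<Longrightarrow> \<exists>m \<beta>. (m, \<beta>) \<in> A \<and> f x = m \<bullet> x + \<beta>"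
  using assms unfolding ipl_def by fast

lemma iplI:
  assumes "continuous_on unit_cube f" "finite A" "\<And>m \<beta>. (m, \<beta>) \<in> A \<Longrightarrow> int_vec m \<and> \<beta> \<in> \<int>"
    "\<And>x. x \<in> unit_cube \<Longrightarrow> \<exists>m \<beta>. (m, \<beta>) \<in> A \<and> f x = m \<bullet> x + \<beta>"
  shows "ipl f"
  unfolding ipl_def
proof (intro conjI exI[of _ A] ballI)
  show "case a of (m, \<beta>) \<Rightarrow> int_vec m \<and> \<beta> \<in> \<int>" if "a \<in> A" for a
    using assms(3) that by (cases a) simp
  fix x :: "real ^ 'a" assume "x \<in> unit_cube"
  then obtain m \<beta> where "(m, \<beta>) \<in> A" "f x = m \<bullet> x + \<beta>" using assms(4) by blast
  then show "\<exists>(m, \<beta>)\<in>A. f x = m \<bullet> x + \<beta>" by (intro bexI[of _ "(m, \<beta>)"]) simp_all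
qed (use assms(1,2) in auto)

lemma ipl_continuous: "ipl f \<Longrightarrow> continuous_on unit_cube f"
  by (simp add: ipl_def)

lemma ipl_affine:
  assumes "int_vec m" "\<beta> \<in> \<int>" shows "ipl (\<lambda>x. m \<bullet> x + \<beta>)"
  by (rule iplI[of _ "{(m, \<beta>)}"]) (use assms in \<open>auto intro!: continuous_intros\<close>)

lemma ipl_const: "\<beta> \<in> \<int> \<Longrightarrow> ipl (\<lambda>x. \<beta>)"
  using ipl_affine[of 0 \<beta>] by (simp add: int_vec_0)

lemma ipl_coordinate: "ipl (\<lambda>x. x $ i)"
  using ipl_affine[of "axis i 1" 0] by (simp add: int_vec_axis inner_axis')

lemma ipl_add:
  assumes "ipl f" "ipl g" shows "ipl (\<lambda>x. f x + g x)"
proof -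
  obtain A where A: "finite A" "\<And>m \<beta>. (m, \<beta>) \<in> A \<Longrightarrow> int_vec m \<and> \<beta> \<in> \<int>"
    "\<And>x. x \<in> unit_cube \<Longrightarrow> \<exists>m \<beta>. (m, \<beta>) \<in> A \<and> f x = m \<bullet> x + \<beta>" by (rule iplE[OF assms(1)]) blast
  obtain B where B: "finite B" "\<And>m \<beta>. (m, \<beta>) \<in> B \<Longrightarrow> int_vec m \<and> \<beta> \<in> \<int>"
    "\<And>x. x \<in> unit_cube \<Longrightarrow> \<exists>m \<beta>. (m, \<beta>) \<in> B \<and> g x = m \<bullet> x + \<beta>" by (rule iplE[OF assms(2)]) blast
  show ?thesis
  proof (rule iplI)
    show "continuous_on unit_cube (\<lambda>x. f x + g x)" using assms ipl_continuous by (intro continuous_on_add) auto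
    show "finite ((\<lambda>(a, b). a + b) ` (A \<times> B))" using A(1) B(1) by simp
    show "int_vec m \<and> \<beta> \<in> \<int>" if "(m, \<beta>) \<in> (\<lambda>(a, b). a + b) ` (A \<times> B)" for m \<beta>
      using that by (auto dest!: A(2) B(2) intro: int_vec_add)
    fix x :: "real ^ 'a" assume x: "x \<in> unit_cube"
    obtain m \<beta> where a: "(m, \<beta>) \<in> A" "f x = m \<bullet> x + \<beta>" using A(3)[OF x] by blast
    obtain m' \<beta>' where b: "(m', \<beta>') \<in> B" "g x = m' \<bullet> x + \<beta>'" using B(3)[OF x] by blast
    have "(m + m', \<beta> + \<beta>') \<in> (\<lambda>(a, b). a + b) ` (A \<times> B)"
      by (rule image_eqI[of _ _ "((m, \<beta>), (m', \<beta>'))"]) (use a b in auto)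
    moreover have "f x + g x = (m + m') \<bullet> x + (\<beta> + \<beta>')" using a b by (simp add: inner_add_left)
    ultimately show "\<exists>m \<beta>. (m, \<beta>) \<in> (\<lambda>(a, b). a + b) ` (A \<times> B) \<and> f x + g x = m \<bullet> x + \<beta>" by blast
  qed
qed

lemma ipl_scale:
  assumes "ipl f" "k \<in> \<int>" shows "ipl (\<lambda>x. k * f x)"
proof -
  obtain A where A: "finite A" "\<And>m \<beta>. (m, \<beta>) \<in> A \<Longrightarrow> int_vec m \<and> \<beta> \<in> \<int>"
    "\<And>x. x \<in> unit_cube \<Longrightarrow> \<exists>m \<beta>. (m, \<beta>) \<in> A \<and> f x = m \<bullet> x + \<beta>" by (rule iplE[OF assms(1)]) blast
  show ?thesis
  proof (rule iplI)
    show "continuous_on unit_cube (\<lambda>x. k * f x)" using assms ipl_continuous by (intro continuous_on_mult_left) auto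
    show "finite ((\<lambda>a. k *\<^sub>R a) ` A)" using A(1) by simp
    show "int_vec m \<and> \<beta> \<in> \<int>" if "(m, \<beta>) \<in> (\<lambda>a. k *\<^sub>R a) ` A" for m \<beta>
      using that assms(2) by (auto dest!: A(2) intro: int_vec_scale)
    fix x :: "real ^ 'a" assume x: "x \<in> unit_cube"
    obtain m \<beta> where a: "(m, \<beta>) \<in> A" "f x = m \<bullet> x + \<beta>" using A(3)[OF x] by blast
    have "(k *\<^sub>R m, k * \<beta>) \<in> (\<lambda>a. k *\<^sub>R a) ` A"
      by (rule image_eqI[of _ _ "(m, \<beta>)"]) (use a in auto)
    moreover have "k * f x = (k *\<^sub>R m) \<bullet> x + k * \<beta>" using a by (simp add: algebra_simps)
    ultimately show "\<exists>m \<beta>. (m, \<beta>) \<in> (\<lambda>a. k *\<^sub>R a) ` A \<and> k * f x = m \<bullet> x + \<beta>" by blast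
  qed
qed

lemma ipl_diff:
  assumes "ipl f" "ipl g" shows "ipl (\<lambda>x. f x - g x)"
  using ipl_add[OF assms(1) ipl_scale[OF assms(2), of "- 1"]] by simp

text \<open>No regions of linearity enter \<open>ipl\<close>, only a finite supply of affine
  functions. A continuous choice between two functions therefore just needs the union of the two
  supplies.\<close>

lemma ipl_select:
  assumes f: "ipl f" and g: "ipl g" and h: "continuous_on unit_cube h" "\<And>x. h x = f x \<or> h x = g x"
  shows "ipl h"
proof -
  obtain A where A: "finite A" "\<And>m \<beta>. (m, \<beta>) \<in> A \<Longrightarrow> int_vec m \<and> \<beta> \<in> \<int>"
    "\<And>x. x \<in> unit_cube \<Longrightarrow> \<exists>m \<beta>. (m, \<beta>) \<in> A \<and> f x = m \<bullet> x + \<beta>" by (rule iplE[OF f]) blast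
  obtain B where B: "finite B" "\<And>m \<beta>. (m, \<beta>) \<in> B \<Longrightarrow> int_vec m \<and> \<beta> \<in> \<int>"
    "\<And>x. x \<in> unit_cube \<Longrightarrow> \<exists>m \<beta>. (m, \<beta>) \<in> B \<and> g x = m \<bullet> x + \<beta>" by (rule iplE[OF g]) blast
  show ?thesis
  proof (rule iplI[of _ "A \<union> B"])
    show "int_vec m \<and> \<beta> \<in> \<int>" if "(m, \<beta>) \<in> A \<union> B" for m \<beta> using that A(2) B(2) by blast
    show "\<exists>m \<beta>. (m, \<beta>) \<in> A \<union> B \<and> h x = m \<bullet> x + \<beta>" if "x \<in> unit_cube" for x
      using A(3)[OF that] B(3)[OF that] h(2)[of x] by (metis UnI1 UnI2)
  qed (use A(1) B(1) h(1) in auto)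
qed

lemma ipl_max: "ipl f \<Longrightarrow> ipl g \<Longrightarrow> ipl (\<lambda>x. max (f x) (g x))"
  by (rule ipl_select[of f g]) (assumption, assumption, intro continuous_on_max ipl_continuous, assumption, assumption, simp add: max_def)

lemma ipl_min: "ipl f \<Longrightarrow> ipl g \<Longrightarrow> ipl (\<lambda>x. min (f x) (g x))"
  by (rule ipl_select[of f g]) (assumption, assumption, intro continuous_on_min ipl_continuous, assumption, assumption, simp add: min_def)

lemma ipl_abs:
  assumes "ipl f" shows "ipl (\<lambda>x. \<bar>f x\<bar>)"
proof -
  have "ipl (\<lambda>x. max (f x) (- 1 * f x))" using assms by (intro ipl_max ipl_scale) simp_all
  moreover have "(\<lambda>x. max (f x) (- 1 * f x)) = (\<lambda>x. \<bar>f x\<bar>)" by (rule ext) (simp only: max_def abs_if, simp)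
  ultimately show ?thesis by (simp only:)
qed

lemma ipl_sum: "(\<And>i. i \<in> I \<Longrightarrow> ipl (f i)) \<Longrightarrow> ipl (\<lambda>x. \<Sum>i\<in>I. f i x)"
  by (induction I rule: infinite_finite_induct) (simp_all add: ipl_const ipl_add)

lemma ipl_Max:
  assumes "finite I" "I \<noteq> {}" "\<And>i. i \<in> I \<Longrightarrow> ipl (f i)"
  shows "ipl (\<lambda>x. Max ((\<lambda>i. f i x) ` I))"
  using assms
proof (induction I rule: finite_ne_induct)
  case (insert i I)
  have "Max ((\<lambda>i. f i x) ` insert i I) = max (f i x) (Max ((\<lambda>i. f i x) ` I))" for x
    using insert by simp
  then show ?case using insert by (simp add: ipl_max)
qed simp

text \<open>By \<open>side\<close> no difference of two candidates changes sign on the cell, so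
  candidates that agree at a relative interior point agree everywhere. The relative interior thus
  splits into disjoint closed parts according to the candidate, and connectedness leaves
  one.\<close>

lemma piecewise_affine_on_cell:
  fixes f :: "real ^ 'n \<Rightarrow> real"
  assumes X: "convex X" "closed X" "X \<noteq> {}" and f: "continuous_on X f" and A: "finite A"
    and sel: "\<And>x. x \<in> X \<Longrightarrow> \<exists>m \<beta>. (m, \<beta>) \<in> A \<and> f x = m \<bullet> x + \<beta>"
    and side: "\<And>m \<beta> m' \<beta>' x y. (m, \<beta>) \<in> A \<Longrightarrow> (m', \<beta>') \<in> A \<Longrightarrow> x \<in> X \<Longrightarrow> y \<in> X \<Longrightarrow>
       (m \<bullet> x + \<beta> \<le> m' \<bullet> x + \<beta>' \<and> m \<bullet> y + \<beta> \<le> m' \<bullet> y + \<beta>') \<or> (m \<bullet> x + \<beta> \<ge> m' \<bullet> x + \<beta>' \<and> m \<bullet> y + \<beta> \<ge> m' \<bullet> y + \<beta>')"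
  obtains m \<beta> where "(m, \<beta>) \<in> A" "\<And>x. x \<in> X \<Longrightarrow> f x = m \<bullet> x + \<beta>"
proof -
  define R where "R = rel_interior X"
  have RX: "R \<subseteq> X" unfolding R_def by (rule rel_interior_subset)
  have "R \<noteq> {}" unfolding R_def using X(1,3) by (simp add: rel_interior_eq_empty)
  then obtain x0 where x0: "x0 \<in> R" by blast
  obtain m \<beta> where a: "(m, \<beta>) \<in> A" "f x0 = m \<bullet> x0 + \<beta>" using sel[of x0] x0 RX by blast
  define A' where "A' = {a \<in> A. \<exists>y\<in>X. fst a \<bullet> y + snd a \<noteq> m \<bullet> y + \<beta>}"
  have ne: "m' \<bullet> x + \<beta>' \<noteq> m \<bullet> x + \<beta>" if a': "(m', \<beta>') \<in> A'" and x: "x \<in> R" for m' \<beta>' x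
  proof
    assume eq: "m' \<bullet> x + \<beta>' = m \<bullet> x + \<beta>"
    obtain y where y: "y \<in> X" "m' \<bullet> y + \<beta>' \<noteq> m \<bullet> y + \<beta>" and A': "(m', \<beta>') \<in> A"
      using a' unfolding A'_def by auto
    \<comment> \<open>The segment from \<open>y\<close> is prolonged beyond the interior point
      \<open>x\<close>. The difference \<open>D\<close> vanishes at \<open>x\<close>, so it would
      have opposite signs at the two ends.\<close>
    obtain e where e: "e > 1" "(1 - e) *\<^sub>R y + e *\<^sub>R x \<in> X"
      using bspec[OF convex_rel_interior_if[OF X(1) x[unfolded R_def]], of y] hull_inc[OF y(1)] by auto
    define z where "z = (1 - e) *\<^sub>R y + e *\<^sub>R x"
    define D where "D w = (m' \<bullet> w + \<beta>') - (m \<bullet> w + \<beta>)" for w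
    have "D w = (m' - m) \<bullet> w + (\<beta>' - \<beta>)" for w by (simp add: D_def inner_diff_left)
    then have "D z = (1 - e) * D y + e * D x" unfolding z_def
      by (simp add: inner_add_right) (simp add: algebra_simps)
    then have Dz: "D z = (1 - e) * D y" using eq by (simp add: D_def)
    have "D y \<noteq> 0" using y(2) by (simp add: D_def)
    then have "(1 - e) * (D y * D y) < 0" using e(1) by (intro mult_neg_pos) (auto simp: zero_less_mult_iff)
    then have "D y * D z < 0" unfolding Dz by (simp add: mult.left_commute)
    moreover have "(D y \<le> 0 \<and> D z \<le> 0) \<or> (D y \<ge> 0 \<and> D z \<ge> 0)"
      using side[OF A' a(1) y(1) e(2)] unfolding D_def z_def[symmetric] by linarith
    then have "0 \<le> D y * D z" by (auto intro: mult_nonneg_nonneg mult_nonpos_nonpos)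
    ultimately show False by simp
  qed
  have cfR: "continuous_on R f" using f RX by (rule continuous_on_subset)
  have clo: "closedin (top_of_set R) {x \<in> R. f x = n \<bullet> x + \<gamma>}" for n \<gamma>
  proof -
    have "closedin (top_of_set R) {x \<in> R. f x - (n \<bullet> x + \<gamma>) = 0}"
      using cfR by (intro continuous_closedin_preimage_constant continuous_intros)
    then show ?thesis by simp
  qed
  define U1 where "U1 = {x \<in> R. f x = m \<bullet> x + \<beta>}"
  define U2 where "U2 = (\<Union>a\<in>A'. {x \<in> R. f x = fst a \<bullet> x + snd a})"
  have "finite A'" unfolding A'_def using A by (rule rev_finite_subset) blast
  then have c2: "closedin (top_of_set R) U2" unfolding U2_def using clo by (intro closedin_Union) (auto simp del: fst_conv snd_conv)
  have c1: "closedin (top_of_set R) U1" unfolding U1_def by (rule clo)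
  have "R \<subseteq> U1 \<union> U2"
  proof
    fix x assume x: "x \<in> R"
    obtain n \<gamma> where n: "(n, \<gamma>) \<in> A" "f x = n \<bullet> x + \<gamma>" using sel[of x] x RX by blast
    show "x \<in> U1 \<union> U2"
    proof (cases "(n, \<gamma>) \<in> A'")
      case True
      then show ?thesis unfolding U2_def using n x by force
    next
      case False
      then have "n \<bullet> x + \<gamma> = m \<bullet> x + \<beta>" using n(1) x RX unfolding A'_def by auto
      then show ?thesis unfolding U1_def using n x by simp
    qed
  qed
  moreover have "U1 \<inter> U2 = {}" unfolding U1_def U2_def using ne by fastforce
  moreover have "U1 \<noteq> {}" unfolding U1_def using x0 a(2) by blast
  moreover have "connected R" unfolding R_def using X(1) by (intro convex_connected convex_rel_interior)
  ultimately have "U2 = {}" using c1 c2 unfolding connected_closedin by blast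
  then have onR: "f x - (m \<bullet> x + \<beta>) = 0" if "x \<in> R" for x using \<open>R \<subseteq> U1 \<union> U2\<close> that unfolding U1_def by auto
  have clR: "closure R = X" unfolding R_def using X by (simp add: convex_closure_rel_interior)
  have "f x - (m \<bullet> x + \<beta>) = 0" if "x \<in> X" for x
    by (rule continuous_constant_on_closure[of R]) (use f onR that clR in \<open>auto intro!: continuous_intros\<close>)
  then show ?thesis using that a(1) by force
qed

lemma unit_cube_convex_hull:
  "unit_cube = convex hull {x :: real ^ 'n. \<forall>i. x $ i = 0 \<or> x $ i = 1}"
  unfolding Cart_1 unit_interval_convex_hull[where 'a="real ^ 'n"]
  by (rule arg_cong[where f="\<lambda>x. convex hull x"]) (simp add: Basis_vec_def inner_axis)

text \<open>The simplexes of a cover may overlap, so all simplexes with vertices among the corners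
  can be taken; Caratheodory's theorem shows that they cover the cube.\<close>

lemma rational_polyhedron_unit_cube: "rational_polyhedron (unit_cube :: (real ^ 'n) set)"
proof -
  define Q where "Q = {x :: real ^ 'n. \<forall>i. x $ i = 0 \<or> x $ i = 1}"
  have cube: "unit_cube = convex hull Q" unfolding Q_def by (rule unit_cube_convex_hull)
  have "Q \<subseteq> vec_lambda ` (PiE UNIV (\<lambda>_::'n. {0, 1}))"
  proof
    fix x assume "x \<in> Q"
    then show "x \<in> vec_lambda ` (PiE UNIV (\<lambda>_::'n. {0, 1}))" unfolding Q_def
      by (intro image_eqI[of _ _ "\<lambda>i. x $ i"]) auto
  qed
  then have finQ: "finite Q" by (rule finite_subset) (intro finite_imageI finite_PiE; simp)
  define \<C> where "\<C> = (\<lambda>s. convex hull s) ` {s. s \<subseteq> Q \<and> \<not> affine_dependent s}"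
  have "finite \<C>" unfolding \<C>_def using finQ by simp
  moreover have "is_simplex S \<and> S \<subseteq> unit_cube \<and> (\<forall>v\<in>vertices S. rational_point v)" if S: "S \<in> \<C>" for S
  proof -
    obtain s where s: "s \<subseteq> Q" "\<not> affine_dependent s" "S = convex hull s" using S unfolding \<C>_def by blast
    have "is_simplex S" unfolding is_simplex_def simplex_def 
      by (rule exI[of _ "int (card s) - 1"], rule exI[of _ s], intro conjI s(2,3)) simp
    moreover have "S \<subseteq> unit_cube" by (simp only: cube s(3) hull_mono[OF s(1)])
    moreover have "rational_point v" if "v \<in> vertices S" for v
    proof -
      have "v \<in> s" using that extreme_point_of_convex_hull[of v s] unfolding vertices_def s(3) by simp
      then have "v \<in> Q" using s(1) by blast
      then have "v $ i = 0 \<or> v $ i = 1" for i unfolding Q_def by blast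
      then show ?thesis unfolding rational_point_def by (metis Rats_0 Rats_1)
    qed
    ultimately show ?thesis by blast
  qed
  moreover have "\<Union>\<C> = unit_cube"
  proof
    show "\<Union>\<C> \<subseteq> unit_cube" using calculation(2) by blast
    show "unit_cube \<subseteq> \<Union>\<C>"
    proof
      fix x :: "real ^ 'n" assume "x \<in> unit_cube"
      \<comment> \<open>A smallest set of corners with \<open>x\<close> in its hull is affinely
        independent, since Caratheodory's theorem would shrink a dependent one.\<close>
      define R where "R s \<longleftrightarrow> s \<subseteq> Q \<and> x \<in> convex hull s" for s
      have "R Q" using \<open>x \<in> unit_cube\<close> by (simp only: R_def cube) simp
      then obtain s where "R s" and min: "\<And>s'. R s' \<Longrightarrow> card s \<le> card s'"
        using ex_has_least_nat[of R Q card] by metis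
      then have s: "s \<subseteq> Q" "x \<in> convex hull s" by (simp_all only: R_def)
      have fs: "finite s" using s(1) finQ finite_subset by blast
      obtain S where S: "S \<subseteq> s" "int (card S) \<le> aff_dim s + 1" "x \<in> convex hull S"
        using s(2) caratheodory_aff_dim[of s] by auto
      have "R S" using S(1,3) s(1) by (simp add: R_def subset_trans)
      then have "int (card s) \<le> aff_dim s + 1" using min[of S] S(2) by linarith
      moreover have "aff_dim s \<le> int (card s) - 1" using aff_dim_le_card[OF fs] by simp
      ultimately have "\<not> affine_dependent s" using fs by (simp add: affine_independent_iff_card)
      then show "x \<in> \<Union>\<C>" unfolding \<C>_def using s by blast
    qed
  qed
  ultimately show ?thesis unfolding rational_polyhedron_def by blast
qed

text \<open>The cube is cut along all hyperplanes on which two candidates for the same coordinate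
  agree. On each cell every coordinate is then a single integral affine function, and the cells can
  be triangulated.\<close>

lemma z_map_if_ipl:
  fixes \<sigma> :: "real ^ 'n \<Rightarrow> real ^ 'n"
  assumes ipl: "\<And>i. ipl (\<lambda>x. \<sigma> x $ i)" and sub: "\<sigma> ` unit_cube \<subseteq> unit_cube"
  shows "z_map unit_cube unit_cube \<sigma>"
proof -
  have "\<exists>A. finite A \<and> (\<forall>m \<beta>. (m, \<beta>) \<in> A \<longrightarrow> int_vec m \<and> \<beta> \<in> \<int>) \<and>
      (\<forall>x\<in>unit_cube. \<exists>m \<beta>. (m, \<beta>) \<in> A \<and> \<sigma> x $ i = m \<bullet> x + \<beta>)" for i
    using iplE[OF ipl[of i]] by metis
  then obtain A where A: "\<And>i. finite (A i)" "\<And>i m \<beta>. (m, \<beta>) \<in> A i \<Longrightarrow> int_vec m \<and> \<beta> \<in> \<int>"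
    "\<And>i x. x \<in> unit_cube \<Longrightarrow> \<exists>m \<beta>. (m, \<beta>) \<in> A i \<and> \<sigma> x $ i = m \<bullet> x + \<beta>" by metis
  \<comment> \<open>A pair \<open>(a, b)\<close> stands for the hyperplane
    \<open>a \<bullet> x = b\<close>, here the one where the two candidates coincide.\<close>
  define I where "I = (\<Union>i. (\<lambda>((m, \<beta>), (m', \<beta>')). (m - m', \<beta>' - \<beta>)) ` (A i \<times> A i))"
  have finI: "finite I" unfolding I_def using A(1) by simp
  have "polytope X" if "X \<in> {unit_cube :: (real ^ 'n) set}" for X using that by (simp add: polytope_interval)
  moreover have "aff_dim X \<le> int DIM(real ^ 'n)" for X :: "(real ^ 'n) set" by (rule aff_dim_le_DIM)
  moreover have "(X \<inter> Y) face_of X" if "X \<in> {unit_cube :: (real ^ 'n) set}" "Y \<in> {unit_cube}" for X Y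
    using that by (simp add: face_of_refl)
  ultimately obtain \<G> where G: "\<Union>\<G> = (unit_cube :: (real ^ 'n) set)" "finite \<G>" "\<And>X. X \<in> \<G> \<Longrightarrow> polytope X"
    "\<And>X Y. X \<in> \<G> \<Longrightarrow> Y \<in> \<G> \<Longrightarrow> X \<inter> Y face_of X"
    and side: "\<And>X x y a b. X \<in> \<G> \<Longrightarrow> x \<in> X \<Longrightarrow> y \<in> X \<Longrightarrow> (a, b) \<in> I \<Longrightarrow> a \<bullet> x \<le> b \<and> a \<bullet> y \<le> b \<or> a \<bullet> x \<ge> b \<and> a \<bullet> y \<ge> b"
    using cell_subdivision_lemma[of "{unit_cube}" "int DIM(real ^ 'n)" I] finI by auto
  obtain \<T> where T: "simplicial_complex \<T>" "\<Union>\<T> = \<Union>\<G>" "\<And>K. K \<in> \<T> \<Longrightarrow> \<exists>C. C \<in> \<G> \<and> K \<subseteq> C"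
    using simplicial_subdivision_of_cell_complex[OF G(2,3,4)] by metis
  have "\<exists>(M :: real ^ 'n ^ 'n) b. (\<forall>i j. M $ i $ j \<in> \<int>) \<and> (\<forall>i. b $ i \<in> \<int>) \<and> (\<forall>x\<in>S. \<sigma> x = M *v x + b)"
    if S: "S \<in> \<T>" for S
  proof (cases "S = {}")
    case True
    then show ?thesis by (intro exI[of _ 0] exI[of _ 0]) simp
  next
    case False
    obtain X where X: "X \<in> \<G>" "S \<subseteq> X" using T(3)[OF S] by blast
    have Xc: "X \<subseteq> unit_cube" using X G(1) by blast
    have pX: "convex X" "closed X" "X \<noteq> {}" using G(3)[OF X(1)] X(2) False
      by (auto simp: polytope_imp_convex polytope_imp_closed)
    have "\<exists>m \<beta>. (m, \<beta>) \<in> A i \<and> (\<forall>x\<in>X. \<sigma> x $ i = m \<bullet> x + \<beta>)" for i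
    proof (rule piecewise_affine_on_cell[OF pX, of "\<lambda>x. \<sigma> x $ i" "A i"])
      show "continuous_on X (\<lambda>x. \<sigma> x $ i)" using ipl_continuous[OF ipl] Xc by (rule continuous_on_subset)
      show "\<exists>m \<beta>. (m, \<beta>) \<in> A i \<and> \<sigma> x $ i = m \<bullet> x + \<beta>" if "x \<in> X" for x using A(3) Xc that by blast
      fix m \<beta> m' \<beta>' x y assume a: "(m, \<beta>) \<in> A i" "(m', \<beta>') \<in> A i" "x \<in> X" "y \<in> X"
      have "(m - m', \<beta>' - \<beta>) \<in> I" unfolding I_def
        by (rule UN_I[of i], simp, rule image_eqI[of _ _ "((m, \<beta>), (m', \<beta>'))"]) (use a in auto)
      from side[OF X(1) a(3,4) this]
      show "m \<bullet> x + \<beta> \<le> m' \<bullet> x + \<beta>' \<and> m \<bullet> y + \<beta> \<le> m' \<bullet> y + \<beta>' \<or> m' \<bullet> x + \<beta>' \<le> m \<bullet> x + \<beta> \<and> m' \<bullet> y + \<beta>' \<le> m \<bullet> y + \<beta>"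
        by (simp add: inner_diff_left algebra_simps)
    qed (use A(1) in auto)
    then obtain m \<beta> where m: "\<And>i. (m i, \<beta> i) \<in> A i" "\<And>i x. x \<in> X \<Longrightarrow> \<sigma> x $ i = m i \<bullet> x + \<beta> i" by metis
    have mi: "int_vec (m i)" "\<beta> i \<in> \<int>" for i using A(2)[OF m(1)] by blast+
    define M :: "real ^ 'n ^ 'n" where "M = (\<chi> i. m i)"
    have "\<forall>i j. M $ i $ j \<in> \<int>" using mi(1) unfolding M_def int_vec_def by simp
    moreover have "\<forall>i. (\<chi> i. \<beta> i) $ i \<in> \<int>" using mi(2) by simp
    moreover have "\<forall>x\<in>S. \<sigma> x = M *v x + (\<chi> i. \<beta> i)"
      using m(2) X(2) by (auto simp: vec_eq_iff M_def matrix_vector_mul_component)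
    ultimately show ?thesis by blast
  qed
  then show ?thesis using rational_polyhedron_unit_cube sub T G(1) unfolding z_map_def triangulates_def by metis
qed

section \<open>Hat functions of a regular graph\<close>

text \<open>\<open>s\<close> and \<open>t\<close> are the coefficients of \<open>(x, 1)\<close> with
  respect to \<open>homog a\<close> and \<open>homog b\<close>, the barycentric coordinates divided
  by the denominators. Integral functionals dual to the homogenized vertices compute them.\<close>

definition edge_coords :: "real ^ 'n \<Rightarrow> real ^ 'n \<Rightarrow> real \<Rightarrow> real \<Rightarrow> real ^ 'n \<Rightarrow> bool" where
  "edge_coords a b s t x \<longleftrightarrow> 0 \<le> s \<and> 0 \<le> t \<and> s * real (den a) + t * real (den b) = 1 \<and>
     x = (s * real (den a)) *\<^sub>R a + (t * real (den b)) *\<^sub>R b"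

lemma edge_coords_sym: "edge_coords a b s t x \<Longrightarrow> edge_coords b a t s x"
  unfolding edge_coords_def by (simp add: add.commute)

lemma ex_edge_coords:
  assumes "rational_point a" "rational_point b" "x \<in> closed_segment a b"
  obtains s t where "edge_coords a b s t x"
proof -
  obtain u where u: "0 \<le> u" "u \<le> 1" "x = (1 - u) *\<^sub>R a + u *\<^sub>R b" using assms(3) by (auto simp: in_segment)
  have "den a > 0" "den b > 0" using den_properties assms by blast+
  then have "edge_coords a b ((1 - u) / den a) (u / den b) x" unfolding edge_coords_def using u by simp
  then show ?thesis using that by blast
qed

lemma edge_coords_in_segment:
  assumes "edge_coords a b s t x" shows "x \<in> closed_segment a b"
  unfolding in_segment
proof (intro exI[of _ "t * real (den b)"] conjI)
  have c: "s * real (den a) = 1 - t * real (den b)" "0 \<le> s * real (den a)" "0 \<le> t * real (den b)"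
    "x = (s * real (den a)) *\<^sub>R a + (t * real (den b)) *\<^sub>R b"
    using assms unfolding edge_coords_def by (auto simp: algebra_simps)
  show "0 \<le> t * real (den b)" by (rule c(3))
  show "t * real (den b) \<le> 1" using c(1,2) by linarith
  show "x = (1 - t * real (den b)) *\<^sub>R a + (t * real (den b)) *\<^sub>R b" using c(4) unfolding c(1) .
qed

lemma affine_on_edge:
  assumes "edge_coords a b s t x"
  shows "m \<bullet> x + \<beta> = s * (real (den a) * (m \<bullet> a + \<beta>)) + t * (real (den b) * (m \<bullet> b + \<beta>))"
proof -
  have "(s * real (den a) + t * real (den b)) * \<beta> = \<beta>"
    using assms unfolding edge_coords_def by simp
  then have "s * (real (den a) * \<beta>) + t * (real (den b) * \<beta>) = \<beta>" by (simp add: distrib_right)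
  moreover have "m \<bullet> x = s * (real (den a) * (m \<bullet> a)) + t * (real (den b) * (m \<bullet> b))"
    using assms unfolding edge_coords_def by (simp add: inner_add_right)
  ultimately show ?thesis by (simp add: distrib_left)
qed

text \<open>A piecewise linear substitute for the distance from the edge with vertices \<open>v\<close>, \<open>w\<close>,
  where \<open>f\<close> and \<open>g\<close> are the coordinates dual to the two homogenized vertices.\<close>
definition edge_dist :: "real ^ 'n \<Rightarrow> real ^ 'n \<Rightarrow> (real ^ 'n \<Rightarrow> real) \<Rightarrow> (real ^ 'n \<Rightarrow> real) \<Rightarrow> real ^ 'n \<Rightarrow> real" where
  "edge_dist v w f g x = max 0 (- f x) + max 0 (- g x) +
     (\<Sum>i\<in>UNIV. \<bar>x $ i - f x * (real (den v) * v $ i) - g x * (real (den w) * w $ i)\<bar>) +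
     \<bar>1 - f x * real (den v) - g x * real (den w)\<bar>"

lemma edge_dist_sym: "edge_dist v w f g = edge_dist w v g f"
  by (rule ext) (simp add: edge_dist_def algebra_simps)

lemma edge_dist_nonneg: "0 \<le> edge_dist v w f g x"
  unfolding edge_dist_def by (simp add: sum_nonneg)

lemma edge_dist_eq_0D:
  assumes "edge_dist v w f g x = 0"
  shows "edge_coords v w (f x) (g x) x"
proof -
  have "0 \<le> (\<Sum>i\<in>UNIV. \<bar>x $ i - f x * (real (den v) * v $ i) - g x * (real (den w) * w $ i)\<bar>)"
    by (simp add: sum_nonneg)
  then have z: "max 0 (- f x) = 0" "max 0 (- g x) = 0"
    "(\<Sum>i\<in>UNIV. \<bar>x $ i - f x * (real (den v) * v $ i) - g x * (real (den w) * w $ i)\<bar>) = 0"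
    "\<bar>1 - f x * real (den v) - g x * real (den w)\<bar> = 0"
    using assms unfolding edge_dist_def by linarith+
  have "\<bar>x $ i - f x * (real (den v) * v $ i) - g x * (real (den w) * w $ i)\<bar> = 0" for i
    using z(3) by (subst (asm) sum_nonneg_eq_0_iff) auto
  then have "x = (f x * real (den v)) *\<^sub>R v + (g x * real (den w)) *\<^sub>R w"
    by (simp add: vec_eq_iff algebra_simps)
  moreover have "- f x \<le> max 0 (- f x)" "- g x \<le> max 0 (- g x)" by simp_all
  ultimately show ?thesis unfolding edge_coords_def using z(1,2,4) by simp
qed

lemma edge_dist_eq_0:
  assumes "edge_coords v w s t x" "f x = s" "g x = t"
  shows "edge_dist v w f g x = 0"
proof -
  have c: "0 \<le> s" "0 \<le> t" "s * real (den v) + t * real (den w) = 1"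
    "x = (s * real (den v)) *\<^sub>R v + (t * real (den w)) *\<^sub>R w" using assms(1) unfolding edge_coords_def by auto
  have "x $ i = s * real (den v) * v $ i + t * real (den w) * w $ i" for i unfolding c(4) by simp
  then show ?thesis unfolding edge_dist_def assms(2,3) using c(1-3) by simp
qed

lemma ipl_edge_dist:
  assumes "ipl f" "ipl g" "rational_point v" "rational_point w"
  shows "ipl (edge_dist v w f g)"
proof -
  have i: "real (den v) * v $ i \<in> \<int>" "real (den w) * w $ i \<in> \<int>" for i
    using den_properties(2)[OF assms(3)] den_properties(2)[OF assms(4)] unfolding int_vec_def by simp_all
  have "ipl (\<lambda>x. max 0 (- 1 * f x) + max 0 (- 1 * g x) +
     (\<Sum>i\<in>UNIV. \<bar>x $ i - (real (den v) * v $ i) * f x - (real (den w) * w $ i) * g x\<bar>) +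
     \<bar>1 - real (den v) * f x - real (den w) * g x\<bar>)"
    by (intro ipl_add ipl_max ipl_sum ipl_abs ipl_diff ipl_scale ipl_const ipl_coordinate assms i) simp_all
  then show ?thesis unfolding edge_dist_def by (simp add: mult.commute)
qed

locale regular_graph = graph_complex \<K> for \<K> :: "(real ^ 'n) set set" +
  assumes regular: "X \<in> \<K> \<Longrightarrow> regular_simplex X"
    and neighbour: "v \<in> V \<Longrightarrow> \<exists>u. E v u"
begin

lemma edge_regular: "E a b \<Longrightarrow> regular_simplex (closed_segment a b)"
  using regular adj_in_complex by blast

lemma edge_in_cube: "E a b \<Longrightarrow> closed_segment a b \<subseteq> unit_cube"
  using edge_regular unfolding regular_simplex_def by blast

lemma rational_vertex: "v \<in> V \<Longrightarrow> rational_point v"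
proof -
  assume "v \<in> V"
  then obtain u where "E v u" using neighbour by blast
  then have "\<forall>w\<in>{v, u}. rational_point w" using edge_regular vertices_closed_segment unfolding regular_simplex_def by metis
  then show ?thesis by simp
qed

lemma edge_functional:
  assumes "E v w"
  obtains m \<beta> where "int_vec m" "\<beta> \<in> \<int>" "real (den v) * (m \<bullet> v + \<beta>) = 1" "real (den w) * (m \<bullet> w + \<beta>) = 0"
proof -
  obtain B where B: "homog ` {v, w} \<subseteq> B" "lattice_basis B"
    using edge_regular[OF assms] vertices_closed_segment unfolding regular_simplex_def by metis
  have "homog w \<noteq> homog v"
  proof
    assume "homog w = homog v"
    then have "real (den w) = real (den v)" "real (den w) *\<^sub>R w = real (den v) *\<^sub>R v" unfolding homog_def by auto
    moreover have "den v > 0" using den_properties(1) rational_vertex adj_vertex assms by blast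
    ultimately have "w = v" by simp
    then show False using assms adj_irrefl by blast
  qed
  moreover have "homog v \<in> B" "homog w \<in> B" using B(1) by auto
  moreover obtain m \<beta> where "int_vec m" "\<beta> \<in> \<int>" "m \<bullet> fst (homog v) + \<beta> * snd (homog v) = 1"
    "\<And>b'. b' \<in> B \<Longrightarrow> b' \<noteq> homog v \<Longrightarrow> m \<bullet> fst b' + \<beta> * snd b' = 0"
    using dual_functional[OF B(2) \<open>homog v \<in> B\<close>] by metis
  ultimately have fv: "m \<bullet> fst (homog v) + \<beta> * snd (homog v) = 1" and fw: "m \<bullet> fst (homog w) + \<beta> * snd (homog w) = 0"
    and int: "int_vec m" "\<beta> \<in> \<int>" by blast+
  have "real (den v) * (m \<bullet> v + \<beta>) = 1" using fv by (simp add: homog_def algebra_simps)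
  moreover have "real (den w) * (m \<bullet> w + \<beta>) = 0" using fw by (simp add: homog_def distrib_left mult.commute)
  ultimately show ?thesis using that[OF int] by blast
qed

text \<open>Along the edge from \<open>v\<close> to \<open>q\<close> all terms except the one with
  \<open>f\<close>, which is nonnegative and dropped, are multiples of \<open>t\<close>. If their
  total factor were 0, then \<open>q\<close> would lie on the ray from \<open>v\<close> through
  \<open>w\<close>, and one of the two edges would contain a foreign vertex.\<close>

lemma edge_dist_lower_bound:
  assumes vw: "E v w" and vq: "E v q" and ne: "q \<noteq> w"
    and f: "real (den v) * (m \<bullet> v + \<beta>) = 1" and g: "real (den v) * (n \<bullet> v + \<gamma>) = 0"
  obtains \<kappa> where "\<kappa> > 0"
    "\<And>s t x. edge_coords v q s t x \<Longrightarrow> \<kappa> * t \<le> edge_dist v w (\<lambda>x. m \<bullet> x + \<beta>) (\<lambda>x. n \<bullet> x + \<gamma>) x"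
proof -
  define C D where "C = real (den q) * (m \<bullet> q + \<beta>)" and "D = real (den q) * (n \<bullet> q + \<gamma>)"
  define G where "G i = real (den q) * q $ i - C * (real (den v) * v $ i) - D * (real (den w) * w $ i)" for i
  define H where "H = real (den q) - C * real (den v) - D * real (den w)"
  define \<kappa> where "\<kappa> = max 0 (- D) + (\<Sum>i\<in>UNIV. \<bar>G i\<bar>) + \<bar>H\<bar>"
  have pos: "den v > 0" "den q > 0" "den w > 0"
    using den_properties(1) rational_vertex adj_vertex adj_sym vw vq by blast+
  have bound: "\<kappa> * t \<le> edge_dist v w (\<lambda>x. m \<bullet> x + \<beta>) (\<lambda>x. n \<bullet> x + \<gamma>) x" if c: "edge_coords v q s t x" for s t x
  proof -
    have e: "s * real (den v) + t * real (den q) = 1" "0 \<le> t"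
      "x = (s * real (den v)) *\<^sub>R v + (t * real (den q)) *\<^sub>R q" using c unfolding edge_coords_def by auto
    have fx: "m \<bullet> x + \<beta> = s + t * C" using affine_on_edge[OF c, of m \<beta>] f by (simp add: C_def)
    have gx: "n \<bullet> x + \<gamma> = t * D" using affine_on_edge[OF c, of n \<gamma>] g by (simp add: D_def)
    have "x $ i - (s + t * C) * (real (den v) * v $ i) - t * D * (real (den w) * w $ i) = t * G i" for i
      unfolding e(3) G_def by (simp add: algebra_simps)
    then have s1: "(\<Sum>i\<in>UNIV. \<bar>x $ i - (s + t * C) * (real (den v) * v $ i) - t * D * (real (den w) * w $ i)\<bar>) = (\<Sum>i\<in>UNIV. \<bar>G i\<bar>) * t"
      using e(2) by (simp add: abs_mult sum_distrib_left mult.commute)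
    have "1 - (s + t * C) * real (den v) - t * D * real (den w) = t * H"
      unfolding H_def using e(1) by (simp add: algebra_simps)
    then have s2: "\<bar>1 - (s + t * C) * real (den v) - t * D * real (den w)\<bar> = \<bar>H\<bar> * t" using e(2) by (simp add: abs_mult)
    have s3: "max 0 (- (t * D)) = max 0 (- D) * t" unfolding max_mult_distrib_right using e(2) by (simp add: mult.commute)
    show ?thesis unfolding edge_dist_def fx gx s1 s2 s3 \<kappa>_def by (simp add: algebra_simps)
  qed
  have n: "0 \<le> max 0 (- D)" "0 \<le> (\<Sum>i\<in>UNIV. \<bar>G i\<bar>)" "0 \<le> \<bar>H\<bar>" by (simp_all add: sum_nonneg)
  have "\<kappa> \<noteq> 0"
  proof
    assume "\<kappa> = 0"
    then have z: "max 0 (- D) = 0" "(\<Sum>i\<in>UNIV. \<bar>G i\<bar>) = 0" "\<bar>H\<bar> = 0" using n unfolding \<kappa>_def by linarith+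
    have "G i = 0" for i using z(2) by (subst (asm) sum_nonneg_eq_0_iff) auto
    then have qeq: "real (den q) *\<^sub>R q = (C * real (den v)) *\<^sub>R v + (D * real (den w)) *\<^sub>R w"
      unfolding G_def by (simp add: vec_eq_iff algebra_simps)
    have deq: "real (den q) = C * real (den v) + D * real (den w)" using z(3) unfolding H_def by simp
    define \<theta> where "\<theta> = D * real (den w) / real (den q)"
    have th0: "0 \<le> \<theta>" unfolding \<theta>_def using z(1) by simp
    have c1: "C * real (den v) / real (den q) = 1 - \<theta>" unfolding \<theta>_def using deq pos(2) by (simp add: field_simps)
    have "q = (1 / real (den q)) *\<^sub>R (real (den q) *\<^sub>R q)" using pos(2) by simp
    also have "\<dots> = (C * real (den v) / real (den q)) *\<^sub>R v + \<theta> *\<^sub>R w"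
      unfolding qeq \<theta>_def by (simp add: scaleR_add_right)
    finally have q: "q = (1 - \<theta>) *\<^sub>R v + \<theta> *\<^sub>R w" unfolding c1 .
    have qv: "q \<noteq> v" using vq adj_irrefl by blast
    show False
    proof (cases "\<theta> \<le> 1")
      case True
      then have "q \<in> closed_segment v w" unfolding in_segment using q th0 by blast
      then show False using vertex_in_edge[OF vw] adj_vertex[OF adj_sym[OF vq]] qv ne by blast
    next
      case False
      then have "w = (1 - 1 / \<theta>) *\<^sub>R v + (1 / \<theta>) *\<^sub>R q" unfolding q by (simp add: algebra_simps)
      moreover have "0 \<le> 1 / \<theta>" "1 / \<theta> \<le> 1" using False by simp_all
      ultimately have "w \<in> closed_segment v q" unfolding in_segment by blast
      then show False using vertex_in_edge[OF vq] adj_vertex[OF adj_sym[OF vw]] ne vw adj_irrefl by blast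
    qed
  qed
  then have "\<kappa> > 0" using n unfolding \<kappa>_def by linarith
  then show ?thesis using that bound by blast
qed

text \<open>With \<open>s\<close> and \<open>t\<close> taken as in \<open>edge_coords\<close>, the
  hat has height \<open>1 / den w\<close> at its vertex, the normalization for which integral
  coefficients are possible.\<close>

definition hat_value :: "real ^ 'n \<Rightarrow> real ^ 'n \<Rightarrow> real ^ 'n \<Rightarrow> real \<Rightarrow> real \<Rightarrow> real" where
  "hat_value w p q s t = (if w = p then s else if w = q then t else 0)"

text \<open>On an edge sharing an end with the given one, the excess over the hat is at most linear
  in the coordinate of the other end, and \<open>\<delta>\<close> grows at least linearly in it, so
  the ratio is bounded. On a disjoint edge \<open>\<delta>\<close> has a positive minimum by
  compactness.\<close>

lemma edge_hat_bound:
  assumes vw: "E v w" and pq: "E p q" "{p, q} \<noteq> {v, w}"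
    and f: "real (den v) * (m \<bullet> v + \<beta>) = 1" "real (den w) * (m \<bullet> w + \<beta>) = 0" "int_vec m" "\<beta> \<in> \<int>"
    and g: "real (den v) * (n \<bullet> v + \<gamma>) = 0" "real (den w) * (n \<bullet> w + \<gamma>) = 1" "int_vec n" "\<gamma> \<in> \<int>"
  defines "\<delta> \<equiv> edge_dist v w (\<lambda>x. m \<bullet> x + \<beta>) (\<lambda>x. n \<bullet> x + \<gamma>)"
  shows "\<exists>M. \<forall>s t x. edge_coords p q s t x \<longrightarrow> m \<bullet> x + \<beta> - M * \<delta> x \<le> hat_value v p q s t"
proof -
  have hat0: "0 \<le> hat_value v p q s t" if "edge_coords p q s t x" for s t x
    using that unfolding hat_value_def edge_coords_def by simp
  have ne: "closed_segment p q \<noteq> closed_segment v w" using edge_neq_avoid[OF vw pq] .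
  note Int = edge_Int[OF vw adj_in_complex[OF pq(1)] ne]
  have shared_v: "\<exists>M. \<forall>s t x. edge_coords v r s t x \<longrightarrow> m \<bullet> x + \<beta> - M * \<delta> x \<le> s" if r: "E v r" "r \<noteq> w" for r
  proof -
    obtain \<kappa> where k: "\<kappa> > 0" "\<And>s t x. edge_coords v r s t x \<Longrightarrow> \<kappa> * t \<le> \<delta> x"
      using edge_dist_lower_bound[OF vw r f(1) g(1)] unfolding \<delta>_def by metis
    define C where "C = real (den r) * (m \<bullet> r + \<beta>)"
    have "m \<bullet> x + \<beta> - (\<bar>C\<bar> / \<kappa>) * \<delta> x \<le> s" if c: "edge_coords v r s t x" for s t x
    proof -
      have "m \<bullet> x + \<beta> = s + t * C" using affine_on_edge[OF c, of m \<beta>] f(1) by (simp add: C_def)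
      moreover have "t * C \<le> t * \<bar>C\<bar>" using c unfolding edge_coords_def by (intro mult_left_mono) auto
      moreover have "(\<bar>C\<bar> / \<kappa>) * (\<kappa> * t) \<le> (\<bar>C\<bar> / \<kappa>) * \<delta> x" using k(1) k(2)[OF c] by (intro mult_left_mono) auto
      moreover have "(\<bar>C\<bar> / \<kappa>) * (\<kappa> * t) = t * \<bar>C\<bar>" using k(1) by simp
      ultimately show ?thesis by linarith
    qed
    then show ?thesis by blast
  qed
  have shared_w: "\<exists>M. \<forall>s t x. edge_coords w r s t x \<longrightarrow> m \<bullet> x + \<beta> - M * \<delta> x \<le> 0" if r: "E w r" "r \<noteq> v" for r
  proof -
    obtain \<kappa> where k: "\<kappa> > 0" "\<And>s t x. edge_coords w r s t x \<Longrightarrow> \<kappa> * t \<le> \<delta> x"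
      using edge_dist_lower_bound[OF adj_sym[OF vw] r g(2) f(2)] unfolding \<delta>_def edge_dist_sym[of v] by metis
    define C where "C = real (den r) * (m \<bullet> r + \<beta>)"
    have "m \<bullet> x + \<beta> - (\<bar>C\<bar> / \<kappa>) * \<delta> x \<le> 0" if c: "edge_coords w r s t x" for s t x
    proof -
      have "m \<bullet> x + \<beta> = t * C" using affine_on_edge[OF c, of m \<beta>] f(2) by (simp add: C_def)
      moreover have "t * C \<le> t * \<bar>C\<bar>" using c unfolding edge_coords_def by (intro mult_left_mono) auto
      moreover have "(\<bar>C\<bar> / \<kappa>) * (\<kappa> * t) \<le> (\<bar>C\<bar> / \<kappa>) * \<delta> x" using k(1) k(2)[OF c] by (intro mult_left_mono) auto
      moreover have "(\<bar>C\<bar> / \<kappa>) * (\<kappa> * t) = t * \<bar>C\<bar>" using k(1) by simp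
      ultimately show ?thesis by linarith
    qed
    then show ?thesis by blast
  qed
  have vq: "p \<noteq> q" using pq(1) adj_irrefl by blast
  consider "v = p" | "v = q" | "w = p" "v \<noteq> q" | "w = q" "v \<noteq> p" | "closed_segment v w \<inter> closed_segment p q = {}"
  proof -
    have "v \<in> closed_segment p q \<Longrightarrow> v = p \<or> v = q" "w \<in> closed_segment p q \<Longrightarrow> w = p \<or> w = q"
      using vertex_in_edge[OF pq(1)] adj_vertex vw adj_sym by blast+
    then show thesis using that Int by blast
  qed
  then show ?thesis
  proof cases
    case 1
    then have "E v q" "q \<noteq> w" using pq by auto
    then obtain M where M: "\<And>s t x. edge_coords v q s t x \<Longrightarrow> m \<bullet> x + \<beta> - M * \<delta> x \<le> s" using shared_v by metis
    show ?thesis using M unfolding hat_value_def 1[symmetric] by auto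
  next
    case 2
    then have "E v p" "p \<noteq> w" using pq adj_sym by auto
    then obtain M where M: "\<And>s t x. edge_coords v p s t x \<Longrightarrow> m \<bullet> x + \<beta> - M * \<delta> x \<le> s" using shared_v by metis
    have "m \<bullet> x + \<beta> - M * \<delta> x \<le> hat_value v p q s t" if "edge_coords p q s t x" for s t x
      using M[of t s x] edge_coords_sym[OF that] vq unfolding hat_value_def 2[symmetric] by simp
    then show ?thesis by blast
  next
    case 3
    then have "E w q" "q \<noteq> v" using pq by auto
    then obtain M where M: "\<And>s t x. edge_coords w q s t x \<Longrightarrow> m \<bullet> x + \<beta> - M * \<delta> x \<le> 0" using shared_w by metis
    have "m \<bullet> x + \<beta> - M * \<delta> x \<le> hat_value v p q s t" if c: "edge_coords p q s t x" for s t x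
      using M[of s t x] c hat0[OF c] 3(1) by simp
    then show ?thesis by blast
  next
    case 4
    then have "E w p" "p \<noteq> v" using pq adj_sym by auto
    then obtain M where M: "\<And>s t x. edge_coords w p s t x \<Longrightarrow> m \<bullet> x + \<beta> - M * \<delta> x \<le> 0" using shared_w by metis
    have "m \<bullet> x + \<beta> - M * \<delta> x \<le> hat_value v p q s t" if c: "edge_coords p q s t x" for s t x
      using M[of t s x] edge_coords_sym[OF c] hat0[OF c] 4(1) by simp
    then show ?thesis by blast
  next
    case 5
    have rat: "rational_point v" "rational_point w" using rational_vertex adj_vertex vw adj_sym by blast+
    have "ipl \<delta>" unfolding \<delta>_def by (intro ipl_edge_dist ipl_affine f g rat)
    then have cont: "continuous_on (closed_segment p q) \<delta>"
      using continuous_on_subset[OF ipl_continuous edge_in_cube[OF pq(1)]] by blast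
    obtain y where y: "y \<in> closed_segment p q" "\<And>x. x \<in> closed_segment p q \<Longrightarrow> \<delta> y \<le> \<delta> x"
      using continuous_attains_inf[OF compact_segment(1) _ cont] by auto
    have "\<delta> y \<noteq> 0"
    proof
      assume "\<delta> y = 0"
      then have "y \<in> closed_segment v w" unfolding \<delta>_def using edge_dist_eq_0D edge_coords_in_segment by blast
      then show False using 5 y(1) by blast
    qed
    then have dy: "\<delta> y > 0" using edge_dist_nonneg[of v w _ _ y] unfolding \<delta>_def by (simp add: less_le)
    have "\<exists>z\<in>closed_segment p q. \<forall>x\<in>closed_segment p q. m \<bullet> x \<le> m \<bullet> z"
      by (rule continuous_attains_sup) (auto intro!: continuous_intros)
    then obtain z where z: "z \<in> closed_segment p q" "\<And>x. x \<in> closed_segment p q \<Longrightarrow> m \<bullet> x \<le> m \<bullet> z" by blast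
    define M where "M = \<bar>m \<bullet> z + \<beta>\<bar> / \<delta> y"
    have "m \<bullet> x + \<beta> - M * \<delta> x \<le> hat_value v p q s t" if c: "edge_coords p q s t x" for s t x
    proof -
      have x: "x \<in> closed_segment p q" using edge_coords_in_segment[OF c] .
      have "M * \<delta> y \<le> M * \<delta> x" using y(2)[OF x] dy unfolding M_def by (intro mult_left_mono) auto
      moreover have "M * \<delta> y = \<bar>m \<bullet> z + \<beta>\<bar>" unfolding M_def using dy by simp
      ultimately show ?thesis using z(2)[OF x] hat0[OF c] by linarith
    qed
    then show ?thesis by blast
  qed
qed

text \<open>On the other edges an upper bound is enough: the maximum over all edges at
  \<open>v\<close> then takes the right value on each of them.\<close>

definition is_edge_hat :: "real ^ 'n \<Rightarrow> real ^ 'n \<Rightarrow> (real ^ 'n \<Rightarrow> real) \<Rightarrow> bool" where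
  "is_edge_hat v w h \<longleftrightarrow> ipl h \<and> (\<forall>x. 0 \<le> h x) \<and> (\<forall>s t x. edge_coords v w s t x \<longrightarrow> h x = s) \<and>
    (\<forall>p q s t x. E p q \<longrightarrow> {p, q} \<noteq> {v, w} \<longrightarrow> edge_coords p q s t x \<longrightarrow> h x \<le> hat_value v p q s t)"

lemma is_edge_hatD:
  assumes "is_edge_hat v w h"
  shows "ipl h" "0 \<le> h x" "edge_coords v w s t x \<Longrightarrow> h x = s"
    "E p q \<Longrightarrow> {p, q} \<noteq> {v, w} \<Longrightarrow> edge_coords p q s t x \<Longrightarrow> h x \<le> hat_value v p q s t"
  using assms unfolding is_edge_hat_def by simp_all

lemma ex_edge_hat:
  assumes vw: "E v w"
  shows "\<exists>h. is_edge_hat v w h"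
proof -
  obtain m \<beta> where f: "int_vec m" "\<beta> \<in> \<int>" "real (den v) * (m \<bullet> v + \<beta>) = 1" "real (den w) * (m \<bullet> w + \<beta>) = 0"
    using edge_functional[OF vw] .
  obtain n \<gamma> where g: "int_vec n" "\<gamma> \<in> \<int>" "real (den w) * (n \<bullet> w + \<gamma>) = 1" "real (den v) * (n \<bullet> v + \<gamma>) = 0"
    using edge_functional[OF adj_sym[OF vw]] .
  define \<delta> where "\<delta> = edge_dist v w (\<lambda>x. m \<bullet> x + \<beta>) (\<lambda>x. n \<bullet> x + \<gamma>)"
  have d0: "0 \<le> \<delta> x" for x unfolding \<delta>_def by (rule edge_dist_nonneg)
  have "\<exists>M. E p q \<longrightarrow> {p, q} \<noteq> {v, w} \<longrightarrow> (\<forall>s t x. edge_coords p q s t x \<longrightarrow> m \<bullet> x + \<beta> - M * \<delta> x \<le> hat_value v p q s t)" for p q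
    using edge_hat_bound[OF vw _ _ f(3,4,1,2) g(4,3,1,2), of p q] unfolding \<delta>_def by blast
  then obtain F where F: "\<And>p q s t x. E p q \<Longrightarrow> {p, q} \<noteq> {v, w} \<Longrightarrow> edge_coords p q s t x \<Longrightarrow>
      m \<bullet> x + \<beta> - F p q * \<delta> x \<le> hat_value v p q s t" by metis
  \<comment> \<open>One integer dominating the finitely many bounds: integrality keeps the pieces of
    \<open>h\<close> integral, and enlarging a bound is harmless because \<open>\<delta>\<close> is
    nonnegative.\<close>
  define M where "M = nat \<lceil>\<Sum>(p, q)\<in>V \<times> V. \<bar>F p q\<bar>\<rceil>"
  have FM: "F p q \<le> real M" if "E p q" for p q
  proof -
    have "(p, q) \<in> V \<times> V" using adj_vertex adj_sym that by blast
    then have "\<bar>F p q\<bar> \<le> (\<Sum>(p, q)\<in>V \<times> V. \<bar>F p q\<bar>)"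
      using member_le_sum[of "(p, q)" "V \<times> V" "\<lambda>(p, q). \<bar>F p q\<bar>"] finite_vertices by auto
    then show ?thesis unfolding M_def by linarith
  qed
  define h where "h x = max 0 (m \<bullet> x + \<beta> - real M * \<delta> x)" for x
  have rat: "rational_point v" "rational_point w" using rational_vertex adj_vertex vw adj_sym by blast+
  have "ipl \<delta>" unfolding \<delta>_def by (intro ipl_edge_dist ipl_affine f g rat)
  then have "ipl h" unfolding h_def by (intro ipl_max ipl_diff ipl_scale ipl_affine ipl_const f) simp_all
  moreover have "0 \<le> h x" for x by (simp add: h_def)
  moreover have "h x = s" if c: "edge_coords v w s t x" for s t x
  proof -
    have "m \<bullet> x + \<beta> = s" "n \<bullet> x + \<gamma> = t" using affine_on_edge[OF c, of m \<beta>] affine_on_edge[OF c, of n \<gamma>] f g by simp_all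
    moreover from this have "\<delta> x = 0" unfolding \<delta>_def by (intro edge_dist_eq_0[OF c]) simp_all
    ultimately show ?thesis using c unfolding h_def edge_coords_def by simp
  qed
  moreover have "h x \<le> hat_value v p q s t"
    if c: "E p q" "{p, q} \<noteq> {v, w}" "edge_coords p q s t x" for p q s t x
  proof -
    have "F p q * \<delta> x \<le> real M * \<delta> x" using FM[OF c(1)] d0 by (intro mult_right_mono) auto
    then have "m \<bullet> x + \<beta> - real M * \<delta> x \<le> hat_value v p q s t" using F[OF c] by linarith
    moreover have "0 \<le> hat_value v p q s t" using c(3) unfolding hat_value_def edge_coords_def by simp
    ultimately show ?thesis unfolding h_def by simp
  qed
  ultimately have "is_edge_hat v w h" unfolding is_edge_hat_def by (intro conjI allI impI)
  then show ?thesis by blast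
qed

lemma vertex_hat:
  assumes v: "v \<in> V"
  obtains h where "ipl h" "\<And>x. 0 \<le> h x"
    "\<And>p q s t x. E p q \<Longrightarrow> edge_coords p q s t x \<Longrightarrow> h x = hat_value v p q s t"
proof -
  define N where "N = {w. E v w}"
  have "N \<subseteq> V" unfolding N_def using adj_vertex adj_sym by blast
  then have finN: "finite N" using finite_vertices finite_subset by blast
  have neN: "N \<noteq> {}" using neighbour[OF v] unfolding N_def by blast
  have "\<exists>h. E v w \<longrightarrow> is_edge_hat v w h" for w using ex_edge_hat by blast
  then obtain H where good: "\<And>w. E v w \<Longrightarrow> is_edge_hat v w (H w)" by metis
  note H = is_edge_hatD[OF good]
  define h where "h x = Max ((\<lambda>w. H w x) ` N)" for x
  have "ipl h" unfolding h_def by (rule ipl_Max[OF finN neN]) (use H(1) in \<open>simp add: N_def\<close>)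
  moreover have h0: "0 \<le> h x" for x
  proof -
    obtain w where "w \<in> N" using neN by blast
    then have "0 \<le> H w x" "H w x \<le> h x" using H(2) finN unfolding N_def h_def by auto
    then show ?thesis by simp
  qed
  moreover have "h x = hat_value v p q s t" if c: "E p q" "edge_coords p q s t x" for p q s t x
  proof -
    have vq: "p \<noteq> q" using c(1) adj_irrefl by blast
    have eq: "H w x = hat_value v p q s t" if w: "E v w" "{p, q} = {v, w}" for w
      using w(2) H(3)[OF w(1)] c(2) edge_coords_sym[OF c(2)] vq unfolding hat_value_def doubleton_eq_iff by auto
    have "H w x \<le> hat_value v p q s t" if "w \<in> N" for w
      using H(4)[OF _ c(1) _ c(2), of w] eq[of w] that unfolding N_def by fastforce
    then have le: "h x \<le> hat_value v p q s t" unfolding h_def using finN neN by (intro Max.boundedI) auto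
    show ?thesis
    proof (cases "v \<in> {p, q}")
      case True
      then obtain w where w: "E v w" "{p, q} = {v, w}" using c(1) adj_sym by auto
      then have "H w x \<le> h x" unfolding h_def N_def[symmetric] using finN by (intro Max_ge) (auto simp: N_def)
      then show ?thesis using eq[OF w] le by simp
    next
      case False
      then have "hat_value v p q s t = 0" by (simp add: hat_value_def)
      then show ?thesis using le h0[of x] by simp
    qed
  qed
  ultimately show ?thesis using that by blast
qed

end

section \<open>Collapsing the simplex of weights onto a tree\<close>

text \<open>One collapse step on the simplex of weights \<open>y\<close> with \<open>\<Sum>d i * y i = 1\<close>. The weight at \<open>k\<close> is
  cancelled against the weights at all \<open>j < k\<close> other than the parent \<open>p\<close>: the weight \<open>A\<close> at \<open>k\<close> together
  with total height 1 of the others is traded for the weight \<open>b\<close> at \<open>p\<close>, which preserves the height as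
  \<open>A * d k + 1 = b * d p\<close>. The vertex 0, of denominator 1, absorbs what is left over.\<close>
locale collapse =
  fixes N k p :: nat and d :: "nat \<Rightarrow> real" and A b :: real
  assumes d_ge_1: "i < N \<Longrightarrow> 1 \<le> d i" and d_0: "d 0 = 1" and kN: "0 < k" "k < N" and pk: "p < k"
    and A2: "2 \<le> A" and b0: "0 \<le> b" and bal: "A * d k + 1 = b * d p"
begin

definition J :: "nat set" where "J = {..<k} - {p}"

definition R :: "(nat \<Rightarrow> real) \<Rightarrow> real" where "R y = (\<Sum>j\<in>J. d j * y j)"

text \<open>The amount traded, a ramp in \<open>y k\<close>: 0 up to \<open>(A - 1) * R y\<close>,
  then of slope 1, and constantly \<open>R y\<close> from \<open>A * R y\<close> on.\<close>

definition G :: "(nat \<Rightarrow> real) \<Rightarrow> real" where "G y = max 0 (min (R y) (y k - (A - 1) * R y))"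

text \<open>From the threshold \<open>A * R y\<close> on, the weights on \<open>J\<close> are gone;
  below it the weight at \<open>k\<close> is gone. Subtracting the whole of \<open>y k\<close> on
  \<open>J\<close> can lose height, which \<open>rest\<close> recovers.\<close>

definition reduced :: "(nat \<Rightarrow> real) \<Rightarrow> nat \<Rightarrow> real" where
  "reduced y i = (if i = k then max 0 (y k - A * R y) else if i = p then y p + b * G y
     else if i < k then max 0 (y i - y k) else y i)"

definition rest :: "(nat \<Rightarrow> real) \<Rightarrow> real" where
  "rest y = 1 - (\<Sum>i<N. d i * reduced y i)"

definition step :: "(nat \<Rightarrow> real) \<Rightarrow> nat \<Rightarrow> real" where
  "step y i = (if i = 0 then reduced y i + rest y else reduced y i)"

lemma sum_split: "(\<Sum>i<N. f i) = f k + f p + (\<Sum>j\<in>J. f j) + (\<Sum>i\<in>{k<..<N}. f i)" for f :: "nat \<Rightarrow> real"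
proof -
  have "{..<N} = insert k (insert p (J \<union> {k<..<N}))" using kN pk by (auto simp: J_def)
  moreover have "k \<notin> insert p (J \<union> {k<..<N})" "p \<notin> J \<union> {k<..<N}" using pk by (auto simp: J_def)
  moreover have "J \<inter> {k<..<N} = {}" by (auto simp: J_def)
  moreover have "finite J" by (simp add: J_def)
  ultimately show ?thesis by (simp add: sum.union_disjoint)
qed

lemma sum_step: "(\<Sum>i<N. d i * step y i) = 1"
proof -
  have "(\<Sum>i<N. d i * step y i) = (\<Sum>i<N. d i * reduced y i + (if i = 0 then rest y else 0))"
    by (intro sum.cong refl) (simp add: step_def d_0)
  also have "\<dots> = (\<Sum>i<N. d i * reduced y i) + rest y" using kN by (simp add: sum.distrib)
  finally show ?thesis by (simp add: rest_def)
qed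

context
  fixes y :: "nat \<Rightarrow> real"
  assumes y0: "\<And>i. i < N \<Longrightarrow> 0 \<le> y i" and y1: "(\<Sum>i<N. d i * y i) = 1"
begin

lemma height_nonneg: "i < N \<Longrightarrow> 0 \<le> d i * y i"
  using d_ge_1[of i] y0[of i] by simp

lemma weight_le: assumes "j \<in> J" shows "y j \<le> R y"
proof -
  have j: "j < N" using assms kN by (simp add: J_def)
  have "y j \<le> d j * y j" using d_ge_1[OF j] y0[OF j] mult_right_mono[of 1 "d j" "y j"] by simp
  also have "\<dots> \<le> R y" unfolding R_def
    by (rule member_le_sum[OF assms]) (use height_nonneg kN in \<open>auto simp: J_def\<close>)
  finally show ?thesis .
qed

lemma R_nonneg: "0 \<le> R y"
  unfolding R_def by (intro sum_nonneg) (use height_nonneg kN in \<open>auto simp: J_def\<close>)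

lemma rest_eq: "rest y = d k * (y k - reduced y k) - d p * (b * G y) + (\<Sum>j\<in>J. d j * (y j - reduced y j))"
proof -
  have "rest y = (\<Sum>i<N. d i * (y i - reduced y i))"
    unfolding rest_def y1[symmetric] by (simp add: right_diff_distrib sum_subtractf)
  also have "\<dots> = d k * (y k - reduced y k) + d p * (y p - reduced y p) + (\<Sum>j\<in>J. d j * (y j - reduced y j))
      + (\<Sum>i\<in>{k<..<N}. d i * (y i - reduced y i))" by (rule sum_split)
  also have "(\<Sum>i\<in>{k<..<N}. d i * (y i - reduced y i)) = 0"
    using pk by (intro sum.neutral) (auto simp: reduced_def)
  also have "d p * (y p - reduced y p) = - (d p * (b * G y))" using pk by (simp add: reduced_def)
  finally show ?thesis by simp
qed

lemma reduced_J: "j \<in> J \<Longrightarrow> reduced y j = max 0 (y j - y k)"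
  by (simp add: reduced_def J_def)

text \<open>The trade is complete: \<open>k\<close> gives up the height
  \<open>A * d k * R y\<close>, \<open>J\<close> gives up \<open>R y\<close>, and \<open>p\<close>
  receives \<open>b * d p * R y\<close>, which by \<open>bal\<close> is their sum.\<close>

lemma large:
  assumes "A * R y \<le> y k"
  shows "rest y = 0" "\<And>j. j \<in> J \<Longrightarrow> reduced y j = 0"
proof -
  have "R y \<le> A * R y" using A2 R_nonneg mult_right_mono[of 1 A "R y"] by simp
  then show z: "reduced y j = 0" if "j \<in> J" for j
    using weight_le[OF that] assms reduced_J[OF that] by simp
  have g: "G y = R y" unfolding G_def using assms R_nonneg by (simp add: algebra_simps)
  have r: "reduced y k = y k - A * R y" using assms by (simp add: reduced_def)
  have s: "(\<Sum>j\<in>J. d j * (y j - reduced y j)) = R y" unfolding R_def using z by simp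
  have "rest y = (A * d k + 1 - b * d p) * R y" unfolding rest_eq g r s by (simp add: algebra_simps)
  then show "rest y = 0" using bal by simp
qed

lemma rest_nonneg: "0 \<le> rest y"
proof (cases "A * R y \<le> y k")
  case False
  have "k < N" "p < N" using kN pk by auto
  have rk: "reduced y k = 0" using False by (simp add: reduced_def)
  have G: "G y = max 0 (y k - (A - 1) * R y)" unfolding G_def using False R_nonneg by (simp add: algebra_simps)
  have dk: "0 \<le> d k * y k" using d_ge_1[OF \<open>k < N\<close>] y0[OF \<open>k < N\<close>] by simp
  show ?thesis
  proof (cases "y k \<le> (A - 1) * R y")
    case True
    then have "G y = 0" using G by simp
    moreover have "0 \<le> (\<Sum>j\<in>J. d j * (y j - reduced y j))"
    proof (intro sum_nonneg mult_nonneg_nonneg)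
      fix j assume j: "j \<in> J"
      then have jN: "j < N" using kN by (simp add: J_def)
      show "0 \<le> d j" using d_ge_1[OF jN] by simp
      show "0 \<le> y j - reduced y j" using reduced_J[OF j] y0[OF jN] y0[OF \<open>k < N\<close>] by simp
    qed
    ultimately show ?thesis unfolding rest_eq rk using dk by simp
  next
    case gt: False
    \<comment> \<open>The reason for \<open>A2\<close>: as soon as \<open>p\<close> gains anything,
      \<open>y k\<close> exceeds \<open>R y\<close> and the weights on \<open>J\<close> have already
      vanished. The remainder then factors with sign given by \<open>A * R y - y k\<close>.\<close>
    have "R y \<le> (A - 1) * R y" using A2 R_nonneg mult_right_mono[of 1 "A - 1" "R y"] by simp
    then have "reduced y j = 0" if "j \<in> J" for j using weight_le[OF that] gt reduced_J[OF that] by simp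
    then have "(\<Sum>j\<in>J. d j * (y j - reduced y j)) = R y" unfolding R_def by simp
    moreover have "G y = y k - (A - 1) * R y" using G gt by simp
    ultimately have "rest y = d k * y k - b * d p * (y k - (A - 1) * R y) + R y" unfolding rest_eq rk by simp
    also have "\<dots> = ((A - 1) * d k + 1) * (A * R y - y k)" unfolding bal[symmetric] by (simp add: algebra_simps)
    also have "0 \<le> \<dots>" using A2 d_ge_1[OF \<open>k < N\<close>] False by (intro mult_nonneg_nonneg add_nonneg_nonneg) auto
    finally show ?thesis .
  qed
qed (simp add: large)

lemma reduced_nonneg: assumes i: "i < N" shows "0 \<le> reduced y i"
proof -
  have "p < N" using kN pk by simp
  have "0 \<le> b * G y" using b0 unfolding G_def by simp
  then show ?thesis using y0[OF i] y0[OF \<open>p < N\<close>] by (auto simp: reduced_def)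
qed

lemma step_nonneg: "i < N \<Longrightarrow> 0 \<le> step y i"
  using reduced_nonneg[of i] rest_nonneg by (cases "i = 0") (simp_all add: step_def)

text \<open>The vertex 0 may belong to \<open>J\<close>, but when the weight at \<open>k\<close>
  survives the remainder is 0, so depositing it there revives nothing.\<close>

lemma step_disjoint: "step y k = 0 \<or> (\<forall>j\<in>J. step y j = 0)"
proof (cases "A * R y \<le> y k")
  case True
  have "step y j = 0" if "j \<in> J" for j
    using large(1)[OF True] large(2)[OF True that] by (cases "j = 0") (simp_all add: step_def)
  then show ?thesis by blast
next
  case False
  then show ?thesis using kN by (simp add: step_def reduced_def)
qed

text \<open>This is what keeps the final map the identity on the tree, where \<open>k\<close> never
  shares a point with an index of \<open>J\<close>.\<close>

lemma step_id:
  assumes "y k = 0 \<or> R y = 0" "i < N" shows "step y i = y i"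
proof -
  have R0: "R y = 0 \<Longrightarrow> j \<in> J \<Longrightarrow> y j = 0" for j
    using weight_le[of j] y0[of j] kN by (fastforce simp: J_def)
  have red: "reduced y i = y i" if i: "i < N" for i
  proof (cases "y k = 0")
    case True
    have "0 \<le> (A - 1) * R y" using A2 R_nonneg by simp
    then have "min (R y) (y k - (A - 1) * R y) \<le> 0" using True min.cobounded2[of "R y" "y k - (A - 1) * R y"] by linarith
    then have "G y = 0" unfolding G_def by simp
    moreover have "max 0 (y k - A * R y) = 0" using True A2 R_nonneg by simp
    ultimately show ?thesis using True y0[OF i] by (simp add: reduced_def)
  next
    case False
    then have R: "R y = 0" using assms by blast
    have k0: "0 \<le> y k" using y0 kN by simp
    have "G y = 0" unfolding G_def R using k0 by simp
    moreover have "i < k \<Longrightarrow> i \<noteq> p \<Longrightarrow> y i = 0" using R0[OF R, of i] by (simp add: J_def)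
    ultimately show ?thesis using R k0 by (simp add: reduced_def)
  qed
  then have "rest y = 0" unfolding rest_def using y1 by simp
  then show ?thesis using red[OF assms(2)] by (cases "i = 0") (simp_all add: step_def)
qed

lemma step_id_cases: "(\<exists>j\<in>J. y k \<noteq> 0 \<and> y j \<noteq> 0) \<or> (\<forall>i<N. step y i = y i)"
proof -
  have "R y = 0" if "\<forall>j\<in>J. y j = 0" using that unfolding R_def by simp
  then show ?thesis using step_id by blast
qed

lemma step_above: "k < i \<Longrightarrow> step y i = y i"
  using pk by (simp add: step_def reduced_def)

end

lemma ipl_step:
  fixes c :: "nat \<Rightarrow> real ^ 'n \<Rightarrow> real"
  assumes c: "\<And>i. i < N \<Longrightarrow> ipl (c i)" and d: "\<And>i. i < N \<Longrightarrow> d i \<in> \<int>" and Ab: "A \<in> \<int>" "b \<in> \<int>" and i: "i < N"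
  shows "ipl (\<lambda>x. step (\<lambda>j. c j x) i)"
proof -
  have R: "ipl (\<lambda>x. R (\<lambda>j. c j x))" unfolding R_def
    using kN by (intro ipl_sum ipl_scale c d) (auto simp: J_def)
  have A1: "A - 1 \<in> \<int>" using Ab by simp
  have "k < N" "p < N" using kN pk by auto
  have G: "ipl (\<lambda>x. G (\<lambda>j. c j x))" unfolding G_def
    by (intro ipl_max ipl_min ipl_diff ipl_scale ipl_const R c A1 \<open>k < N\<close>) simp
  have red: "ipl (\<lambda>x. reduced (\<lambda>j. c j x) i)" if "i < N" for i
  proof -
    consider "i = k" | "i \<noteq> k" "i = p" | "i \<noteq> k" "i \<noteq> p" "i < k" | "i \<noteq> k" "i \<noteq> p" "\<not> i < k" by blast
    then show ?thesis
    proof cases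
      case 1
      then show ?thesis unfolding reduced_def by (simp, intro ipl_max ipl_diff ipl_scale ipl_const R c Ab \<open>k < N\<close>) simp
    next
      case 2
      then show ?thesis unfolding reduced_def by (simp, intro ipl_add ipl_scale G c Ab \<open>p < N\<close>)
    next
      case 3
      then show ?thesis unfolding reduced_def by (simp, intro ipl_max ipl_diff ipl_const c \<open>k < N\<close> that) simp
    next
      case 4
      then show ?thesis unfolding reduced_def using c[OF that] by simp
    qed
  qed
  have rest: "ipl (\<lambda>x. rest (\<lambda>j. c j x))" unfolding rest_def
    by (intro ipl_diff ipl_sum ipl_scale ipl_const red d) auto
  show ?thesis unfolding step_def using ipl_add[OF red rest, OF i] red[OF i] by (cases "i = 0") simp_all
qed

end

lemma collapse_coefficients:
  fixes m n :: nat
  assumes "coprime m n" "0 < m" "0 < n"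
  obtains A b :: int where "2 \<le> A" "0 \<le> b" "A * int m + 1 = b * int n"
proof -
  obtain u v :: int where uv: "u * int m + v * int n = 1"
    using bezout_int[of "int m" "int n"] assms(1) by (metis coprime_imp_gcd_eq_1 coprime_int_iff)
  \<comment> \<open>Bezout coefficients may be shifted by multiples of \<open>(n, m)\<close>; this
    multiple is large enough for \<open>A\<close> to be at least 2 whatever the sign of
    \<open>u\<close>.\<close>
  define t where "t = \<bar>u\<bar> + 2"
  define A where "A = - u + t * int n"
  define b where "b = v + t * int m"
  have "t * 1 \<le> t * int n" using assms(3) by (intro mult_left_mono) (auto simp: t_def)
  then have A2: "2 \<le> A" using t_def unfolding A_def by linarith
  have eq: "A * int m + 1 = b * int n" unfolding A_def b_def using uv by (simp add: algebra_simps)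
  have "0 \<le> b"
  proof (rule ccontr)
    assume "\<not> 0 \<le> b"
    then have "b * int n \<le> 0" by (simp add: mult_nonpos_nonneg)
    moreover have "0 \<le> A * int m" using A2 by simp
    ultimately show False using eq by linarith
  qed
  then show ?thesis using that A2 eq by blast
qed

section \<open>Weights on a regular tree and the resulting retraction\<close>

locale regular_tree = regular_graph \<K> for \<K> :: "(real ^ 'n) set set" +
  fixes ws :: "(real ^ 'n) list"
  assumes coprime_dens: "E a b \<Longrightarrow> coprime (den a) (den b)"
    and order: "tree_order E ws" and set_ws: "set ws = V" and den_root: "den (ws ! 0) = 1"
begin

abbreviation "N \<equiv> length ws"
abbreviation "dn i \<equiv> real (den (ws ! i))"
abbreviation "P \<equiv> \<Union>\<K>"

lemma N_pos: "0 < N" and distinct_ws: "distinct ws"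
  using order unfolding tree_order_def by auto

lemma ws_vertex: "i < N \<Longrightarrow> ws ! i \<in> V"
  using set_ws nth_mem by blast

lemma dn_ge_1: "i < N \<Longrightarrow> 1 \<le> dn i"
  using den_properties(1)[OF rational_vertex[OF ws_vertex]] by (simp add: Suc_le_eq)

lemma sum_ws: "(\<Sum>i<N. f (ws ! i)) = (\<Sum>v\<in>V. f v)" for f :: "real ^ 'n \<Rightarrow> 'b::comm_monoid_add"
  using sum.reindex_bij_betw[OF bij_betw_nth[OF distinct_ws refl refl], of f] set_ws by simp

lemma sum_hat_value:
  assumes "E p q"
  shows "(\<Sum>v\<in>V. (hat_value v p q s t * real (den v)) *\<^sub>R f v)
    = (s * real (den p)) *\<^sub>R f p + (t * real (den q)) *\<^sub>R (f q :: 'b::real_vector)"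
proof -
  have pq: "p \<in> V" "q \<in> V" "p \<noteq> q" using adj_vertex adj_sym assms adj_irrefl by blast+
  have "(\<Sum>v\<in>V. (hat_value v p q s t * real (den v)) *\<^sub>R f v)
      = (\<Sum>v\<in>V. (if v = p then (s * real (den v)) *\<^sub>R f v else 0) + (if v = q then (t * real (den v)) *\<^sub>R f v else 0))"
    using pq(3) by (intro sum.cong refl) (simp add: hat_value_def)
  then show ?thesis using pq finite_vertices by (simp add: sum.distrib)
qed

lemma sum_hat_value_real:
  assumes "E p q"
  shows "(\<Sum>i<N. dn i * hat_value (ws ! i) p q s t) = s * real (den p) + t * real (den q)"
  using sum_hat_value[OF assms, of s t "\<lambda>_. 1::real"] sum_ws[of "\<lambda>v. real (den v) * hat_value v p q s t"]
  by (simp add: mult.commute)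

text \<open>The weights \<open>c\<close> are barycentric coordinates with respect to the homogenized vertices.\<close>
definition collapsed :: "nat \<Rightarrow> (nat \<Rightarrow> real ^ 'n \<Rightarrow> real) \<Rightarrow> bool" where
  "collapsed m c \<longleftrightarrow> (\<forall>i<N. ipl (c i)) \<and> (\<forall>i<N. \<forall>x\<in>unit_cube. 0 \<le> c i x) \<and>
     (\<forall>x\<in>unit_cube. (\<Sum>i<N. dn i * c i x) = 1) \<and>
     (\<forall>i<N. \<forall>p q s t x. E p q \<longrightarrow> edge_coords p q s t x \<longrightarrow> c i x = hat_value (ws ! i) p q s t) \<and>
     (\<forall>k<N. \<forall>j<k. m \<le> k \<longrightarrow> \<not> E (ws ! k) (ws ! j) \<longrightarrow> (\<forall>x\<in>unit_cube. c k x = 0 \<or> c j x = 0))"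

lemma collapsedD:
  assumes "collapsed m c"
  shows "i < N \<Longrightarrow> ipl (c i)" "i < N \<Longrightarrow> x \<in> unit_cube \<Longrightarrow> 0 \<le> c i x"
    "x \<in> unit_cube \<Longrightarrow> (\<Sum>i<N. dn i * c i x) = 1"
    "i < N \<Longrightarrow> E p q \<Longrightarrow> edge_coords p q s t x \<Longrightarrow> c i x = hat_value (ws ! i) p q s t"
    "k < N \<Longrightarrow> j < k \<Longrightarrow> m \<le> k \<Longrightarrow> \<not> E (ws ! k) (ws ! j) \<Longrightarrow> x \<in> unit_cube \<Longrightarrow> c k x = 0 \<or> c j x = 0"
  using assms unfolding collapsed_def by simp_all

lemma edge_coords_in_cube: "E p q \<Longrightarrow> edge_coords p q s t x \<Longrightarrow> x \<in> unit_cube"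
  using edge_coords_in_segment edge_in_cube by blast

text \<open>Off the tree the hats may add up to more than 1. Lowering each by the excess
  \<open>S x - 1\<close> and truncating at 0 repairs this: denominators are at least 1, so one
  surviving index already removes the whole excess. The root, of denominator 1, takes the remainder
  with integral coefficients. On the tree the hats sum to 1 and nothing changes.\<close>

lemma collapsed_initial: "\<exists>c. collapsed N c"
proof -
  have "\<exists>h. ipl h \<and> (\<forall>x. 0 \<le> h x) \<and> (\<forall>p q s t x. E p q \<longrightarrow> edge_coords p q s t x \<longrightarrow> h x = hat_value (ws ! i) p q s t)"
    if i: "i < N" for i
    by (rule vertex_hat[OF ws_vertex[OF i]]) (intro exI conjI allI impI, assumption+)
  then obtain h where h: "\<And>i. i < N \<Longrightarrow> ipl (h i)" "\<And>i x. i < N \<Longrightarrow> 0 \<le> h i x"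
    "\<And>i p q s t x. i < N \<Longrightarrow> E p q \<Longrightarrow> edge_coords p q s t x \<Longrightarrow> h i x = hat_value (ws ! i) p q s t"
    by metis
  define S where "S x = (\<Sum>i=1..<N. dn i * h i x)" for x
  define g where "g i x = max 0 (h i x - max 0 (S x - 1))" for i x
  define c where "c i x = (if i = 0 then 1 - (\<Sum>i=1..<N. dn i * g i x) else g i x)" for i x
  have split: "(\<Sum>i<N. f i) = f 0 + (\<Sum>i=1..<N. f i)" for f :: "nat \<Rightarrow> real"
    using N_pos by (simp add: lessThan_atLeast0 sum.atLeast_Suc_lessThan)
  have iplS: "ipl S" unfolding S_def by (intro ipl_sum ipl_scale h) auto
  have iplg: "ipl (g i)" if "i < N" for i unfolding g_def
    by (intro ipl_max ipl_diff ipl_const iplS h that) simp_all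
  have "ipl (c i)" if "i < N" for i
  proof (cases "i = 0")
    case True
    have "ipl (\<lambda>x. 1 - (\<Sum>i=1..<N. dn i * g i x))" by (intro ipl_diff ipl_sum ipl_scale ipl_const iplg) auto
    then show ?thesis using True unfolding c_def by simp
  next
    case False
    then show ?thesis using iplg[OF that] unfolding c_def by simp
  qed
  moreover have sum_g: "(\<Sum>i=1..<N. dn i * g i x) \<le> 1" for x
  proof (cases "S x \<le> 1")
    case True
    then have "g i x = h i x" if "i < N" for i unfolding g_def using h(2)[OF that] by simp
    then have "(\<Sum>i=1..<N. dn i * g i x) = S x" unfolding S_def by simp
    then show ?thesis using True by simp
  next
    case False
    define I where "I = {i \<in> {1..<N}. g i x \<noteq> 0}"
    have gI: "g i x = h i x - (S x - 1)" if "i \<in> I" for i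
      using that False unfolding I_def g_def by (auto simp: max_def split: if_splits)
    have sI: "(\<Sum>i=1..<N. dn i * g i x) = (\<Sum>i\<in>I. dn i * g i x)"
      by (rule sum.mono_neutral_right) (auto simp: I_def)
    show ?thesis
    proof (cases "I = {}")
      case True
      then show ?thesis using sI by simp
    next
      case nonempty: False
      have "(\<Sum>i\<in>I. dn i * g i x) = (\<Sum>i\<in>I. dn i * h i x) - (\<Sum>i\<in>I. dn i * (S x - 1))"
        using gI by (simp add: right_diff_distrib sum_subtractf)
      moreover have "(\<Sum>i\<in>I. dn i * h i x) \<le> S x" unfolding S_def
        using h(2) by (intro sum_mono2) (auto simp: I_def)
      moreover have "S x - 1 \<le> (\<Sum>i\<in>I. dn i * (S x - 1))"
      proof -
        obtain i where i: "i \<in> I" using nonempty by blast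
        then have "1 * (S x - 1) \<le> dn i * (S x - 1)" using dn_ge_1[of i] False by (intro mult_right_mono) (auto simp: I_def)
        also have "\<dots> \<le> (\<Sum>i\<in>I. dn i * (S x - 1))" using False
          by (intro member_le_sum[OF i]) (auto simp: I_def)
        finally show ?thesis by simp
      qed
      ultimately show ?thesis using sI by linarith
    qed
  qed
  then have "0 \<le> c i x" for i x unfolding c_def g_def[abs_def] by (simp add: g_def)
  moreover have "(\<Sum>i<N. dn i * c i x) = 1" for x unfolding split using den_root by (simp add: c_def)
  moreover have "c i x = hat_value (ws ! i) p q s t" if i: "i < N" and e: "E p q" "edge_coords p q s t x" for i p q s t x
  proof -
    have "(\<Sum>i<N. dn i * h i x) = (\<Sum>i<N. dn i * hat_value (ws ! i) p q s t)" using h(3)[OF _ e] by simp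
    then have "(\<Sum>i<N. dn i * h i x) = 1" using sum_hat_value_real[OF e(1)] e(2) unfolding edge_coords_def by simp
    then have hS: "h 0 x + S x = 1" unfolding split S_def using den_root by simp
    then have "S x \<le> 1" using h(2)[OF N_pos, of x] by simp
    then have gh: "g j x = h j x" if "j < N" for j unfolding g_def using h(2)[OF that] by simp
    then have "(\<Sum>i=1..<N. dn i * g i x) = S x" unfolding S_def by simp
    then have "c i x = h i x" unfolding c_def using gh[OF i] hS by simp
    then show ?thesis using h(3)[OF i e] by simp
  qed
  ultimately have "collapsed N c" unfolding collapsed_def by auto
  then show ?thesis by blast
qed

text \<open>The step acts only where \<open>k\<close> and an earlier non-parent both carry weight.
  This does not happen on the tree, since weighted vertices there are the ends of an edge. A later
  vertex carrying weight at such a point would be adjacent to both, against the uniqueness of its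
  parent; so its weight is 0 and the decouplings obtained before survive.\<close>

lemma collapsed_step:
  assumes c: "collapsed (Suc k) c" and k: "0 < k" "k < N"
  shows "\<exists>c'. collapsed k c'"
proof -
  obtain p where p: "p < k" "E (ws ! k) (ws ! p)" "\<And>j. j < k \<Longrightarrow> E (ws ! k) (ws ! j) \<Longrightarrow> j = p"
    using order k unfolding tree_order_def by blast
  obtain A b :: int where Ab: "2 \<le> A" "0 \<le> b" "A * int (den (ws ! k)) + 1 = b * int (den (ws ! p))"
    using collapse_coefficients[OF coprime_dens[OF p(2)]] den_properties(1)[OF rational_vertex[OF ws_vertex]] k p(1)
    by (metis less_trans)
  interpret C: collapse N k p "\<lambda>i. dn i" "of_int A" "of_int b"
  proof
    show "of_int A * dn k + 1 = of_int b * dn p"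
      using arg_cong[OF Ab(3), of real_of_int] by simp
  qed (use dn_ge_1 den_root k p(1) Ab in auto)
  define c' where "c' i x = C.step (\<lambda>j. c j x) i" for i x
  have nn: "0 \<le> c i x" if "i < N" "x \<in> unit_cube" for i x using collapsedD(2)[OF c that] .
  have s1: "(\<Sum>i<N. dn i * c i x) = 1" if "x \<in> unit_cube" for x using collapsedD(3)[OF c that] .
  have trivial: "(\<exists>j\<in>C.J. c k x \<noteq> 0 \<and> c j x \<noteq> 0) \<or> (\<forall>i<N. c' i x = c i x)" if x: "x \<in> unit_cube" for x
    unfolding c'_def by (rule C.step_id_cases[OF nn[OF _ x] s1[OF x]])
  have "ipl (c' i)" if "i < N" for i
    using C.ipl_step[of c i] collapsedD(1)[OF c] that unfolding c'_def by simp
  moreover have "0 \<le> c' i x" if "i < N" "x \<in> unit_cube" for i x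
    unfolding c'_def by (rule C.step_nonneg[OF nn[OF _ that(2)] s1[OF that(2)] that(1)])
  moreover have "(\<Sum>i<N. dn i * c' i x) = 1" for x unfolding c'_def by (rule C.sum_step)
  moreover have "c' i x = hat_value (ws ! i) v w s t" if i: "i < N" and e: "E v w" "edge_coords v w s t x" for i v w s t x
  proof -
    have x: "x \<in> unit_cube" using edge_coords_in_cube[OF e] .
    have "\<not> (\<exists>j\<in>C.J. c k x \<noteq> 0 \<and> c j x \<noteq> 0)"
    proof
      assume "\<exists>j\<in>C.J. c k x \<noteq> 0 \<and> c j x \<noteq> 0"
      then obtain j where j: "j < k" "j \<noteq> p" "c k x \<noteq> 0" "c j x \<noteq> 0" unfolding C.J_def by blast
      then have "ws ! k \<in> {v, w}" "ws ! j \<in> {v, w}"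
        using collapsedD(4)[OF c _ e, of k] collapsedD(4)[OF c _ e, of j] k unfolding hat_value_def by (auto split: if_splits)
      moreover have "ws ! k \<noteq> ws ! j" using j(1) k distinct_ws by (simp add: nth_eq_iff_index_eq)
      ultimately have "E (ws ! k) (ws ! j)" using e(1) adj_sym by auto
      then show False using p(3) j by blast
    qed
    then have "c' i x = c i x" using trivial[OF x] i by blast
    then show ?thesis using collapsedD(4)[OF c i e] by simp
  qed
  moreover have "c' l x = 0 \<or> c' j x = 0"
    if l: "l < N" "j < l" "k \<le> l" "\<not> E (ws ! l) (ws ! j)" and x: "x \<in> unit_cube" for l j x
  proof (cases "l = k")
    case True
    then have "j \<in> C.J" using l p(2) unfolding C.J_def by auto
    then show ?thesis using C.step_disjoint[OF nn[OF _ x] s1[OF x]] True unfolding c'_def by blast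
  next
    case False
    then have lk: "Suc k \<le> l" using l by simp
    show ?thesis
    proof (cases "\<forall>i<N. c' i x = c i x")
      case True
      then show ?thesis using collapsedD(5)[OF c l(1,2) lk l(4) x] l by simp
    next
      case False
      then obtain j' where j': "j' < k" "c k x \<noteq> 0" "c j' x \<noteq> 0" using trivial[OF x] unfolding C.J_def by blast
      have "c l x = 0"
      proof (rule ccontr)
        assume cl: "c l x \<noteq> 0"
        have "E (ws ! l) (ws ! k)" "E (ws ! l) (ws ! j')"
          using collapsedD(5)[OF c l(1) _ lk _ x, of k] collapsedD(5)[OF c l(1) _ lk _ x, of j'] cl j' lk by auto
        moreover obtain q where "\<And>i. i < l \<Longrightarrow> E (ws ! l) (ws ! i) \<Longrightarrow> i = q"
          using order l(1) lk unfolding tree_order_def by (metis Suc_le_eq gr_implies_not0 neq0_conv)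
        ultimately have "k = q" "j' = q" using lk j'(1) by auto
        then show False using j'(1) by simp
      qed
      then show ?thesis using C.step_above[OF nn[OF _ x] s1[OF x]] lk unfolding c'_def by simp
    qed
  qed
  ultimately have "collapsed k c'" unfolding collapsed_def by blast
  then show ?thesis by blast
qed

lemma ex_collapsed: "\<exists>c. collapsed 1 c"
proof -
  have "\<exists>c. collapsed (N - m) c" if "m < N" for m
    using that
  proof (induction m)
    case 0
    then show ?case using collapsed_initial by simp
  next
    case (Suc m)
    then obtain c where "collapsed (Suc (N - Suc m)) c" by (metis Suc_diff_Suc Suc_lessD)
    then show ?case using collapsed_step Suc.prems by simp
  qed
  from this[of "N - 1"] show ?thesis using N_pos by simp
qed

lemma z_retract_cube: "z_retract P unit_cube"
proof -
  obtain c where c: "collapsed 1 c" using ex_collapsed by blast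
  define \<sigma> where "\<sigma> x = (\<Sum>i<N. (c i x * dn i) *\<^sub>R ws ! i)" for x
  have fixed: "\<sigma> x = x" if x: "x \<in> P" for x
  proof -
    have "x \<in> (\<Union>(a,b)\<in>{(a,b). E a b}. closed_segment a b)" using x Union_complex neighbour by blast
    then obtain p q where pq: "E p q" "x \<in> closed_segment p q" by blast
    obtain s t where st: "edge_coords p q s t x"
      using ex_edge_coords[OF _ _ pq(2)] rational_vertex adj_vertex adj_sym pq(1) by metis
    have "\<sigma> x = (\<Sum>i<N. (hat_value (ws ! i) p q s t * dn i) *\<^sub>R ws ! i)"
      unfolding \<sigma>_def using collapsedD(4)[OF c _ pq(1) st] by simp
    also have "\<dots> = (\<Sum>v\<in>V. (hat_value v p q s t * real (den v)) *\<^sub>R v)"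
      using sum_ws[of "\<lambda>v. (hat_value v p q s t * real (den v)) *\<^sub>R v"] .
    also have "\<dots> = x" unfolding sum_hat_value[OF pq(1)] using st unfolding edge_coords_def by simp
    finally show ?thesis .
  qed
  have into: "\<sigma> x \<in> P" if x: "x \<in> unit_cube" for x
  proof -
    have s1: "(\<Sum>i<N. dn i * c i x) = 1" using collapsedD(3)[OF c x] .
    have "\<exists>i<N. c i x \<noteq> 0"
    proof (rule ccontr)
      assume "\<not> (\<exists>i<N. c i x \<noteq> 0)"
      then show False using s1 by simp
    qed
    \<comment> \<open>The last vertex with weight. Everything before it except its parent is
      decoupled from it, so the image lies on the edge to the parent, or is the root.\<close>
    define k where "k = Max {i. i < N \<and> c i x \<noteq> 0}"
    have "k \<in> {i. i < N \<and> c i x \<noteq> 0}" unfolding k_def using \<open>\<exists>i<N. c i x \<noteq> 0\<close> by (intro Max_in) auto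
    then have k: "k < N" "c k x \<noteq> 0" by auto
    have above: "c i x = 0" if "k < i" "i < N" for i
    proof (rule ccontr)
      assume "c i x \<noteq> 0"
      then have "i \<le> k" unfolding k_def using that(2) by (intro Max_ge) auto
      then show False using that(1) by simp
    qed
    show ?thesis
    proof (cases "k = 0")
      case True
      have z: "c i x = 0" if "i \<in> {..<N} - {0}" for i using above[of i] that True by simp
      have "(\<Sum>i<N. dn i * c i x) = dn 0 * c 0 x" using z N_pos by (subst sum.remove[of _ 0]) auto
      then have "c 0 x = 1" using s1 den_root by simp
      moreover have "\<sigma> x = (c 0 x * dn 0) *\<^sub>R ws ! 0" unfolding \<sigma>_def using z N_pos by (subst sum.remove[of _ 0]) auto
      ultimately have "\<sigma> x = ws ! 0" using den_root by simp
      then show ?thesis using ws_vertex[OF N_pos] unfolding complex_vertices_def by auto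
    next
      case False
      then obtain p where p: "p < k" "E (ws ! k) (ws ! p)" "\<And>j. j < k \<Longrightarrow> E (ws ! k) (ws ! j) \<Longrightarrow> j = p"
        using order k unfolding tree_order_def by blast
      have z: "c i x = 0" if "i \<in> {..<N} - {k} - {p}" for i
      proof (cases "k < i")
        case True
        then show ?thesis using above that by simp
      next
        case False
        then have "i < k" "\<not> E (ws ! k) (ws ! i)" using that p(3) by auto
        then show ?thesis using collapsedD(5)[OF c k(1), of i x] \<open>k \<noteq> 0\<close> k(2) x by simp
      qed
      have split: "(\<Sum>i<N. f i) = f k + f p" if "\<And>i. i \<in> {..<N} - {k} - {p} \<Longrightarrow> f i = 0" for f :: "nat \<Rightarrow> 'b::real_vector"
      proof -
        have "sum f {..<N} = f k + (f p + sum f ({..<N} - {k} - {p}))"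
          using k(1) p(1) by (simp add: sum.remove[of "{..<N}" k] sum.remove[of "{..<N} - {k}" p])
        then show ?thesis using that by simp
      qed
      have "dn k * c k x + dn p * c p x = 1" using s1 split[of "\<lambda>i. dn i * c i x"] z by simp
      moreover have "\<sigma> x = (c k x * dn k) *\<^sub>R ws ! k + (c p x * dn p) *\<^sub>R ws ! p"
        unfolding \<sigma>_def by (rule split) (simp add: z)
      moreover have "0 \<le> c k x" "0 \<le> c p x" using collapsedD(2)[OF c _ x] k(1) p(1) by auto
      ultimately have "edge_coords (ws ! k) (ws ! p) (c k x) (c p x) (\<sigma> x)"
        unfolding edge_coords_def by (simp add: mult.commute)
      then have "\<sigma> x \<in> closed_segment (ws ! k) (ws ! p)" by (rule edge_coords_in_segment)
      then show ?thesis using adj_in_complex[OF p(2)] by blast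
    qed
  qed
  have PC: "P \<subseteq> unit_cube"
  proof
    fix x assume "x \<in> P"
    then have "x \<in> (\<Union>(a,b)\<in>{(a,b). E a b}. closed_segment a b)" using Union_complex neighbour by blast
    then show "x \<in> unit_cube" using edge_in_cube by blast
  qed
  have "ipl (\<lambda>x. \<sigma> x $ l)" for l
  proof -
    \<comment> \<open>The homogenized vertices are integral, so the coordinates of the map are
      integral combinations of the weights.\<close>
    have "dn i * ws ! i $ l \<in> \<int>" if "i < N" for i
      using den_properties(2)[OF rational_vertex[OF ws_vertex[OF that]]] unfolding int_vec_def by simp
    then have "ipl (\<lambda>x. \<Sum>i<N. (dn i * ws ! i $ l) * c i x)"
      by (intro ipl_sum ipl_scale collapsedD(1)[OF c]) auto
    moreover have "\<sigma> x $ l = (\<Sum>i<N. (dn i * ws ! i $ l) * c i x)" for x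
      unfolding \<sigma>_def by (simp add: sum_component mult.commute mult.left_commute)
    ultimately show ?thesis by simp
  qed
  moreover have "\<sigma> ` unit_cube \<subseteq> unit_cube" using into PC by blast
  ultimately have "z_map unit_cube unit_cube \<sigma>" by (rule z_map_if_ipl)
  moreover have "\<sigma> ` unit_cube = P"
  proof
    show "\<sigma> ` unit_cube \<subseteq> P" using into by blast
    show "P \<subseteq> \<sigma> ` unit_cube"
    proof
      fix x assume x: "x \<in> P"
      show "x \<in> \<sigma> ` unit_cube" using fixed[OF x] subsetD[OF PC x] by (intro image_eqI[of _ _ x]) simp_all
    qed
  qed
  moreover have "\<forall>x\<in>unit_cube. \<sigma> (\<sigma> x) = \<sigma> x" by (intro ballI fixed into)
  ultimately show ?thesis unfolding z_retract_def z_retraction_def by blast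
qed

end

section \<open>The characterization\<close>

lemma int_vec_extreme_point_unit_cube:
  fixes v :: "real ^ 'n"
  assumes "v extreme_point_of (unit_cube :: (real ^ 'n) set)"
  shows "int_vec v"
proof -
  have "v \<in> {x :: real ^ 'n. \<forall>i. x $ i = 0 \<or> x $ i = 1}"
    using assms unfolding unit_cube_convex_hull by (rule extreme_point_of_convex_hull)
  then have "v $ i = 0 \<or> v $ i = 1" for i by blast
  then show ?thesis unfolding int_vec_def by (metis Ints_0 Ints_1)
qed

context
  fixes P :: "(real ^ 'n) set" and \<C>
  assumes fin: "finite \<C>" and simp_C: "\<And>S. S \<in> \<C> \<Longrightarrow> is_simplex S" and UC: "\<Union>\<C> = P"
    and dim_C: "\<And>S. S \<in> \<C> \<Longrightarrow> aff_dim S \<le> 1" and ex_dim: "\<exists>S\<in>\<C>. aff_dim S = 1"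
begin

lemma compact_convex_simplices: "S \<in> \<C> \<Longrightarrow> compact S" "S \<in> \<C> \<Longrightarrow> convex S"
  using simp_C compact_simplex convex_simplex unfolding is_simplex_def by blast+

lemma aff_dim_convex_subset: "convex S \<Longrightarrow> S \<subseteq> P \<Longrightarrow> aff_dim S \<le> 1"
  using aff_dim_convex_subset_Union[OF fin dim_C] UC by simp

lemma infinite_polyhedron: "infinite P"
proof -
  obtain S where S: "S \<in> \<C>" "aff_dim S = 1" using ex_dim by blast
  have "infinite S"
    by (rule convex_aff_dim_le_1_cases[OF compact_convex_simplices[OF S(1)]])
      (use S(2) in \<open>auto simp: finite_closed_segment\<close>)
  moreover have "S \<subseteq> P" using S(1) UC by blast
  ultimately show ?thesis using infinite_super by blast
qed

lemma graph_complex_triangulation: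
  assumes "triangulates \<K> P"
  shows "graph_complex \<K>"
proof
  show "simplicial_complex \<K>" using assms unfolding triangulates_def by blast
  show "aff_dim X \<le> 1" if "X \<in> \<K>" for X
  proof (rule aff_dim_convex_subset)
    show "convex X" using that assms convex_simplex unfolding triangulates_def simplicial_complex_def by blast
    show "X \<subseteq> P" using that assms unfolding triangulates_def by blast
  qed
qed

lemma ex_triangulation: "\<exists>\<K>. triangulates \<K> P"
proof -
  define W where "W = (\<Union>S\<in>\<C>. \<Union>S'\<in>\<C>. {v. v extreme_point_of (S \<inter> S')})"
  have "finite {v. v extreme_point_of (S \<inter> S')}" if S: "S \<in> \<C>" "S' \<in> \<C>" for S S'
  proof (rule finite_extreme_points_dim_1)
    show "compact (S \<inter> S')" "convex (S \<inter> S')"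
      using compact_convex_simplices S by (auto simp: compact_Int convex_Int)
    show "aff_dim (S \<inter> S') \<le> 1" using aff_dim_subset[of "S \<inter> S'" S] dim_C[OF S(1)] by simp
  qed
  then have "finite W" unfolding W_def using fin by blast
  interpret segment_cover \<C> W
  proof
    show "W \<subseteq> \<Union>\<C>" unfolding W_def extreme_point_of_def by blast
    show "v \<in> W" if "S \<in> \<C>" "S' \<in> \<C>" "v extreme_point_of (S \<inter> S')" for S S' v
      using that unfolding W_def by blast
  qed (use fin compact_convex_simplices dim_C \<open>finite W\<close> in auto)
  show ?thesis using triangulates_segment_complex UC by auto
qed

lemma tree_if_simply_connected:
  assumes con: "connected P" and sc: "simply_connected P"
  shows "tree P"
proof -
  obtain \<K> where K: "triangulates \<K> P" using ex_triangulation by blast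
  then interpret graph_complex \<K> by (rule graph_complex_triangulation)
  have UK: "\<Union>\<K> = P" using K unfolding triangulates_def by blast
  have "bridges E" using bridges_if_simply_connected sc UK by simp
  then have "\<not> (\<exists>vs. length vs \<ge> 3 \<and> distinct vs \<and> (\<forall>i<length vs. E (vs ! i) (vs ! (Suc i mod length vs))))"
    using adj_sym by (rule bridges_imp_no_cycle)
  moreover have "\<forall>u\<in>V. \<forall>v\<in>V. E\<^sup>*\<^sup>* u v" using vertex_connected con UK by simp
  moreover have "V \<noteq> {}"
  proof -
    have "P \<noteq> {}" using infinite_polyhedron by auto
    then obtain X where "X \<in> \<K>" "X \<noteq> {}" using UK by auto
    then show ?thesis using complex_cases adj_vertex by blast
  qed
  ultimately show ?thesis unfolding tree_def using K dim_le_1 by blast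
qed

lemma contractible_if_tree:
  assumes "tree P" shows "contractible P"
proof -
  obtain \<K> where K: "triangulates \<K> P" "\<forall>S\<in>\<K>. aff_dim S \<le> 1" "complex_vertices \<K> \<noteq> {}"
    "\<forall>u\<in>complex_vertices \<K>. \<forall>v\<in>complex_vertices \<K>. (complex_adj \<K>)\<^sup>*\<^sup>* u v"
    and nc: "\<not> (\<exists>vs. length vs \<ge> 3 \<and> distinct vs \<and>
             (\<forall>i<length vs. complex_adj \<K> (vs ! i) (vs ! (Suc i mod length vs))))"
    using assms unfolding tree_def by blast
  interpret graph_complex \<K> using K(1) by (rule graph_complex_triangulation)
  have "bridges E" using nc adj_sym adj_irrefl by (rule no_cycle_imp_bridges)
  then have "contractible (\<Union>\<K>)" using K(3,4) by (intro contractible_if_bridges) auto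
  then show ?thesis using K(1) unfolding triangulates_def by simp
qed

lemma z_retract_imp:
  assumes "z_retract P unit_cube"
  shows "contractible P" "\<exists>v\<in>P. v extreme_point_of (unit_cube :: (real ^ 'n) set)"
    "\<exists>\<K>. triangulates \<K> P \<and> strongly_regular_complex \<K>"
proof -
  obtain \<sigma> where \<sigma>: "z_map unit_cube unit_cube \<sigma>" "\<forall>x\<in>unit_cube. \<sigma> (\<sigma> x) = \<sigma> x" "\<sigma> ` unit_cube = P"
    using assms unfolding z_retract_def z_retraction_def by blast
  obtain \<K> where K: "triangulates \<K> unit_cube"
    "\<forall>T\<in>\<K>. \<exists>(M :: real ^ 'n ^ 'n) b. (\<forall>i j. M $ i $ j \<in> \<int>) \<and> (\<forall>i. b $ i \<in> \<int>) \<and> (\<forall>x\<in>T. \<sigma> x = M *v x + b)"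
    using \<sigma>(1) unfolding z_map_def by blast
  interpret z_retraction_dim_1 P \<sigma> \<K> \<C>
  proof
    show "\<exists>(M :: real ^ 'n ^ 'n) b. (\<forall>i j. M $ i $ j \<in> \<int>) \<and> int_vec b \<and> (\<forall>x\<in>T. \<sigma> x = M *v x + b)" if "T \<in> \<K>" for T
      using bspec[OF K(2) that] unfolding int_vec_def .
    show "\<sigma> x = x" if "x \<in> P" for x using that \<sigma>(2,3) by blast
    show "P \<subseteq> unit_cube" using \<sigma>(1,3) unfolding z_map_def by blast
    show "infinite P" by (rule infinite_polyhedron)
  qed (use K(1) \<sigma>(3) fin UC compact_convex_simplices dim_C in auto)
  show "contractible P" by (rule contractible_P)
  show "\<exists>v\<in>P. v extreme_point_of (unit_cube :: (real ^ 'n) set)" by (rule contains_vertex)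
  show "\<exists>\<K>. triangulates \<K> P \<and> strongly_regular_complex \<K>" by (rule strongly_regular_triangulation)
qed

lemma z_retract_if:
  assumes con: "contractible P" and v: "v \<in> P" "v extreme_point_of (unit_cube :: (real ^ 'n) set)"
    and K: "triangulates \<K> P" "strongly_regular_complex \<K>"
  shows "z_retract P unit_cube"
proof -
  interpret graph_complex \<K> using K(1) by (rule graph_complex_triangulation)
  have UK: "\<Union>\<K> = P" using K(1) unfolding triangulates_def by blast
  have regular: "regular_simplex X" if "X \<in> \<K>" for X
    using that K(2) unfolding strongly_regular_complex_def regular_complex_def by blast
  have conP: "connected (\<Union>\<K>)" using con UK contractible_imp_connected by simp
  have ne: "\<Union>\<K> \<noteq> {w}" for w using infinite_polyhedron UK by auto
  interpret regular_graph \<K>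
  proof
    show "regular_simplex X" if "X \<in> \<K>" for X using regular[OF that] .
    show "\<exists>u. E w u" if "w \<in> V" for w using no_isolated_vertex[OF conP that ne] by metis
  qed
  have br: "bridges E" using bridges_if_simply_connected contractible_imp_simply_connected[OF con] UK by simp
  \<comment> \<open>An extreme point of the cube is extreme in every subset containing it, hence a
    vertex of any triangulation of P.\<close>
  have vV: "v \<in> V"
  proof -
    obtain X where X: "X \<in> \<K>" "v \<in> X" using v(1) UK by blast
    have "X \<subseteq> unit_cube" using regular[OF X(1)] unfolding regular_simplex_def by blast
    then have "v extreme_point_of X" using v(2) X(2) unfolding extreme_point_of_def by blast
    then have "{v} \<in> \<K>" using face_in_complex[OF X(1)] by (simp add: face_of_singleton)
    then show ?thesis unfolding complex_vertices_def by blast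
  qed
  obtain ws where ws: "tree_order E ws" "set ws = V" "ws ! 0 = v"
  proof (rule ex_tree_order[of E V v])
    show "\<And>u v. E u v \<Longrightarrow> E v u" by (rule adj_sym)
    show "\<And>u v. E u v \<Longrightarrow> u \<in> V" by (rule adj_vertex)
    show "\<And>w. w \<in> V \<Longrightarrow> E\<^sup>*\<^sup>* v w" by (rule vertex_connected[OF conP vV])
  qed (use br adj_irrefl finite_vertices vV in auto)
  interpret regular_tree \<K> ws
  proof
    fix a b assume ab: "E a b"
    \<comment> \<open>Edges are maximal in a complex of dimension 1, so the gcd condition applies to
      each of them.\<close>
    have "T = closed_segment a b" if T: "T \<in> \<K>" "closed_segment a b \<subseteq> T" for T
      using T(1)
    proof (cases rule: complex_cases)
      case (2 w)
      then have "a = w" "b = w" using T(2) by auto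
      then show ?thesis using ab adj_irrefl by blast
    next
      case (3 c d)
      then show ?thesis using closed_segment_adj_eq[OF ab 3(1)] T(2) by simp
    qed (use T(2) in auto)
    then have "Gcd (den ` vertices (closed_segment a b)) = 1"
      using K(2) adj_in_complex[OF ab] unfolding strongly_regular_complex_def by blast
    then show "coprime (den a) (den b)" unfolding vertices_closed_segment by (simp add: coprime_iff_gcd_eq_1)
  next
    show "den (ws ! 0) = 1" unfolding ws(3) using v(2) by (intro den_int_vec int_vec_extreme_point_unit_cube)
  qed (use ws in auto)
  show ?thesis using z_retract_cube UK by simp
qed

end

theorem corollary4p4:
  fixes P :: "(real ^ 'n) set"
  assumes "cube_polyhedron P" and "polyhedron_has_dim P 1"
  shows "(z_retract P unit_cube \<longleftrightarrow>
            contractible P \<and>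
            (\<exists>v\<in>P. v extreme_point_of (unit_cube :: (real ^ 'n) set)) \<and>
            (\<exists>\<K>. triangulates \<K> P \<and> strongly_regular_complex \<K>))
         \<and> (contractible P \<longleftrightarrow> connected P \<and> simply_connected P)
         \<and> (connected P \<and> simply_connected P \<longleftrightarrow> tree P)"
proof -
  obtain \<C> where C: "finite \<C>" "\<And>S. S \<in> \<C> \<Longrightarrow> is_simplex S" "\<Union>\<C> = P"
    "\<And>S. S \<in> \<C> \<Longrightarrow> aff_dim S \<le> 1" "\<exists>S\<in>\<C>. aff_dim S = 1"
    using assms(2) unfolding polyhedron_has_dim_def by auto
  have 1: "z_retract P unit_cube \<longleftrightarrow> contractible P \<and>
            (\<exists>v\<in>P. v extreme_point_of (unit_cube :: (real ^ 'n) set)) \<and>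
            (\<exists>\<K>. triangulates \<K> P \<and> strongly_regular_complex \<K>)"
    using z_retract_imp[OF C] z_retract_if[OF C] by metis
  have 2: "connected P \<and> simply_connected P" if "contractible P"
    using that contractible_imp_connected contractible_imp_simply_connected by blast
  have 3: "tree P" if "connected P \<and> simply_connected P"
    using that tree_if_simply_connected[OF C] by blast
  have 4: "contractible P" if "tree P" using that contractible_if_tree[OF C] by blast
  show ?thesis using 1 2 3 4 by metis
qed

end
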